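(* Consider the latent block model (LBM) or the stochastic block model (SBM) with true parameter $\theta^\star=(\boldsymbol\mu^\star,\boldsymbol\pi^\star)\in\Theta$, and assume (all defined in the context) identifiability, symmetry, the concentration inequality, bounded Kullback--Leibler divergences, the Lipschitz condition with constant $L_0$, and the asymptotic setup for $m=m_n$. Assume moreover that $\mathfrak S=\{(\mathrm{Id},\mathrm{Id})\}$. Let $c=\mu_{\min}^2\kappa_{\min}/16$, $C=2\kappa_{\max}$, $K=\log(\alpha_{\max}/\alpha_{\min})\vee\log(\beta_{\max}/\beta_{\min})$. Then for any small enough $\eta>0$ (namely $\eta\in(0,c/(2L_0))$) there exist positive reals $\{\varepsilon_{n,m}\}$ with $\sum_n\varepsilon_{n,m_n}<+\infty$ and a set $\Omega_1$ with $\mathbb P_\star(\Omega_1)\ge1-\varepsilon_{n,m}$ such that on $\Omega_1$, for any $\theta=(\boldsymbol\mu,\boldsymbol\pi)\in\Theta$ satisfying $\|\boldsymbol\pi-\boldsymbol\pi^\star\|_\infty\le\eta$, $$p^\theta_{n,m}(\mathbf Z_n,\mathbf W_m)\ge1-a_{n,m}\exp(a_{n,m})\quad\text{and}\quad p^\theta_{n,m}(\mathbf Z_n,\mathbf W_m)\le\big(1+b_{n,m}e^{b_{n,m}}\big)^{-1},$$ where $$\begin{cases}a_{n,m}=ne^{-(c-2L_0\eta)m+K}+me^{-(c-2L_0\eta)n+K},\quad b_{n,m}=ne^{-Cm-K}+me^{-Cn-K}&\text{(LBM)},\\ a_{n,n}=ne^{-2n(c-2L_0\eta)+K},\quad b_{n,n}=ne^{-2Cn-K}&\text{(SBM)},\end{cases}$$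 all converge to $0$ as $n\to+\infty$. As a consequence, for the maximum a posteriori procedure $(\widehat{\mathbf Z}_n,\widehat{\mathbf W}_m):=\arg\max_{(\mathbf z_n,\mathbf w_m)\in\mathcal U}p^{\hat\theta}_{n,m}(\mathbf z_n,\mathbf w_m)$ at a parameter value $\hat\theta=(\hat{\boldsymbol\mu},\hat{\boldsymbol\pi})$ such that $\hat{\boldsymbol\pi}\to\boldsymbol\pi^\star$, the number of misclassified rows and/or columns on the set $\Omega_1$, $$\sum_{i=1}^n1\{\hat Z_i\ne Z_i\}+\sum_{j=1}^m1\{\hat W_j\ne W_j\}\ \text{(LBM)}\quad\text{or}\quad\sum_{i=1}^n1\{\hat Z_i\ne Z_i\}\ \text{(SBM)},$$ is exactly $0$ for large enough $n$.
   Context: Model. Let $Q,L\ge1$, $\mathcal Q=\{1,\dots,Q\}$, $\mathcal L=\{1,\dots,L\}$, $\boldsymbol\alpha=(\alpha_q)$ and $\boldsymbol\beta=(\beta_l)$ probability distributions with positive weights on $\mathcal Q$ and $\mathcal L$. $\mathbf Z_n=(Z_1,\dots,Z_n)$ is i.i.d. with law $\boldsymbol\alpha$, $\mathbf W_m=(W_1,\dots,W_m)$ is i.i.d. with law $\boldsymbol\beta$. LBM: $\mathbf Z_n$ and $\mathbf W_m$ are independent, $\mathcal I=\{1,\dots,n\}\times\{1,\dots,m\}$, $\boldsymbol\mu=\boldsymbol\alpha^{\otimes n}\otimes\boldsymbol\beta^{\otimes m}$, $\mathcal U=\mathcal Q^n\times\mathcal L^m$. SBM: $n=m$, $\mathcal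 Q=\mathcal L$, $\boldsymbol\alpha=\boldsymbol\beta$, $Z_i=W_i$ for all $i$, $\boldsymbol\mu=\boldsymbol\alpha^{\otimes n}$, and $\mathcal U$ is the set of pairs $(\mathbf z_n,\mathbf w_n)$ with $\mathbf z_n=\mathbf w_n\in\mathcal Q^n$. Here $\mathcal I=\{1,\dots,n\}^2$ (the data are the adjacency matrix of a random graph); as particular cases one may also consider graphs with no self-loops, in which case $\mathcal I=\{1,\dots,n\}^2\setminus\{(i,i):1\le i\le n\}$, or undirected graphs, possibly with no self-loops, by imposing $X_{ij}=X_{ji}$, in which latter case $\mathcal I=\{(i,j):1\le i<j\le n\}$. Let $\boldsymbol\pi=(\pi_{ql})_{(q,l)\in\mathcal Q\times\mathcal L}$ belong to a set of matrices $\Pi_{\mathcal Q\mathcal L}$ with entries in a set $\Pi$. Conditionally on $(\mathbf Z_n,\mathbf W_m)$ the observations $\mathbf X_{n,m}=(X_{ij})_{(i,j)\in\mathcal I}$ (values in $\mathcal X$) are independent and, given $(Z_i,W_j)=(q,l)$, $X_{ij}$ has density $f(\cdot;\pi_{ql})$ (w.r.t. counting or Lebesgue measure). The parameter set is $\Theta=\{\theta=(\boldsymbol\mu,\boldsymbol\pi):\boldsymbol\pi\in\Pi_{\mathcal Q\mathcal L},\ \alpha_q\ge\alpha_{\min}>0,\ \beta_l\ge\beta_{\min}>0\ \forall (q,l)\}$; $\alpha_{\max}$, $\beta_{\max}$ are the maxima of $\alpha_q$, $\beta_l$ over $q$, $l$ and $\theta\in\Theta$; $\mu_{\min}=\alpha_{\min}\wedge\beta_{\min}$.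 $\mathbb P_\theta$ is the distribution under $\theta$; $\mathbb P_\star,\mathbb E_\star$ are probability and expectation under the true $\theta^\star$; $\mathbb P_\star^{\mathbf z^\star\mathbf w^\star},\mathbb E_\star^{\mathbf z^\star\mathbf w^\star}$ are those conditional on $(\mathbf Z_n,\mathbf W_m)=(\mathbf z^\star_n,\mathbf w^\star_m)$. $\|\boldsymbol\pi\|_\infty$ is the maximum of the entries' absolute values. Posterior: $p^\theta_{n,m}(\mathbf z_n,\mathbf w_m):=\mathbb P_\theta((\mathbf Z_n,\mathbf W_m)=(\mathbf z_n,\mathbf w_m)\mid\mathbf X_{n,m})$. Equivalence. $\mathfrak S_{\mathcal Q\mathcal L}$ is $\mathfrak S_Q\times\mathfrak S_L$ (LBM) or $\{(s,s):s\in\mathfrak S_Q\}$ (SBM), where $\mathfrak S_Q,\mathfrak S_L$ are the permutation groups of $\mathcal Q,\mathcal L$; $\boldsymbol\pi^{s,t}:=(\pi_{s(q)t(l)})_{q,l}$. Permutations act entrywise on $\mathbf z_n$, $\mathbf w_m$. For the subgroup $\mathfrak S$ of the symmetry assumption below, $(\mathbf z_n,\mathbf w_m)\sim(\mathbf z'_n,\mathbf w'_m)$ iff $(s(\mathbf z'_n),t(\mathbf w'_m))=(\mathbf z_n,\mathbf w_m)$ for some $(s,t)\in\mathfrak S$; $\tilde{\mathcal U}=\mathcal U/\sim$. With $\|u\|_0$ the number of nonzero coordinates, $d((\mathbf z_n,\mathbf w_m),(\mathbf z'_n,\mathbf w'_m)):=\min\{\|\mathbf z_n-s(\mathbf z'_n)\|_0+\|\mathbf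 w_m-t(\mathbf w'_m)\|_0:(s,t)\in\mathfrak S\}$. $\mathcal U^0$ is the set of $(\mathbf z_n,\mathbf w_m)\in\mathcal U$ such that each $q\in\mathcal Q$ appears at least $n\mu_{\min}/2$ times in $\mathbf z_n$ and each $l\in\mathcal L$ at least $m\mu_{\min}/2$ times in $\mathbf w_m$; $\tilde{\mathcal U}^0$ is its image in $\tilde{\mathcal U}$. Notation: $\delta^{\boldsymbol\pi}(\mathbf z^\star_n,\mathbf w^\star_m,\mathbf z_n,\mathbf w_m)=\sum_{(i,j)\in\mathcal I}\log\frac{f(X_{ij};\pi_{z^\star_iw^\star_j})}{f(X_{ij};\pi_{z_iw_j})}$; $D(\pi\|\pi')=\int_{\mathcal X}\log\frac{f(x;\pi)}{f(x;\pi')}f(x;\pi)\,dx$; $\kappa_{\min}=\min\{D(\pi^\star_{ql}\|\pi^\star_{q'l'}):(q,l),(q',l')\in\mathcal Q\times\mathcal L,\ \pi^\star_{ql}\ne\pi^\star_{q'l'}\}>0$. Assumptions. Identifiability: $f(\cdot;\pi)=f(\cdot;\pi')\Rightarrow\pi=\pi'$; for all $q\ne q'$ there is $l$ with $\pi_{ql}\ne\pi_{q'l}$, and for all $l\ne l'$ there is $q$ with $\pi_{ql}\ne\pi_{ql'}$. Symmetry: there is a (maximal) subgroup $\mathfrak S$ of $\mathfrak S_{\mathcal Q\mathcal L}$ with $\boldsymbol\pi^{s,t}=\boldsymbol\pi$ for all $(s,t)\in\mathfrak S$, $\boldsymbol\pi\in\Pi_{\mathcal Q\mathcal L}$, and $\boldsymbol\pi^{s,t}\ne\boldsymbol\pi$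 for all $(s,t)\in\mathfrak S_{\mathcal Q\mathcal L}\setminus\mathfrak S$, $\boldsymbol\pi\in\Pi_{\mathcal Q\mathcal L}$. Concentration inequality: fix $(\mathbf z^\star_n,\mathbf w^\star_m)\in\tilde{\mathcal U}^0$ and $(\mathbf z_n,\mathbf w_m)\in\tilde{\mathcal U}$ such that $(\mathbf z_n,\mathbf w_m)\not\sim(\mathbf z^\star_n,\mathbf w^\star_m)$. There exists some positive function $\psi^\star:(0,+\infty)\to(0,+\infty]$ such that for any $\boldsymbol\pi\in\Pi_{\mathcal Q\mathcal L}$ and any $\varepsilon>0$, $\mathbb P_\star^{\mathbf z^\star\mathbf w^\star}\big(|\delta^{\boldsymbol\pi}-\mathbb E_\star^{\mathbf z^\star\mathbf w^\star}(\delta^{\boldsymbol\pi})|\ge\varepsilon(mr_1+nr_2)\big)\le2\exp[-\psi^\star(\varepsilon)(mr_1+nr_2)]$, where $\delta^{\boldsymbol\pi}=\delta^{\boldsymbol\pi}(\mathbf z^\star_n,\mathbf w^\star_m,\mathbf z_n,\mathbf w_m)$, $r_1=\|\mathbf z^\star_n-s(\mathbf z_n)\|_0$, $r_2=\|\mathbf w^\star_m-t(\mathbf w_m)\|_0$ and $(s,t)\in\mathfrak S$ attains $d((\mathbf z^\star_n,\mathbf w^\star_m),(\mathbf z_n,\mathbf w_m))$. Bounded Kullback--Leibler divergences: $\kappa_{\max}:=\max\{D(\pi\|\pi'):\pi,\pi'\in\Pi\}<+\infty$. Lipschitz condition: there is $L_0>0$ with $\big|\int_{\mathcal X}\log\frac{f(x;\pi_{ql})}{f(x;\pi'_{ql})}f(x;\pi_{q'l'})\,dx\big|\le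 L_0\|\boldsymbol\pi-\boldsymbol\pi'\|_\infty$ for all $\boldsymbol\pi,\boldsymbol\pi'\in\Pi_{\mathcal Q\mathcal L}$ and all $(q,l),(q',l')$. Asymptotic setup: $m=m_n\to+\infty$ with $m_n\le n$ and $(\log n)/m_n\to0$ (for SBM, $m_n=n$).
   Formalization: The concentration inequality is assumed uniformly over π (the supremum over Π_QL is inside the probability), as the pointwise version does not give one Ω₁ for all θ; the upper bound on the posterior is claimed only for Q ≥ 2, since it can fail for Q = 1, L ≥ 2. *)

theory Defs
  imports "HOL-Probability.Probability" "HOL-Algebra.Sym_Groups"
begin

section \<open>The model\<close>

text \<open>The latent block model, or the stochastic block model for graphs with or without self-loops
  (first argument of \<open>SBM\<close>), directed or undirected (second argument).\<close>

datatype variant = LBM | SBM (self_loops: bool) (directed: bool)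

text \<open>\<open>base\<close> is the dominating measure (counting or Lebesgue measure in the applications), its space
  is the space of the observations; \<open>density_fn p\<close> is the density \<open>f(.; p)\<close>; \<open>entry_set\<close> is the set
  \<open>\<Pi>\<close> of entries and \<open>conn_set\<close> the set of connectivity matrices. Matrices are functions of which
  only the values at \<open>(q, l)\<close> with \<open>q \<in> {1..nrows}\<close>, \<open>l \<in> {1..ncols}\<close> matter.\<close>

record ('x, 'p) block_model =
  variant :: variant
  nrows :: nat
  ncols :: nat
  base :: "'x measure"
  density_fn :: "'p \<Rightarrow> 'x \<Rightarrow> real"
  entry_set :: "'p set"
  conn_set :: "(nat \<Rightarrow> nat \<Rightarrow> 'p) set"
  alpha_min :: real
  beta_min :: real

record 'p param =
  alpha :: "nat \<Rightarrow> real"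
  beta :: "nat \<Rightarrow> real"
  conn :: "nat \<Rightarrow> nat \<Rightarrow> 'p"

type_synonym config = "(nat \<Rightarrow> nat) \<times> (nat \<Rightarrow> nat)"

abbreviation rgroups :: "('x, 'p) block_model \<Rightarrow> nat set"
  where "rgroups S \<equiv> {1..nrows S}"

abbreviation cgroups :: "('x, 'p) block_model \<Rightarrow> nat set"
  where "cgroups S \<equiv> {1..ncols S}"

definition valid_model :: "('x, 'p) block_model \<Rightarrow> bool" where
  "valid_model S \<longleftrightarrow>
     nrows S \<ge> 1 \<and> ncols S \<ge> 1 \<and> alpha_min S > 0 \<and> beta_min S > 0 \<and>
     (\<forall>\<pi>\<in>conn_set S. \<forall>q\<in>rgroups S. \<forall>l\<in>cgroups S. \<pi> q l \<in> entry_set S) \<and>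
     (\<forall>p\<in>entry_set S. density_fn S p \<in> borel_measurable (base S) \<and>
        (\<forall>x\<in>space (base S). density_fn S p x \<ge> 0) \<and>
        (\<integral>\<^sup>+x. ennreal (density_fn S p x) \<partial>base S) = 1) \<and>
     (variant S \<noteq> LBM \<longrightarrow> ncols S = nrows S \<and> beta_min S = alpha_min S) \<and>
     (\<forall>b. variant S = SBM b False \<longrightarrow>
        (\<forall>\<pi>\<in>conn_set S. \<forall>q\<in>rgroups S. \<forall>l\<in>cgroups S. \<pi> q l = \<pi> l q))"

definition Theta :: "('x, 'p) block_model \<Rightarrow> 'p param set" where
  "Theta S = {\<theta>. conn \<theta> \<in> conn_set S \<and>
     (\<forall>q\<in>rgroups S. alpha \<theta> q \<ge> alpha_min S) \<and> (\<Sum>q\<in>rgroups S. alpha \<theta> q) = 1 \<and>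
     (\<forall>l\<in>cgroups S. beta \<theta> l \<ge> beta_min S) \<and> (\<Sum>l\<in>cgroups S. beta \<theta> l) = 1 \<and>
     (variant S \<noteq> LBM \<longrightarrow> (\<forall>q\<in>rgroups S. beta \<theta> q = alpha \<theta> q))}"

definition mu_min :: "('x, 'p) block_model \<Rightarrow> real" where
  "mu_min S = min (alpha_min S) (beta_min S)"

definition alpha_max :: "('x, 'p) block_model \<Rightarrow> real" where
  "alpha_max S = Sup {alpha \<theta> q | \<theta> q. \<theta> \<in> Theta S \<and> q \<in> rgroups S}"

definition beta_max :: "('x, 'p) block_model \<Rightarrow> real" where
  "beta_max S = Sup {beta \<theta> l | \<theta> l. \<theta> \<in> Theta S \<and> l \<in> cgroups S}"

text \<open>For undirected graphs the observations \<open>X\<^sub>i\<^sub>j = X\<^sub>j\<^sub>i\<close> are indexed once.\<close>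

definition index_set :: "('x, 'p) block_model \<Rightarrow> nat \<Rightarrow> nat \<Rightarrow> (nat \<times> nat) set" where
  "index_set S n m = (case variant S of
      LBM \<Rightarrow> {1..n} \<times> {1..m}
    | SBM loops dir \<Rightarrow> {(i, j) \<in> {1..n} \<times> {1..n}. (i \<noteq> j \<or> loops) \<and> (i \<le> j \<or> dir)})"

definition configs :: "('x, 'p) block_model \<Rightarrow> nat \<Rightarrow> nat \<Rightarrow> config set" where
  "configs S n m = (case variant S of
      LBM \<Rightarrow> ({1..n} \<rightarrow>\<^sub>E rgroups S) \<times> ({1..m} \<rightarrow>\<^sub>E cgroups S)
    | SBM _ _ \<Rightarrow> {(z, w). z \<in> {1..n} \<rightarrow>\<^sub>E rgroups S \<and> w = z})"

definition regular_configs :: "('x, 'p) block_model \<Rightarrow> nat \<Rightarrow> nat \<Rightarrow> config set" where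
  "regular_configs S n m = {(z, w) \<in> configs S n m.
     (\<forall>q\<in>rgroups S. real (card {i\<in>{1..n}. z i = q}) \<ge> real n * mu_min S / 2) \<and>
     (\<forall>l\<in>cgroups S. real (card {j\<in>{1..m}. w j = l}) \<ge> real m * mu_min S / 2)}"

definition prior :: "('x, 'p) block_model \<Rightarrow> nat \<Rightarrow> nat \<Rightarrow> 'p param \<Rightarrow> config \<Rightarrow> real" where
  "prior S n m \<theta> = (\<lambda>(z, w). case variant S of
      LBM \<Rightarrow> (\<Prod>i\<in>{1..n}. alpha \<theta> (z i)) * (\<Prod>j\<in>{1..m}. beta \<theta> (w j))
    | SBM _ _ \<Rightarrow> (\<Prod>i\<in>{1..n}. alpha \<theta> (z i)))"

definition data_space :: "('x, 'p) block_model \<Rightarrow> nat \<Rightarrow> nat \<Rightarrow> (nat \<times> nat \<Rightarrow> 'x) measure" where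
  "data_space S n m = (\<Pi>\<^sub>M ij\<in>index_set S n m. base S)"

text \<open>The law of the observations given the configuration.\<close>

definition cond_law ::
  "('x, 'p) block_model \<Rightarrow> nat \<Rightarrow> nat \<Rightarrow> (nat \<Rightarrow> nat \<Rightarrow> 'p) \<Rightarrow> config \<Rightarrow> (nat \<times> nat \<Rightarrow> 'x) measure" where
  "cond_law S n m \<pi> = (\<lambda>(z, w). \<Pi>\<^sub>M (i, j)\<in>index_set S n m.
     density (base S) (\<lambda>x. ennreal (density_fn S (\<pi> (z i) (w j)) x)))"

definition block_data :: "('x, 'p) block_model \<Rightarrow> nat \<Rightarrow> nat \<Rightarrow> 'p param \<Rightarrow> 'o measure \<Rightarrow>
    ('o \<Rightarrow> config) \<Rightarrow> ('o \<Rightarrow> nat \<times> nat \<Rightarrow> 'x) \<Rightarrow> bool" where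
  "block_data S n m \<theta> M ZW X \<longleftrightarrow>
     ZW \<in> M \<rightarrow>\<^sub>M count_space (configs S n m) \<and> X \<in> M \<rightarrow>\<^sub>M data_space S n m \<and>
     (\<forall>c\<in>configs S n m. \<forall>A\<in>sets (data_space S n m).
        measure M {\<omega>\<in>space M. ZW \<omega> = c \<and> X \<omega> \<in> A} =
        prior S n m \<theta> c * measure (cond_law S n m (conn \<theta>) c) A)"

definition joint_density :: "('x, 'p) block_model \<Rightarrow> nat \<Rightarrow> nat \<Rightarrow> 'p param \<Rightarrow>
    (nat \<times> nat \<Rightarrow> 'x) \<Rightarrow> config \<Rightarrow> real" where
  "joint_density S n m \<theta> x = (\<lambda>(z, w). prior S n m \<theta> (z, w) *
     (\<Prod>(i, j)\<in>index_set S n m. density_fn S (conn \<theta> (z i) (w j)) (x (i, j))))"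

text \<open>The version of the conditional probability of a configuration given \<open>X = x\<close> provided by
  Bayes' formula (see \<open>posterior_cond_prob\<close> below); fixing the version is needed to compare
  uncountably many parameters at one and the same observation.\<close>

definition posterior :: "('x, 'p) block_model \<Rightarrow> nat \<Rightarrow> nat \<Rightarrow> 'p param \<Rightarrow>
    (nat \<times> nat \<Rightarrow> 'x) \<Rightarrow> config \<Rightarrow> real" where
  "posterior S n m \<theta> x c =
     joint_density S n m \<theta> x c / (\<Sum>c'\<in>configs S n m. joint_density S n m \<theta> x c')"

definition is_MAP :: "('x, 'p) block_model \<Rightarrow> nat \<Rightarrow> nat \<Rightarrow> 'p param \<Rightarrow>
    (nat \<times> nat \<Rightarrow> 'x) \<Rightarrow> config \<Rightarrow> bool" where
  "is_MAP S n m \<theta> x c \<longleftrightarrow> is_arg_max (posterior S n m \<theta> x) (\<lambda>c. c \<in> configs S n m) c"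

definition misclassified :: "('x, 'p) block_model \<Rightarrow> nat \<Rightarrow> nat \<Rightarrow> config \<Rightarrow> config \<Rightarrow> nat" where
  "misclassified S n m = (\<lambda>(z', w') (z, w). case variant S of
      LBM \<Rightarrow> card {i\<in>{1..n}. z' i \<noteq> z i} + card {j\<in>{1..m}. w' j \<noteq> w j}
    | SBM _ _ \<Rightarrow> card {i\<in>{1..n}. z' i \<noteq> z i})"


section \<open>Symmetries and equivalent configurations\<close>

definition group_perms :: "('x, 'p) block_model \<Rightarrow> ((nat \<Rightarrow> nat) \<times> (nat \<Rightarrow> nat)) set" where
  "group_perms S = (case variant S of
      LBM \<Rightarrow> {s. s permutes rgroups S} \<times> {t. t permutes cgroups S}
    | SBM _ _ \<Rightarrow> {(s, s) | s. s permutes rgroups S})"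

definition fixes_conn ::
  "('x, 'p) block_model \<Rightarrow> (nat \<Rightarrow> nat) \<times> (nat \<Rightarrow> nat) \<Rightarrow> (nat \<Rightarrow> nat \<Rightarrow> 'p) \<Rightarrow> bool" where
  "fixes_conn S = (\<lambda>(s, t) \<pi>. \<forall>q\<in>rgroups S. \<forall>l\<in>cgroups S. \<pi> (s q) (t l) = \<pi> q l)"

definition equivalent ::
  "((nat \<Rightarrow> nat) \<times> (nat \<Rightarrow> nat)) set \<Rightarrow> nat \<Rightarrow> nat \<Rightarrow> config \<Rightarrow> config \<Rightarrow> bool" where
  "equivalent G n m = (\<lambda>(z, w) (z', w').
     \<exists>(s, t)\<in>G. (\<forall>i\<in>{1..n}. s (z' i) = z i) \<and> (\<forall>j\<in>{1..m}. t (w' j) = w j))"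

text \<open>\<open>moved n z s z'\<close> is \<open>\<parallel>z - s(z')\<parallel>\<^sub>0\<close>.\<close>

definition moved :: "nat \<Rightarrow> (nat \<Rightarrow> nat) \<Rightarrow> (nat \<Rightarrow> nat) \<Rightarrow> (nat \<Rightarrow> nat) \<Rightarrow> nat" where
  "moved n z s z' = card {i\<in>{1..n}. z i \<noteq> s (z' i)}"

definition config_dist ::
  "((nat \<Rightarrow> nat) \<times> (nat \<Rightarrow> nat)) set \<Rightarrow> nat \<Rightarrow> nat \<Rightarrow> config \<Rightarrow> config \<Rightarrow> nat" where
  "config_dist G n m = (\<lambda>(z, w) (z', w'). Min {moved n z s z' + moved m w t w' | s t. (s, t) \<in> G})"


section \<open>Divergences\<close>

text \<open>Logarithms of densities take the value \<open>-\<infinity>\<close> where the density vanishes. In \<^typ>\<open>ereal\<close>, a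
  log-ratio of the form \<open>0/0\<close> is \<open>\<infinity>\<close>; weighted by a vanishing density it contributes \<open>0\<close>.\<close>

definition elog :: "real \<Rightarrow> ereal" where
  "elog y = (if y = 0 then - \<infinity> else ereal (ln y))"

text \<open>The Lebesgue integral of an extended real function, with values in \<open>[-\<infinity>, \<infinity>]\<close>.\<close>

definition xintegral :: "'a measure \<Rightarrow> ('a \<Rightarrow> ereal) \<Rightarrow> ereal" where
  "xintegral M g =
     enn2ereal (\<integral>\<^sup>+x. e2ennreal (g x) \<partial>M) - enn2ereal (\<integral>\<^sup>+x. e2ennreal (- g x) \<partial>M)"

definition mean_log_ratio :: "('x, 'p) block_model \<Rightarrow> 'p \<Rightarrow> 'p \<Rightarrow> 'p \<Rightarrow> ereal" where
  "mean_log_ratio S p p' p'' = xintegral (base S)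
     (\<lambda>x. (elog (density_fn S p x) - elog (density_fn S p' x)) * ereal (density_fn S p'' x))"

definition KL :: "('x, 'p) block_model \<Rightarrow> 'p \<Rightarrow> 'p \<Rightarrow> ereal" where
  "KL S p p' = mean_log_ratio S p p' p"

definition kappa_max :: "('x, 'p) block_model \<Rightarrow> ereal" where
  "kappa_max S = Sup {KL S p p' | p p'. p \<in> entry_set S \<and> p' \<in> entry_set S}"

text \<open>A minimum, since the set is finite. The set is empty only if there is a single block; the
  value is then \<open>\<infinity>\<close>.\<close>

definition kappa_min :: "('x, 'p) block_model \<Rightarrow> (nat \<Rightarrow> nat \<Rightarrow> 'p) \<Rightarrow> ereal" where
  "kappa_min S \<pi> = Inf {KL S (\<pi> q l) (\<pi> q' l') | q l q' l'.
     q \<in> rgroups S \<and> l \<in> cgroups S \<and> q' \<in> rgroups S \<and> l' \<in> cgroups S \<and> \<pi> q l \<noteq> \<pi> q' l'}"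

definition log_lik_ratio :: "('x, 'p) block_model \<Rightarrow> nat \<Rightarrow> nat \<Rightarrow> (nat \<Rightarrow> nat \<Rightarrow> 'p) \<Rightarrow>
    config \<Rightarrow> config \<Rightarrow> (nat \<times> nat \<Rightarrow> 'x) \<Rightarrow> ereal" where
  "log_lik_ratio S n m \<pi> = (\<lambda>(z', w') (z, w) x. \<Sum>(i, j)\<in>index_set S n m.
     elog (density_fn S (\<pi> (z' i) (w' j)) (x (i, j))) -
     elog (density_fn S (\<pi> (z i) (w j)) (x (i, j))))"

definition conn_dist :: "('x, 'p::real_normed_vector) block_model \<Rightarrow>
    (nat \<Rightarrow> nat \<Rightarrow> 'p) \<Rightarrow> (nat \<Rightarrow> nat \<Rightarrow> 'p) \<Rightarrow> real" where
  "conn_dist S \<pi> \<pi>' = Max {norm (\<pi> q l - \<pi>' q l) | q l. q \<in> rgroups S \<and> l \<in> cgroups S}"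


section \<open>Assumptions\<close>

definition identifiability :: "('x, 'p) block_model \<Rightarrow> bool" where
  "identifiability S \<longleftrightarrow>
     (\<forall>p\<in>entry_set S. \<forall>p'\<in>entry_set S.
        (\<forall>x\<in>space (base S). density_fn S p x = density_fn S p' x) \<longrightarrow> p = p') \<and>
     (\<forall>\<pi>\<in>conn_set S.
        (\<forall>q\<in>rgroups S. \<forall>q'\<in>rgroups S. q \<noteq> q' \<longrightarrow> (\<exists>l\<in>cgroups S. \<pi> q l \<noteq> \<pi> q' l)) \<and>
        (\<forall>l\<in>cgroups S. \<forall>l'\<in>cgroups S. l \<noteq> l' \<longrightarrow> (\<exists>q\<in>rgroups S. \<pi> q l \<noteq> \<pi> q l')))"

definition symmetry_group ::
  "('x, 'p) block_model \<Rightarrow> ((nat \<Rightarrow> nat) \<times> (nat \<Rightarrow> nat)) set \<Rightarrow> bool" where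
  "symmetry_group S G \<longleftrightarrow>
     subgroup G (sym_group (nrows S) \<times>\<times> sym_group (ncols S)) \<and> G \<subseteq> group_perms S \<and>
     (\<forall>\<pi>\<in>conn_set S. (\<forall>\<sigma>\<in>G. fixes_conn S \<sigma> \<pi>) \<and> (\<forall>\<sigma>\<in>group_perms S - G. \<not> fixes_conn S \<sigma> \<pi>))"

definition exp_minus :: "ereal \<Rightarrow> real" where
  "exp_minus y = (if y = \<infinity> then 0 else exp (- real_of_ereal y))"

text \<open>The deviations are controlled simultaneously for all matrices in \<open>conn_set S\<close>, by one and the
  same rate \<open>\<psi>\<close> for all \<open>n\<close> and all configurations. The event \<open>A\<close> only serves to
  measure the possibly non-measurable set of observations for which some matrix deviates.
  Configurations stand for their equivalence classes.\<close>

definition concentration :: "('x, 'p) block_model \<Rightarrow> ((nat \<Rightarrow> nat) \<times> (nat \<Rightarrow> nat)) set \<Rightarrow>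
    (nat \<Rightarrow> nat) \<Rightarrow> (nat \<Rightarrow> nat \<Rightarrow> 'p) \<Rightarrow> (real \<Rightarrow> ereal) \<Rightarrow> bool" where
  "concentration S G m \<pi>\<^sub>0 \<psi> \<longleftrightarrow>
     (\<forall>\<epsilon>>0. \<psi> \<epsilon> > 0) \<and>
     (\<forall>n\<ge>1. \<forall>(z\<^sub>0, w\<^sub>0)\<in>regular_configs S n (m n). \<forall>(z, w)\<in>configs S n (m n).
        \<not> equivalent G n (m n) (z, w) (z\<^sub>0, w\<^sub>0) \<longrightarrow>
        (\<forall>(s, t)\<in>G. \<forall>r\<^sub>1 r\<^sub>2. r\<^sub>1 = moved n z\<^sub>0 s z \<longrightarrow> r\<^sub>2 = moved (m n) w\<^sub>0 t w \<longrightarrow>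
           r\<^sub>1 + r\<^sub>2 = config_dist G n (m n) (z\<^sub>0, w\<^sub>0) (z, w) \<longrightarrow>
           (\<forall>\<epsilon>>0. \<exists>A\<in>sets (data_space S n (m n)).
              {x \<in> space (data_space S n (m n)). \<exists>\<pi>\<in>conn_set S.
                 \<bar>log_lik_ratio S n (m n) \<pi> (z\<^sub>0, w\<^sub>0) (z, w) x -
                  xintegral (cond_law S n (m n) \<pi>\<^sub>0 (z\<^sub>0, w\<^sub>0))
                    (log_lik_ratio S n (m n) \<pi> (z\<^sub>0, w\<^sub>0) (z, w))\<bar>
                 \<ge> ereal (\<epsilon> * (real (m n) * real r\<^sub>1 + real n * real r\<^sub>2))} \<subseteq> A \<and>
              measure (cond_law S n (m n) \<pi>\<^sub>0 (z\<^sub>0, w\<^sub>0)) A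
                \<le> 2 * exp_minus (\<psi> \<epsilon> * ereal (real (m n) * real r\<^sub>1 + real n * real r\<^sub>2)))))"

definition lipschitz_condition :: "('x, 'p::real_normed_vector) block_model \<Rightarrow> real \<Rightarrow> bool" where
  "lipschitz_condition S L\<^sub>0 \<longleftrightarrow> L\<^sub>0 > 0 \<and>
     (\<forall>\<pi>\<in>conn_set S. \<forall>\<pi>'\<in>conn_set S. \<forall>q\<in>rgroups S. \<forall>l\<in>cgroups S. \<forall>q'\<in>rgroups S. \<forall>l'\<in>cgroups S.
        \<bar>mean_log_ratio S (\<pi> q l) (\<pi>' q l) (\<pi> q' l')\<bar> \<le> ereal (L\<^sub>0 * conn_dist S \<pi> \<pi>'))"

definition asymptotic_setup :: "('x, 'p) block_model \<Rightarrow> (nat \<Rightarrow> nat) \<Rightarrow> bool" where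
  "asymptotic_setup S m \<longleftrightarrow>
     filterlim m at_top sequentially \<and> (\<forall>n. m n \<le> n) \<and> (\<lambda>n. ln (real n) / real (m n)) \<longlonglongrightarrow> 0 \<and>
     (variant S \<noteq> LBM \<longrightarrow> (\<forall>n. m n = n))"

definition a_bound :: "('x, 'p) block_model \<Rightarrow> real \<Rightarrow> real \<Rightarrow> nat \<Rightarrow> nat \<Rightarrow> real" where
  "a_bound S \<gamma> K n m = (case variant S of
      LBM \<Rightarrow> real n * exp (- \<gamma> * real m + K) + real m * exp (- \<gamma> * real n + K)
    | SBM _ _ \<Rightarrow> real n * exp (- 2 * real n * \<gamma> + K))"

definition b_bound :: "('x, 'p) block_model \<Rightarrow> real \<Rightarrow> real \<Rightarrow> nat \<Rightarrow> nat \<Rightarrow> real" where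
  "b_bound S C K n m = (case variant S of
      LBM \<Rightarrow> real n * exp (- C * real m - K) + real m * exp (- C * real n - K)
    | SBM _ _ \<Rightarrow> real n * exp (- 2 * C * real n - K))"

section \<open>The posterior is a conditional probability\<close>

lemma finite_index_set: "finite (index_set S n m)"
proof (cases "variant S")
  case LBM
  then show ?thesis by (simp add: index_set_def)
next
  case (SBM a b)
  then show ?thesis
    by (auto simp: index_set_def intro: finite_subset[of _ "{1..n} \<times> {1..n}"])
qed

lemma finite_configs: "finite (configs S n m)"
proof (cases "variant S")
  case LBM
  then show ?thesis by (simp add: configs_def finite_PiE)
next
  case (SBM a b)
  have "{(z, w). z \<in> {1..n} \<rightarrow>\<^sub>E rgroups S \<and> w = z} = (\<lambda>z. (z, z)) ` ({1..n} \<rightarrow>\<^sub>E rgroups S)"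
    by auto
  then show ?thesis using SBM by (simp add: configs_def finite_PiE)
qed

lemma entry_in_entry_set:
  assumes "valid_model S" "\<pi> \<in> conn_set S" "(z, w) \<in> configs S n m" "(i, j) \<in> index_set S n m"
  shows "\<pi> (z i) (w j) \<in> entry_set S"
proof -
  have "z i \<in> rgroups S \<and> w j \<in> cgroups S"
  proof (cases "variant S")
    case LBM
    then show ?thesis using assms by (auto simp: configs_def index_set_def dest: PiE_mem)
  next
    case (SBM a b)
    then have "ncols S = nrows S" using assms(1) by (simp add: valid_model_def)
    then show ?thesis using SBM assms by (auto simp: configs_def index_set_def dest: PiE_mem)
  qed
  then show ?thesis using assms(1,2) unfolding valid_model_def by blast
qed

lemma cond_law_eq_density:
  assumes S: "valid_model S" "sigma_finite_measure (base S)"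
    and \<pi>: "\<pi> \<in> conn_set S" and c: "(z, w) \<in> configs S n m"
  shows "cond_law S n m \<pi> (z, w) = density (data_space S n m)
    (\<lambda>x. \<Prod>(i, j)\<in>index_set S n m. ennreal (density_fn S (\<pi> (z i) (w j)) (x (i, j))))"
proof -
  let ?I = "index_set S n m"
  define g where "g ij = (\<lambda>x. ennreal (density_fn S (\<pi> (z (fst ij)) (w (snd ij))) x))" for ij
  have g_meas [measurable]: "g ij \<in> borel_measurable (base S)" if "ij \<in> ?I" for ij
    using entry_in_entry_set[OF S(1) \<pi> c, of "fst ij" "snd ij"] that S(1)
    unfolding g_def valid_model_def by auto
  have g_int: "(\<integral>\<^sup>+x. g ij x \<partial>base S) = 1" if "ij \<in> ?I" for ij
    using entry_in_entry_set[OF S(1) \<pi> c, of "fst ij" "snd ij"] that S(1)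
    unfolding g_def valid_model_def by auto
  define B where "B ij = (if ij \<in> ?I then density (base S) (g ij) else base S)" for ij
  have sfB: "sigma_finite_measure (B ij)" for ij
  proof (cases "ij \<in> ?I")
    case True
    then have "prob_space (density (base S) (g ij))"
      using g_meas[OF True] g_int[OF True] by (intro prob_spaceI) (simp add: emeasure_density)
    then show ?thesis
      using True by (simp add: B_def prob_space_imp_sigma_finite)
  next
    case False
    then show ?thesis using S(2) by (simp add: B_def)
  qed
  interpret B: product_sigma_finite B by (rule product_sigma_finite.intro) (rule sfB)
  interpret N: product_sigma_finite "\<lambda>_ :: nat \<times> nat. base S"
    by (rule product_sigma_finite.intro) (rule S(2))
  have "cond_law S n m \<pi> (z, w) = PiM ?I B"
    unfolding cond_law_def by (auto intro!: PiM_cong simp: B_def g_def case_prod_unfold)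
  also have "\<dots> = density (data_space S n m) (\<lambda>x. \<Prod>ij\<in>?I. g ij (x ij))"
  proof (rule B.PiM_eqI[symmetric])
    show "finite ?I" by (rule finite_index_set)
    show "sets (density (data_space S n m) (\<lambda>x. \<Prod>ij\<in>?I. g ij (x ij))) = sets (PiM ?I B)"
      unfolding data_space_def sets_density by (rule sets_PiM_cong) (auto simp: B_def)
    fix A assume A: "\<And>i. i \<in> ?I \<Longrightarrow> A i \<in> sets (B i)"
    have A': "A i \<in> sets (base S)" if "i \<in> ?I" for i using A[OF that] that by (simp add: B_def)
    have meas: "(\<lambda>x. \<Prod>ij\<in>?I. g ij (x ij)) \<in> borel_measurable (\<Pi>\<^sub>M ij\<in>?I. base S)"
      by measurable
    have ind: "indicator (Pi\<^sub>E ?I A) x = (\<Prod>ij\<in>?I. indicator (A ij) (x ij) :: ennreal)"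
      if x: "x \<in> space (\<Pi>\<^sub>M ij\<in>?I. base S)" for x
    proof (cases "x \<in> Pi\<^sub>E ?I A")
      case True
      then show ?thesis by (auto simp: indicator_def PiE_iff intro!: prod.neutral[symmetric])
    next
      case False
      then obtain ij where "ij \<in> ?I" "x ij \<notin> A ij"
        using x by (auto simp: space_PiM PiE_iff)
      then show ?thesis using False finite_index_set[of S n m]
        by (auto simp: indicator_def)
    qed
    have "emeasure (density (data_space S n m) (\<lambda>x. \<Prod>ij\<in>?I. g ij (x ij))) (Pi\<^sub>E ?I A)
      = (\<integral>\<^sup>+x. (\<Prod>ij\<in>?I. g ij (x ij)) * indicator (Pi\<^sub>E ?I A) x \<partial>(\<Pi>\<^sub>M ij\<in>?I. base S))"
      unfolding data_space_def
      by (rule emeasure_density[OF meas]) (auto intro!: sets_PiM_I_finite finite_index_set A')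
    also have "\<dots> = (\<integral>\<^sup>+x. (\<Prod>ij\<in>?I. g ij (x ij) * indicator (A ij) (x ij)) \<partial>(\<Pi>\<^sub>M ij\<in>?I. base S))"
      by (intro nn_integral_cong) (simp add: ind prod.distrib)
    also have "\<dots> = (\<Prod>ij\<in>?I. \<integral>\<^sup>+x. g ij x * indicator (A ij) x \<partial>base S)"
      using A' g_meas
      by (intro N.product_nn_integral_prod finite_index_set borel_measurable_times_ennreal
            borel_measurable_indicator) auto
    also have "\<dots> = (\<Prod>ij\<in>?I. emeasure (B ij) (A ij))"
      using A' g_meas by (intro prod.cong refl) (simp add: B_def emeasure_density)
    finally show "emeasure (density (data_space S n m) (\<lambda>x. \<Prod>ij\<in>?I. g ij (x ij))) (Pi\<^sub>E ?I A)
      = (\<Prod>ij\<in>?I. emeasure (B ij) (A ij))" .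
  qed
  finally show ?thesis by (simp add: g_def case_prod_unfold)
qed

lemma prior_nonneg:
  assumes "valid_model S" "\<theta> \<in> Theta S" "c \<in> configs S n m"
  shows "prior S n m \<theta> c \<ge> 0"
proof -
  have *: "alpha \<theta> q \<ge> 0" if "q \<in> rgroups S" for q
  proof -
    have "alpha \<theta> q \<ge> alpha_min S" "alpha_min S > 0"
      using assms(1,2) that unfolding valid_model_def Theta_def by blast+
    then show ?thesis by linarith
  qed
  have **: "beta \<theta> l \<ge> 0" if "l \<in> cgroups S" for l
  proof -
    have "beta \<theta> l \<ge> beta_min S" "beta_min S > 0"
      using assms(1,2) that unfolding valid_model_def Theta_def by blast+
    then show ?thesis by linarith
  qed
  obtain z w where c: "c = (z, w)" by force
  show ?thesis
  proof (cases "variant S")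
    case LBM
    have zw: "z \<in> {1..n} \<rightarrow>\<^sub>E rgroups S" "w \<in> {1..m} \<rightarrow>\<^sub>E cgroups S"
      using LBM assms(3) by (simp_all add: c configs_def)
    have "(\<Prod>i\<in>{1..n}. alpha \<theta> (z i)) \<ge> 0" "(\<Prod>j\<in>{1..m}. beta \<theta> (w j)) \<ge> 0"
      by (rule prod_nonneg, rule *, rule PiE_mem[OF zw(1)], assumption)
        (rule prod_nonneg, rule **, rule PiE_mem[OF zw(2)], assumption)
    then show ?thesis using LBM by (simp add: c prior_def)
  next
    case (SBM a b)
    then have z: "z \<in> {1..n} \<rightarrow>\<^sub>E rgroups S" using assms(3) by (simp add: c configs_def)
    have "(\<Prod>i\<in>{1..n}. alpha \<theta> (z i)) \<ge> 0"
      by (rule prod_nonneg, rule *, rule PiE_mem[OF z], assumption)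
    then show ?thesis using SBM by (simp add: c prior_def)
  qed
qed

lemma joint_density_nonneg:
  assumes "valid_model S" "\<theta> \<in> Theta S" "c \<in> configs S n m" "x \<in> space (data_space S n m)"
  shows "joint_density S n m \<theta> x c \<ge> 0"
proof -
  obtain z w where c: "c = (z, w)" by force
  have "density_fn S (conn \<theta> (z i) (w j)) (x (i, j)) \<ge> 0" if "(i, j) \<in> index_set S n m" for i j
  proof -
    have "conn \<theta> (z i) (w j) \<in> entry_set S"
      using entry_in_entry_set[OF assms(1)] assms(2,3) that c by (auto simp: Theta_def)
    moreover have "x (i, j) \<in> space (base S)"
      using assms(4) that by (auto simp: data_space_def space_PiM dest: PiE_mem)
    ultimately show ?thesis using assms(1) by (auto simp: valid_model_def)
  qed
  then show ?thesis
    unfolding joint_density_def c using prior_nonneg[OF assms(1-3)]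
    by (auto simp: c intro!: mult_nonneg_nonneg prod_nonneg)
qed

lemma joint_density_measurable:
  assumes "valid_model S" "\<theta> \<in> Theta S" "c \<in> configs S n m"
  shows "(\<lambda>x. joint_density S n m \<theta> x c) \<in> borel_measurable (data_space S n m)"
proof -
  obtain z w where c: "c = (z, w)" by force
  have "(\<lambda>x. density_fn S (conn \<theta> (z (fst ij)) (w (snd ij))) (x ij)) \<in> borel_measurable (data_space S n m)"
    if "ij \<in> index_set S n m" for ij
  proof -
    have "conn \<theta> (z (fst ij)) (w (snd ij)) \<in> entry_set S"
      using entry_in_entry_set[OF assms(1)] assms(2,3) that c by (auto simp: Theta_def)
    then have [measurable]: "density_fn S (conn \<theta> (z (fst ij)) (w (snd ij))) \<in> borel_measurable (base S)"
      using assms(1) by (auto simp: valid_model_def)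
    show ?thesis unfolding data_space_def using that by measurable
  qed
  then show ?thesis
    unfolding joint_density_def c by (auto simp: case_prod_unfold)
qed

lemma posterior_bounds:
  assumes "valid_model S" "\<theta> \<in> Theta S" "c \<in> configs S n m" "x \<in> space (data_space S n m)"
  shows "posterior S n m \<theta> x c \<ge> 0" "posterior S n m \<theta> x c \<le> 1"
proof -
  have nn: "joint_density S n m \<theta> x c' \<ge> 0" if "c' \<in> configs S n m" for c'
    using joint_density_nonneg assms that by blast
  show "posterior S n m \<theta> x c \<ge> 0"
    unfolding posterior_def by (intro divide_nonneg_nonneg sum_nonneg nn assms(3))
  have "joint_density S n m \<theta> x c \<le> (\<Sum>c'\<in>configs S n m. joint_density S n m \<theta> x c')"
    using nn assms(3) by (intro member_le_sum finite_configs) auto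
  then show "posterior S n m \<theta> x c \<le> 1"
    unfolding posterior_def using sum_nonneg[of "configs S n m" "joint_density S n m \<theta> x"] nn
    by (auto simp: divide_le_eq_1 less_le)
qed

lemma data_joint_law:
  assumes S: "valid_model S" "sigma_finite_measure (base S)" and \<theta>: "\<theta> \<in> Theta S"
    and M: "prob_space M" and D: "block_data S n m \<theta> M ZW X"
    and c: "c \<in> configs S n m" and A: "A \<in> sets (data_space S n m)"
  shows "emeasure M {\<omega>\<in>space M. ZW \<omega> = c \<and> X \<omega> \<in> A} =
    (\<integral>\<^sup>+x. ennreal (joint_density S n m \<theta> x c) * indicator A x \<partial>data_space S n m)"
proof -
  interpret M: prob_space M by fact
  obtain z w where zw: "c = (z, w)" by force
  let ?I = "index_set S n m"
  let ?L = "\<lambda>x. \<Prod>(i, j)\<in>?I. density_fn S (conn \<theta> (z i) (w j)) (x (i, j))"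
  let ?E = "\<lambda>x. \<Prod>(i, j)\<in>?I. ennreal (density_fn S (conn \<theta> (z i) (w j)) (x (i, j)))"
  have \<pi>: "conn \<theta> \<in> conn_set S" using \<theta> by (simp add: Theta_def)
  have entry: "conn \<theta> (z i) (w j) \<in> entry_set S" if "(i, j) \<in> ?I" for i j
    using entry_in_entry_set[OF S(1) \<pi>] c zw that by blast
  have pos: "density_fn S (conn \<theta> (z i) (w j)) (x (i, j)) \<ge> 0"
    if "(i, j) \<in> ?I" "x \<in> space (data_space S n m)" for i j x
  proof -
    have "x (i, j) \<in> space (base S)"
      using that by (auto simp: data_space_def space_PiM dest: PiE_mem)
    then show ?thesis using entry[OF that(1)] S(1) by (auto simp: valid_model_def)
  qed
  have E_eq: "?E x = ennreal (?L x)" if "x \<in> space (data_space S n m)" for x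
    using pos[OF _ that] by (auto simp: case_prod_unfold intro!: prod_ennreal)
  have E_meas: "?E \<in> borel_measurable (data_space S n m)"
  proof -
    have "(\<lambda>x. ennreal (density_fn S (conn \<theta> (z (fst ij)) (w (snd ij))) (x ij)))
        \<in> borel_measurable (data_space S n m)" if "ij \<in> ?I" for ij
    proof -
      have [measurable]: "density_fn S (conn \<theta> (z (fst ij)) (w (snd ij))) \<in> borel_measurable (base S)"
        using entry[of "fst ij" "snd ij"] that S(1) by (auto simp: valid_model_def)
      show ?thesis unfolding data_space_def using that by measurable
    qed
    then show ?thesis by (auto simp: case_prod_unfold)
  qed
  have prob: "prob_space (cond_law S n m (conn \<theta>) c)"
    unfolding cond_law_def zw case_prod_unfold prod.sel
  proof (rule prob_space_PiM)
    fix ij assume "ij \<in> ?I"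
    then have "conn \<theta> (z (fst ij)) (w (snd ij)) \<in> entry_set S"
      using entry[of "fst ij" "snd ij"] by simp
    then show "prob_space (density (base S) (\<lambda>x. ennreal (density_fn S (conn \<theta> (z (fst ij)) (w (snd ij))) x)))"
      using S(1) by (intro prob_spaceI) (auto simp: valid_model_def emeasure_density)
  qed
  interpret P: prob_space "cond_law S n m (conn \<theta>) c" by (rule prob)
  have "emeasure M {\<omega>\<in>space M. ZW \<omega> = c \<and> X \<omega> \<in> A} =
      ennreal (prior S n m \<theta> c) * emeasure (cond_law S n m (conn \<theta>) c) A"
    using D c A prior_nonneg[OF S(1) \<theta> c]
    by (simp add: block_data_def M.emeasure_eq_measure P.emeasure_eq_measure ennreal_mult)
  also have "emeasure (cond_law S n m (conn \<theta>) c) A = (\<integral>\<^sup>+x. ?E x * indicator A x \<partial>data_space S n m)"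
    using c A by (simp add: zw cond_law_eq_density[OF S \<pi>] emeasure_density[OF E_meas])
  also have "ennreal (prior S n m \<theta> c) * \<dots> =
      (\<integral>\<^sup>+x. ennreal (prior S n m \<theta> c) * (?E x * indicator A x) \<partial>data_space S n m)"
    using E_meas A by (intro nn_integral_cmult[symmetric]) auto
  also have "\<dots> = (\<integral>\<^sup>+x. ennreal (joint_density S n m \<theta> x c) * indicator A x \<partial>data_space S n m)"
  proof (intro nn_integral_cong)
    fix x assume x: "x \<in> space (data_space S n m)"
    have "ennreal (joint_density S n m \<theta> x c) = ennreal (prior S n m \<theta> c) * ?E x"
      unfolding E_eq[OF x] using prior_nonneg[OF S(1) \<theta> c]
      by (simp add: joint_density_def zw ennreal_mult')
    then show "ennreal (prior S n m \<theta> c) * (?E x * indicator A x) =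
        ennreal (joint_density S n m \<theta> x c) * indicator A x"
      by (simp add: mult.assoc)
  qed
  finally show ?thesis .
qed

lemma posterior_cond_prob:
  assumes S: "valid_model S" "sigma_finite_measure (base S)" and \<theta>: "\<theta> \<in> Theta S"
    and M: "prob_space M" and D: "block_data S n m \<theta> M ZW X" and c: "c \<in> configs S n m"
  shows "AE \<omega> in M. real_cond_exp M (vimage_algebra (space M) X (data_space S n m))
    (indicator {\<omega>\<in>space M. ZW \<omega> = c}) \<omega> = posterior S n m \<theta> (X \<omega>) c"
proof -
  let ?N = "data_space S n m"
  let ?F = "vimage_algebra (space M) X ?N"
  let ?g = "\<lambda>x. \<Sum>c'\<in>configs S n m. joint_density S n m \<theta> x c'"
  interpret M: prob_space M by fact
  have X [measurable]: "X \<in> M \<rightarrow>\<^sub>M ?N" and ZW: "ZW \<in> M \<rightarrow>\<^sub>M count_space (configs S n m)"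
    using D by (simp_all add: block_data_def)
  have Xsp: "X \<in> space M \<rightarrow> space ?N" using measurable_space[OF X] by blast
  have setsF: "sets ?F = {X -` A \<inter> space M | A. A \<in> sets ?N}"
    by (rule sets_vimage_algebra2[OF Xsp])
  have sub: "subalgebra M ?F"
    unfolding subalgebra_def setsF using measurable_sets[OF X] by (simp only: space_vimage_algebra) blast
  interpret F: finite_measure_subalgebra M ?F
    by standard (rule sub)
  have XF: "X \<in> ?F \<rightarrow>\<^sub>M ?N" by (rule measurable_vimage_algebra1[OF Xsp])
  have jm [measurable]: "(\<lambda>x. joint_density S n m \<theta> x c') \<in> borel_measurable ?N"
    if "c' \<in> configs S n m" for c'
    using joint_density_measurable S(1) \<theta> that by blast
  have pm [measurable]: "(\<lambda>x. posterior S n m \<theta> x c) \<in> borel_measurable ?N"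
    unfolding posterior_def using c by (intro borel_measurable_divide borel_measurable_sum jm)
  have gm [measurable]: "?g \<in> borel_measurable ?N" by (intro borel_measurable_sum jm)
  have Zc [measurable]: "{\<omega>\<in>space M. ZW \<omega> = c} \<in> sets M"
  proof -
    have "ZW -` {c} \<inter> space M \<in> sets M" using ZW c by (intro measurable_sets[OF ZW]) auto
    moreover have "ZW -` {c} \<inter> space M = {\<omega>\<in>space M. ZW \<omega> = c}" by auto
    ultimately show ?thesis by simp
  qed
  have law: "distr M ?N X = density ?N (\<lambda>x. ennreal (?g x))"
  proof (rule measure_eqI)
    fix A assume "A \<in> sets (distr M ?N X)"
    then have A [measurable]: "A \<in> sets ?N" by simp
    have dec: "X -` A \<inter> space M = (\<Union>c'\<in>configs S n m. {\<omega>\<in>space M. ZW \<omega> = c' \<and> X \<omega> \<in> A})"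
      using measurable_space[OF ZW] by auto
    have ms: "{\<omega>\<in>space M. ZW \<omega> = c' \<and> X \<omega> \<in> A} \<in> sets M" if "c' \<in> configs S n m" for c'
    proof -
      have "(ZW -` {c'} \<inter> space M) \<inter> (X -` A \<inter> space M) \<in> sets M"
        using that by (intro sets.Int measurable_sets[OF ZW] measurable_sets[OF X]) auto
      moreover have "(ZW -` {c'} \<inter> space M) \<inter> (X -` A \<inter> space M) = {\<omega>\<in>space M. ZW \<omega> = c' \<and> X \<omega> \<in> A}"
        by auto
      ultimately show ?thesis by simp
    qed
    have "emeasure (distr M ?N X) A = emeasure M (\<Union>c'\<in>configs S n m. {\<omega>\<in>space M. ZW \<omega> = c' \<and> X \<omega> \<in> A})"
      by (simp add: emeasure_distr dec)
    also have "\<dots> = (\<Sum>c'\<in>configs S n m. emeasure M {\<omega>\<in>space M. ZW \<omega> = c' \<and> X \<omega> \<in> A})"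
      using ms by (intro sum_emeasure[symmetric] finite_configs) (auto simp: disjoint_family_on_def)
    also have "\<dots> = (\<Sum>c'\<in>configs S n m. \<integral>\<^sup>+x. ennreal (joint_density S n m \<theta> x c') * indicator A x \<partial>?N)"
      by (intro sum.cong refl data_joint_law[OF S \<theta> M D _ A])
    also have "\<dots> = (\<integral>\<^sup>+x. (\<Sum>c'\<in>configs S n m. ennreal (joint_density S n m \<theta> x c') * indicator A x) \<partial>?N)"
      by (intro nn_integral_sum[symmetric]) measurable
    also have "\<dots> = (\<integral>\<^sup>+x. ennreal (?g x) * indicator A x \<partial>?N)"
      by (intro nn_integral_cong)
        (simp add: sum_distrib_right[symmetric] sum_ennreal joint_density_nonneg[OF S(1) \<theta>])
    also have "\<dots> = emeasure (density ?N (\<lambda>x. ennreal (?g x))) A"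
      by (simp add: emeasure_density)
    finally show "emeasure (distr M ?N X) A = emeasure (density ?N (\<lambda>x. ennreal (?g x))) A" .
  qed simp
  have bnd: "0 \<le> posterior S n m \<theta> (X \<omega>) c \<and> posterior S n m \<theta> (X \<omega>) c \<le> 1"
    if "\<omega> \<in> space M" for \<omega>
    using posterior_bounds[OF S(1) \<theta> c] Xsp that by blast
  have int: "integrable M (\<lambda>\<omega>. posterior S n m \<theta> (X \<omega>) c)"
    using bnd by (intro M.integrable_const_bound[where B = 1]) auto
  show ?thesis
  proof (rule F.real_cond_exp_charact)
    show "integrable M (indicator {\<omega>\<in>space M. ZW \<omega> = c} :: _ \<Rightarrow> real)"
      by (rule integrable_real_indicator[OF Zc]) (simp add: M.emeasure_eq_measure)
    show "integrable M (\<lambda>\<omega>. posterior S n m \<theta> (X \<omega>) c)" by (rule int)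
    show "(\<lambda>\<omega>. posterior S n m \<theta> (X \<omega>) c) \<in> borel_measurable ?F"
      using XF pm by (rule measurable_compose)
    fix B assume "B \<in> sets ?F"
    then obtain A where A [measurable]: "A \<in> sets ?N" and B: "B = X -` A \<inter> space M"
      unfolding setsF by auto
    have Bm [measurable]: "B \<in> sets M" unfolding B by measurable
    have "ennreal (\<integral>\<omega>\<in>B. posterior S n m \<theta> (X \<omega>) c \<partial>M)
        = (\<integral>\<^sup>+\<omega>. ennreal (indicator B \<omega> * posterior S n m \<theta> (X \<omega>) c) \<partial>M)"
      unfolding set_lebesgue_integral_def real_scaleR_def
    proof (rule nn_integral_eq_integral[symmetric])
      show "integrable M (\<lambda>\<omega>. indicator B \<omega> * posterior S n m \<theta> (X \<omega>) c)"
        using integrable_real_mult_indicator[OF Bm int] by (simp add: mult.commute)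
      show "AE \<omega> in M. 0 \<le> indicator B \<omega> * posterior S n m \<theta> (X \<omega>) c"
        by (rule AE_I2) (intro mult_nonneg_nonneg indicator_pos_le conjunct1[OF bnd])
    qed
    also have "\<dots> = (\<integral>\<^sup>+\<omega>. ennreal (posterior S n m \<theta> (X \<omega>) c) * indicator A (X \<omega>) \<partial>M)"
      by (intro nn_integral_cong) (auto simp: B indicator_def)
    also have "\<dots> = (\<integral>\<^sup>+x. ennreal (posterior S n m \<theta> x c) * indicator A x \<partial>distr M ?N X)"
      by (subst nn_integral_distr) auto
    also have "\<dots> = (\<integral>\<^sup>+x. ennreal (?g x) * (ennreal (posterior S n m \<theta> x c) * indicator A x) \<partial>?N)"
      unfolding law by (subst nn_integral_density) auto
    also have "\<dots> = (\<integral>\<^sup>+x. ennreal (joint_density S n m \<theta> x c) * indicator A x \<partial>?N)"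
    proof (intro nn_integral_cong)
      fix x assume x: "x \<in> space ?N"
      have nn: "joint_density S n m \<theta> x c' \<ge> 0" if "c' \<in> configs S n m" for c'
        using joint_density_nonneg[OF S(1) \<theta> that x] .
      have "?g x * posterior S n m \<theta> x c = joint_density S n m \<theta> x c"
      proof (cases "?g x = 0")
        case True
        then have "joint_density S n m \<theta> x c = 0"
          using nn c sum_nonneg_eq_0_iff[OF finite_configs, of S n m "joint_density S n m \<theta> x"] by auto
        then show ?thesis using True by simp
      qed (simp add: posterior_def)
      then have "ennreal (?g x) * ennreal (posterior S n m \<theta> x c) = ennreal (joint_density S n m \<theta> x c)"
        using nn by (subst ennreal_mult[symmetric]) (auto intro!: sum_nonneg posterior_bounds[OF S(1) \<theta> c x])
      then show "ennreal (?g x) * (ennreal (posterior S n m \<theta> x c) * indicator A x)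
          = ennreal (joint_density S n m \<theta> x c) * indicator A x"
        by (simp add: mult.assoc[symmetric])
    qed
    also have "\<dots> = emeasure M {\<omega>\<in>space M. ZW \<omega> = c \<and> X \<omega> \<in> A}"
      by (rule data_joint_law[OF S \<theta> M D c A, symmetric])
    also have "{\<omega>\<in>space M. ZW \<omega> = c \<and> X \<omega> \<in> A} = {\<omega>\<in>space M. ZW \<omega> = c} \<inter> B"
      by (auto simp: B)
    also have "emeasure M ({\<omega>\<in>space M. ZW \<omega> = c} \<inter> B) = ennreal (measure M ({\<omega>\<in>space M. ZW \<omega> = c} \<inter> B))"
      by (rule M.emeasure_eq_measure)
    finally have *: "ennreal (\<integral>\<omega>\<in>B. posterior S n m \<theta> (X \<omega>) c \<partial>M) =
        ennreal (measure M ({\<omega>\<in>space M. ZW \<omega> = c} \<inter> B))" .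
    have "0 \<le> (\<integral>\<omega>\<in>B. posterior S n m \<theta> (X \<omega>) c \<partial>M)"
      unfolding set_lebesgue_integral_def real_scaleR_def
      by (rule integral_nonneg_AE, rule AE_I2)
        (intro mult_nonneg_nonneg indicator_pos_le conjunct1[OF bnd])
    then have "(\<integral>\<omega>\<in>B. posterior S n m \<theta> (X \<omega>) c \<partial>M) = measure M ({\<omega>\<in>space M. ZW \<omega> = c} \<inter> B)"
      by (rule iffD1[OF ennreal_inj[OF _ measure_nonneg] *])
    moreover have "(\<integral>\<omega>\<in>B. indicator {\<omega>\<in>space M. ZW \<omega> = c} \<omega> \<partial>M) = measure M ({\<omega>\<in>space M. ZW \<omega> = c} \<inter> B)"
    proof -
      have "(\<integral>\<omega>\<in>B. indicator {\<omega>\<in>space M. ZW \<omega> = c} \<omega> \<partial>M)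
          = (\<integral>\<omega>. indicator ({\<omega>\<in>space M. ZW \<omega> = c} \<inter> B) \<omega> \<partial>M :: real)"
        unfolding set_lebesgue_integral_def
        by (intro Bochner_Integration.integral_cong refl) (auto simp: indicator_def)
      also have "\<dots> = measure M ({\<omega>\<in>space M. ZW \<omega> = c} \<inter> B)"
        using Zc Bm by (simp add: Int_assoc Int_absorb2 sets.sets_into_space)
      finally show ?thesis .
    qed
    ultimately show "(\<integral>\<omega>\<in>B. indicator {\<omega>\<in>space M. ZW \<omega> = c} \<omega> \<partial>M)
        = (\<integral>\<omega>\<in>B. posterior S n m \<theta> (X \<omega>) c \<partial>M)" by simp
  qed
qed

end

theory Submission
  imports Defs
begin

text \<open>Fix the true configuration \<open>c\<^sub>0\<close>. The posterior probability of
  \<open>c\<^sub>0\<close> is \<open>1 / (1 + \<Sigma>)\<close>, where \<open>\<Sigma>\<close> is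
  the sum of the posterior odds of the other configurations, so both bounds are bounds on
  \<open>\<Sigma>\<close>. All estimates are made in terms of \<open>R(c) = m r\<^sub>1 + n
  r\<^sub>2\<close>, where \<open>c\<close> differs from \<open>c\<^sub>0\<close> in
  \<open>r\<^sub>1\<close> rows and \<open>r\<^sub>2\<close> columns (\<open>weighted_dist\<close>).
  The odds of \<open>c\<close> are a ratio of priors, at most \<open>exp K\<close> per changed
  label, times \<open>exp (- \<delta>)\<close>, where \<open>\<delta>\<close> is the log-likelihood
  ratio. The assumed concentration inequality and a union bound over all pairs of configurations
  replace \<open>\<delta>\<close> by its mean, with an error \<open>\<rho> R(c)\<close> for all
  \<open>c\<close> and all matrices at once, outside an event of summable probability
  (\<open>typical_event\<close>). The union bound and the bound on \<open>\<Sigma>\<close> use the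
  same sum: as the sites are relabelled independently, the sum of \<open>exp (- \<gamma>
  R(c))\<close> over \<open>c \<noteq> c\<^sub>0\<close> factorises and is at most \<open>x exp
  x\<close>, with \<open>x\<close> at most of the order of \<open>n exp (- \<gamma> m)\<close>
  (\<open>sum_exp_weighted_dist_le\<close>).

  The heart of the matter is a lower bound on the mean of \<open>\<delta>\<close>. By the Lipschitz
  condition it suffices to treat the true matrix \<open>\<pi>\<^sub>0\<close>, at a cost of \<open>2
  L\<^sub>0 \<eta> R(c)\<close>; then every cell whose true entry of \<open>\<pi>\<^sub>0\<close> is
  replaced by another one contributes at least \<open>kappa_min\<close>, and the claim is that there
  are at least \<open>7/100 mu_min\<^sup>2 R(c)\<close> such cells
  (\<open>modified_observed_cells_ge\<close>). The number of such cells can only decrease when the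
  labels of the columns, and then those of the rows, are replaced by the best relabelling of the old
  groups. The outcome \<open>(s, t)\<close> either modifies a whole block of cells, of which there
  are at least about \<open>mu_min\<^sup>2 n m\<close>, or is a symmetry of
  \<open>\<pi>\<^sub>0\<close>, because the rows and the columns of \<open>\<pi>\<^sub>0\<close> are
  distinct. In the latent block model the only symmetry is the identity, and each wrong label costs
  a whole class of cells. For graphs only symmetries of the form \<open>(s, s)\<close> are excluded;
  but rows and columns carry the same labels, which cannot follow two different permutations at the
  same time (\<open>modified_cells_ge_shared\<close>).

  Since \<open>7/100 > 1/16\<close>, the exponent exceeds the one in the statement by a positive
  multiple of \<open>R(c)\<close>; this absorbs the deviations and the number of available labels.
  Likewise, the odds of the \<open>n\<close> configurations that relabel a single row are at least
  \<open>exp (- K - (kappa_max + \<rho>) R(c))\<close>, whereas \<open>C = 2 kappa_max\<close> and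
  \<open>\<rho> < kappa_max\<close>. The estimates hold for large \<open>n\<close>; for the other
  \<open>n\<close> the event \<open>\<Omega>\<^sub>1\<close> is empty.\<close>

section \<open>Log-density ratios\<close>

lemma xintegral_eq_integral:
  assumes "integrable M h" and "AE x in M. g x = ereal (h x)"
  shows "xintegral M g = ereal (\<integral>x. h x \<partial>M)"
proof -
  have "(\<integral>\<^sup>+x. e2ennreal (g x) \<partial>M) = (\<integral>\<^sup>+x. ennreal (h x) \<partial>M)"
    using assms(2) by (intro nn_integral_cong_AE) (auto simp: e2ennreal_ereal)
  moreover have "(\<integral>\<^sup>+x. e2ennreal (- g x) \<partial>M) = (\<integral>\<^sup>+x. ennreal (- h x) \<partial>M)"
    using assms(2) by (intro nn_integral_cong_AE) (auto simp: e2ennreal_ereal)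
  moreover have "(\<integral>\<^sup>+x. ennreal (h x) \<partial>M) < \<infinity>" "(\<integral>\<^sup>+x. ennreal (- h x) \<partial>M) < \<infinity>"
    using assms(1) by (auto simp: real_integrable_def less_top)
  ultimately show ?thesis
    unfolding xintegral_def real_lebesgue_integral_def[OF assms(1)]
    by (cases "\<integral>\<^sup>+x. ennreal (h x) \<partial>M"; cases "\<integral>\<^sup>+x. ennreal (- h x) \<partial>M") auto
qed

lemma xintegral_density:
  assumes [measurable]: "g \<in> borel_measurable N" "r \<in> borel_measurable N"
    and "\<And>x. x \<in> space N \<Longrightarrow> r x \<ge> 0"
  shows "xintegral (density N (\<lambda>x. ennreal (r x))) g = xintegral N (\<lambda>x. g x * ereal (r x))"
proof -
  have *: "e2ennreal (y * ereal s) = ennreal s * e2ennreal y" if "s \<ge> 0" for y :: ereal and s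
  proof (cases y)
    case (real t)
    then show ?thesis using that by (simp add: e2ennreal_ereal ennreal_mult' mult.commute)
  next
    case PInf
    then show ?thesis using that by (cases "s = 0") (auto simp: e2ennreal_infty ennreal_mult_top)
  next
    case MInf
    then show ?thesis using that by (cases "s = 0") (auto simp: e2ennreal_neg)
  qed
  have **: "- (y * ereal s) = (- y) * ereal s" for y :: ereal and s by (rule ereal_mult_minus_left[symmetric])
  show ?thesis
    unfolding xintegral_def **
    by (simp add: nn_integral_density * assms(3) del: ereal_mult_minus_left cong: nn_integral_cong)
qed

lemma elog_measurable [measurable (raw)]:
  assumes [measurable]: "f \<in> borel_measurable M"
  shows "(\<lambda>x. elog (f x)) \<in> borel_measurable M"
  unfolding elog_def by measurable

locale bounded_KL_model =
  fixes S :: "('x, 'p) block_model"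
  assumes valid: "valid_model S" and kappa_max_finite: "kappa_max S < \<infinity>"
begin

definition entry_law :: "'p \<Rightarrow> 'x measure" where
  "entry_law p = density (base S) (\<lambda>x. ennreal (density_fn S p x))"

definition log_ratio :: "'p \<Rightarrow> 'p \<Rightarrow> 'x \<Rightarrow> real" where
  "log_ratio p p' x = ln (density_fn S p x) - ln (density_fn S p' x)"

definition kl :: "'p \<Rightarrow> 'p \<Rightarrow> real" where
  "kl p p' = (\<integral>x. log_ratio p p' x \<partial>entry_law p)"

lemma
  assumes "p \<in> entry_set S"
  shows density_measurable [measurable]: "density_fn S p \<in> borel_measurable (base S)"
    and density_nonneg: "x \<in> space (base S) \<Longrightarrow> density_fn S p x \<ge> 0"
    and density_integral: "(\<integral>\<^sup>+x. ennreal (density_fn S p x) \<partial>base S) = 1"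
  using valid assms by (auto simp: valid_model_def)

lemma space_entry_law [simp]: "space (entry_law p) = space (base S)"
  and sets_entry_law [simp, measurable_cong]: "sets (entry_law p) = sets (base S)"
  by (simp_all add: entry_law_def)

lemma prob_space_entry_law: "p \<in> entry_set S \<Longrightarrow> prob_space (entry_law p)"
  unfolding entry_law_def using density_integral[of p]
  by (intro prob_spaceI) (simp add: emeasure_density)

lemma log_ratio_measurable [measurable]:
  assumes [measurable]: "p \<in> entry_set S" "p' \<in> entry_set S"
  shows "log_ratio p p' \<in> borel_measurable (base S)"
  unfolding log_ratio_def by measurable

lemma mean_log_ratio_eq_xintegral:
  assumes [measurable]: "p \<in> entry_set S" "p' \<in> entry_set S" "p'' \<in> entry_set S"
  shows "mean_log_ratio S p p' p'' =
    xintegral (entry_law p'') (\<lambda>x. elog (density_fn S p x) - elog (density_fn S p' x))"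
  unfolding mean_log_ratio_def entry_law_def
  by (subst xintegral_density) (simp_all add: density_nonneg assms(3))

lemma KL_finite:
  assumes "p \<in> entry_set S" "p' \<in> entry_set S"
  shows "KL S p p' < \<infinity>"
proof -
  have "KL S p p' \<le> kappa_max S"
    unfolding kappa_max_def using assms by (intro Sup_upper) blast
  then show ?thesis using kappa_max_finite by (rule le_less_trans)
qed

text \<open>A log-ratio is \<open>\<infinity>\<close> where the second density vanishes, so a finite divergence
  forces the second density to be positive almost everywhere under the first. Hence all the entry
  laws are equivalent, and the log-ratios are real-valued almost everywhere.\<close>

lemma density_pos_AE:
  assumes p [measurable]: "p \<in> entry_set S" and p' [measurable]: "p' \<in> entry_set S"
  shows "AE x in entry_law p. density_fn S p' x > 0"
proof -
  let ?g = "\<lambda>x. elog (density_fn S p x) - elog (density_fn S p' x)"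
  have "xintegral (entry_law p) ?g < \<infinity>"
    using KL_finite[OF p p'] mean_log_ratio_eq_xintegral[OF p p' p] by (simp add: KL_def)
  then have "(\<integral>\<^sup>+x. e2ennreal (?g x) \<partial>entry_law p) \<noteq> \<infinity>"
    unfolding xintegral_def by (auto simp: top_ereal_def)
  then have "AE x in entry_law p. e2ennreal (?g x) \<noteq> \<infinity>"
    by (intro nn_integral_PInf_AE) measurable
  moreover have "AE x in entry_law p. x \<in> space (base S)"
    using AE_space[of "entry_law p"] by simp
  ultimately show ?thesis
  proof eventually_elim
    case (elim x)
    have "density_fn S p' x \<noteq> 0"
      using elim(1) by (auto simp: elog_def e2ennreal_infty)
    then show ?case using density_nonneg[OF p' elim(2)] by simp
  qed
qed

text \<open>Integrating the quotient against the first density returns the mass of the second one on the set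
  where the first one is positive.\<close>

lemma
  assumes p [measurable]: "p \<in> entry_set S" and p' [measurable]: "p' \<in> entry_set S"
  shows nn_integral_quotient_le: "(\<integral>\<^sup>+x. ennreal (density_fn S p' x / density_fn S p x) \<partial>entry_law p) \<le> 1"
    and integrable_quotient: "integrable (entry_law p) (\<lambda>x. density_fn S p' x / density_fn S p x)"
proof -
  let ?q = "\<lambda>x. density_fn S p' x / density_fn S p x"
  have "(\<integral>\<^sup>+x. ennreal (?q x) \<partial>entry_law p) =
      (\<integral>\<^sup>+x. ennreal (density_fn S p x) * ennreal (?q x) \<partial>base S)"
    unfolding entry_law_def by (rule nn_integral_density) measurable
  also have "\<dots> \<le> (\<integral>\<^sup>+x. ennreal (density_fn S p' x) \<partial>base S)"
    using density_nonneg p p'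
    by (intro nn_integral_mono) (auto simp: ennreal_mult'[symmetric] intro!: ennreal_leI)
  also have "\<dots> = 1" by (rule density_integral[OF p'])
  finally show *: "(\<integral>\<^sup>+x. ennreal (?q x) \<partial>entry_law p) \<le> 1" .
  show "integrable (entry_law p) ?q"
    using * density_nonneg p p'
    by (intro integrableI_nonneg AE_I2) (auto simp: less_top[symmetric] top_unique)
qed

text \<open>The positive part is integrable because the divergence is finite, the negative part because
  \<open>ln t \<le> t\<close> bounds it by the quotient of the densities.\<close>

lemma log_ratio_integrable_self:
  assumes p [measurable]: "p \<in> entry_set S" and p' [measurable]: "p' \<in> entry_set S"
  shows "integrable (entry_law p) (log_ratio p p')"
proof -
  let ?g = "\<lambda>x. elog (density_fn S p x) - elog (density_fn S p' x)"
  have eq: "AE x in entry_law p. ?g x = ereal (log_ratio p p' x)"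
    using density_pos_AE[OF p p] density_pos_AE[OF p p']
    by eventually_elim (simp add: elog_def log_ratio_def)
  have "xintegral (entry_law p) ?g < \<infinity>"
    using KL_finite[OF p p'] mean_log_ratio_eq_xintegral[OF p p' p] by (simp add: KL_def)
  then have "(\<integral>\<^sup>+x. e2ennreal (?g x) \<partial>entry_law p) \<noteq> \<infinity>"
    unfolding xintegral_def by (auto simp: top_ereal_def)
  moreover have "(\<integral>\<^sup>+x. e2ennreal (?g x) \<partial>entry_law p) = (\<integral>\<^sup>+x. ennreal (log_ratio p p' x) \<partial>entry_law p)"
    using eq by (intro nn_integral_cong_AE) (auto simp: e2ennreal_ereal)
  moreover have "(\<integral>\<^sup>+x. ennreal (- log_ratio p p' x) \<partial>entry_law p) \<le>
      (\<integral>\<^sup>+x. ennreal (density_fn S p' x / density_fn S p x) \<partial>entry_law p)"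
    using density_pos_AE[OF p p] density_pos_AE[OF p p']
  proof (intro nn_integral_mono_AE, eventually_elim)
    case (elim x)
    then have "- log_ratio p p' x = ln (density_fn S p' x / density_fn S p x)"
      by (simp add: log_ratio_def ln_div)
    also have "\<dots> \<le> density_fn S p' x / density_fn S p x" using elim by (intro ln_bound) simp
    finally show ?case by (rule ennreal_leI)
  qed
  then have "(\<integral>\<^sup>+x. ennreal (- log_ratio p p' x) \<partial>entry_law p) \<le> 1"
    using nn_integral_quotient_le[OF p p'] by (rule order_trans)
  ultimately show ?thesis by (auto simp: real_integrable_def top_unique)
qed

text \<open>Under a third entry law, a log-ratio is the difference of two log-ratios with this law.\<close>

lemma
  assumes p [measurable]: "p \<in> entry_set S" and p' [measurable]: "p' \<in> entry_set S"
    and p'' [measurable]: "p'' \<in> entry_set S"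
  shows log_ratio_integrable: "integrable (entry_law p'') (log_ratio p p')"
    and integral_log_ratio: "(\<integral>x. log_ratio p p' x \<partial>entry_law p'') = kl p'' p' - kl p'' p"
proof -
  have eq: "log_ratio p p' = (\<lambda>x. log_ratio p'' p' x - log_ratio p'' p x)"
    by (auto simp: log_ratio_def)
  show "integrable (entry_law p'') (log_ratio p p')"
    unfolding eq by (intro Bochner_Integration.integrable_diff log_ratio_integrable_self assms)
  show "(\<integral>x. log_ratio p p' x \<partial>entry_law p'') = kl p'' p' - kl p'' p"
    unfolding eq kl_def
    by (intro Bochner_Integration.integral_diff log_ratio_integrable_self assms)
qed

lemma mean_log_ratio_eq_kl:
  assumes "p \<in> entry_set S" "p' \<in> entry_set S" "p'' \<in> entry_set S"
  shows "mean_log_ratio S p p' p'' = ereal (kl p'' p' - kl p'' p)"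
proof -
  have "AE x in entry_law p''. elog (density_fn S p x) - elog (density_fn S p' x) =
      ereal (log_ratio p p' x)"
    using density_pos_AE[of p'' p] density_pos_AE[of p'' p'] assms
    by (auto simp: elog_def log_ratio_def)
  then show ?thesis
    using assms by (simp add: mean_log_ratio_eq_xintegral integral_log_ratio[symmetric]
        xintegral_eq_integral log_ratio_integrable)
qed

lemma kl_self [simp]: "kl p p = 0"
  by (simp add: kl_def log_ratio_def)

lemma KL_eq_kl: "p \<in> entry_set S \<Longrightarrow> p' \<in> entry_set S \<Longrightarrow> KL S p p' = ereal (kl p p')"
  by (simp add: KL_def mean_log_ratio_eq_kl)

text \<open>Gibbs' inequality: \<open>ln t \<le> t - 1\<close> for the quotient of the densities.\<close>

lemma kl_nonneg:
  assumes p [measurable]: "p \<in> entry_set S" and p' [measurable]: "p' \<in> entry_set S"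
  shows "kl p p' \<ge> 0"
proof -
  interpret P: prob_space "entry_law p" by (rule prob_space_entry_law[OF p])
  let ?q = "\<lambda>x. density_fn S p' x / density_fn S p x"
  have "ennreal (\<integral>x. ?q x \<partial>entry_law p) \<le> 1"
    using nn_integral_quotient_le[OF p p'] density_nonneg p p'
    by (subst nn_integral_eq_integral[symmetric]) (auto intro!: AE_I2 integrable_quotient)
  then have "(\<integral>x. ?q x \<partial>entry_law p) \<le> 1" by simp
  moreover have "(\<integral>x. 1 - ?q x \<partial>entry_law p) \<le> kl p p'"
    unfolding kl_def
  proof (rule integral_mono_AE)
    show "integrable (entry_law p) (\<lambda>x. 1 - ?q x)"
      using integrable_quotient[OF p p'] by auto
    show "AE x in entry_law p. 1 - ?q x \<le> log_ratio p p' x"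
      using density_pos_AE[OF p p] density_pos_AE[OF p p']
    proof eventually_elim
      case (elim x)
      then have "- log_ratio p p' x = ln (?q x)" by (simp add: log_ratio_def ln_div)
      also have "\<dots> \<le> ?q x - 1" using elim by (intro ln_le_minus_one) simp
      finally show ?case by simp
    qed
  qed (rule log_ratio_integrable_self[OF p p'])
  ultimately show ?thesis
    using integrable_quotient[OF p p'] using P.prob_space by simp
qed

lemma kl_le_kappa_max:
  assumes "p \<in> entry_set S" "p' \<in> entry_set S"
  shows "kl p p' \<le> real_of_ereal (kappa_max S)"
proof -
  have le: "ereal (kl p p') \<le> kappa_max S"
    unfolding kappa_max_def KL_eq_kl[OF assms, symmetric] using assms by (intro Sup_upper) blast
  show ?thesis using le kappa_max_finite by (cases "kappa_max S") auto
qed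

subsection \<open>The mean of the log-likelihood ratio\<close>

text \<open>Almost surely no density involved vanishes, so the sum is real and can be integrated term by term,
  each term under the corresponding marginal of the product measure.\<close>

lemma xintegral_log_lik_ratio:
  assumes c\<^sub>0: "(z\<^sub>0, w\<^sub>0) \<in> configs S n m" and c: "(z, w) \<in> configs S n m"
    and \<pi>\<^sub>0: "\<pi>\<^sub>0 \<in> conn_set S" and \<pi>: "\<pi> \<in> conn_set S"
  shows "xintegral (cond_law S n m \<pi>\<^sub>0 (z\<^sub>0, w\<^sub>0)) (log_lik_ratio S n m \<pi> (z\<^sub>0, w\<^sub>0) (z, w)) =
    ereal (\<Sum>(i, j)\<in>index_set S n m.
      kl (\<pi>\<^sub>0 (z\<^sub>0 i) (w\<^sub>0 j)) (\<pi> (z i) (w j)) - kl (\<pi>\<^sub>0 (z\<^sub>0 i) (w\<^sub>0 j)) (\<pi> (z\<^sub>0 i) (w\<^sub>0 j)))"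
proof -
  let ?I = "index_set S n m"
  define p\<^sub>0 where "p\<^sub>0 ij = \<pi>\<^sub>0 (z\<^sub>0 (fst ij)) (w\<^sub>0 (snd ij))" for ij
  define p where "p ij = \<pi> (z\<^sub>0 (fst ij)) (w\<^sub>0 (snd ij))" for ij
  define p' where "p' ij = \<pi> (z (fst ij)) (w (snd ij))" for ij
  have E: "p\<^sub>0 ij \<in> entry_set S" "p ij \<in> entry_set S" "p' ij \<in> entry_set S" if "ij \<in> ?I" for ij
    using entry_in_entry_set[OF valid, of _ _ _ n m "fst ij" "snd ij"] assms that
    by (auto simp: p\<^sub>0_def p_def p'_def)
  let ?P = "PiM ?I (\<lambda>ij. entry_law (p\<^sub>0 ij))"
  have law: "cond_law S n m \<pi>\<^sub>0 (z\<^sub>0, w\<^sub>0) = ?P"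
    by (simp add: cond_law_def entry_law_def p\<^sub>0_def case_prod_unfold)
  have marg: "distr ?P (entry_law (p\<^sub>0 ij)) (\<lambda>x. x ij) = entry_law (p\<^sub>0 ij)" if "ij \<in> ?I" for ij
    using that by (intro distr_PiM_component finite_index_set prob_space_entry_law E)
  have pos: "AE x in ?P. density_fn S q (x ij) > 0" if "ij \<in> ?I" "q \<in> entry_set S" for ij q
  proof -
    have "AE y in distr ?P (entry_law (p\<^sub>0 ij)) (\<lambda>x. x ij). density_fn S q y > 0"
      unfolding marg[OF that(1)] using that E by (intro density_pos_AE)
    then show ?thesis using that by (subst (asm) AE_distr_iff) auto
  qed
  have int: "integrable ?P (\<lambda>x. log_ratio (p ij) (p' ij) (x ij))"
    and mean: "(\<integral>x. log_ratio (p ij) (p' ij) (x ij) \<partial>?P) = kl (p\<^sub>0 ij) (p' ij) - kl (p\<^sub>0 ij) (p ij)"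
    if ij: "ij \<in> ?I" for ij
  proof -
    have m [measurable]: "log_ratio (p ij) (p' ij) \<in> borel_measurable (entry_law (p\<^sub>0 ij))"
      using log_ratio_measurable[OF E(2,3)[OF ij]] by simp
    have c [measurable]: "(\<lambda>x. x ij) \<in> ?P \<rightarrow>\<^sub>M entry_law (p\<^sub>0 ij)" using ij by measurable
    show "integrable ?P (\<lambda>x. log_ratio (p ij) (p' ij) (x ij))"
      using integrable_distr_eq[OF c m] log_ratio_integrable[OF E(2,3,1)[OF ij]]
      unfolding marg[OF ij] by blast
    show "(\<integral>x. log_ratio (p ij) (p' ij) (x ij) \<partial>?P) = kl (p\<^sub>0 ij) (p' ij) - kl (p\<^sub>0 ij) (p ij)"
      using integral_distr[OF c m] integral_log_ratio[OF E(2,3,1)[OF ij]]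
      unfolding marg[OF ij] by simp
  qed
  have "AE x in ?P. \<forall>ij\<in>?I. density_fn S (p ij) (x ij) > 0 \<and> density_fn S (p' ij) (x ij) > 0"
    by (intro AE_finite_allI finite_index_set AE_conjI pos E)
  then have "AE x in ?P. log_lik_ratio S n m \<pi> (z\<^sub>0, w\<^sub>0) (z, w) x =
      ereal (\<Sum>ij\<in>?I. log_ratio (p ij) (p' ij) (x ij))"
  proof eventually_elim
    case (elim x)
    have "log_lik_ratio S n m \<pi> (z\<^sub>0, w\<^sub>0) (z, w) x =
        (\<Sum>ij\<in>?I. ereal (log_ratio (p ij) (p' ij) (x ij)))"
      unfolding log_lik_ratio_def prod.case case_prod_unfold
      using elim by (intro sum.cong refl) (force simp: elog_def log_ratio_def p_def p'_def)
    then show ?case by simp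
  qed
  moreover have "integrable ?P (\<lambda>x. \<Sum>ij\<in>?I. log_ratio (p ij) (p' ij) (x ij))"
    using int by auto
  ultimately have "xintegral ?P (log_lik_ratio S n m \<pi> (z\<^sub>0, w\<^sub>0) (z, w)) =
      ereal (\<integral>x. (\<Sum>ij\<in>?I. log_ratio (p ij) (p' ij) (x ij)) \<partial>?P)"
    by (intro xintegral_eq_integral)
  also have "(\<integral>x. (\<Sum>ij\<in>?I. log_ratio (p ij) (p' ij) (x ij)) \<partial>?P) =
      (\<Sum>ij\<in>?I. kl (p\<^sub>0 ij) (p' ij) - kl (p\<^sub>0 ij) (p ij))"
    using int mean by (simp add: Bochner_Integration.integral_sum)
  finally show ?thesis by (simp add: law p\<^sub>0_def p_def p'_def case_prod_unfold)
qed

end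

section \<open>Counting modified entries\<close>

definition modified_cells ::
  "'i set \<Rightarrow> 'j set \<Rightarrow> ('a \<Rightarrow> 'b \<Rightarrow> 'p) \<Rightarrow> ('i \<Rightarrow> 'a) \<Rightarrow> ('j \<Rightarrow> 'b) \<Rightarrow> ('i \<Rightarrow> 'a) \<Rightarrow> ('j \<Rightarrow> 'b) \<Rightarrow> ('i \<times> 'j) set"
  where "modified_cells I J \<pi> z\<^sub>0 w\<^sub>0 z w = {(i, j) \<in> I \<times> J. \<pi> (z\<^sub>0 i) (w\<^sub>0 j) \<noteq> \<pi> (z i) (w j)}"

lemma finite_modified_cells [simp]:
  "finite I \<Longrightarrow> finite J \<Longrightarrow> finite (modified_cells I J \<pi> z\<^sub>0 w\<^sub>0 z w)"
  unfolding modified_cells_def by (rule finite_subset[of _ "I \<times> J"]) auto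

lemma card_modified_cells_rows:
  assumes "finite I" "finite J"
  shows "card (modified_cells I J \<pi> z\<^sub>0 w\<^sub>0 z w) =
    (\<Sum>i\<in>I. card {j\<in>J. \<pi> (z\<^sub>0 i) (w\<^sub>0 j) \<noteq> \<pi> (z i) (w j)})"
proof -
  have "modified_cells I J \<pi> z\<^sub>0 w\<^sub>0 z w = (SIGMA i:I. {j\<in>J. \<pi> (z\<^sub>0 i) (w\<^sub>0 j) \<noteq> \<pi> (z i) (w j)})"
    by (auto simp: modified_cells_def)
  then show ?thesis using assms by (simp add: card_SigmaI)
qed

lemma card_modified_cells_swap:
  "card (modified_cells J I (\<lambda>l q. \<pi> q l) w\<^sub>0 z\<^sub>0 w z) = card (modified_cells I J \<pi> z\<^sub>0 w\<^sub>0 z w)"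
  by (rule bij_betw_same_card[of prod.swap], rule bij_betw_byWitness[where f' = prod.swap])
    (auto simp: modified_cells_def)

text \<open>The number of modified cells is a sum over the rows, and the contribution of a row depends
  on the row only through its old and its new group. So relabelling each old group by the cheapest
  new group can only decrease the number.\<close>

lemma cheapest_row_relabelling:
  assumes fin: "finite I" "finite J" "finite Q" and z\<^sub>0: "z\<^sub>0 \<in> I \<rightarrow> Q" and z: "z \<in> I \<rightarrow> Q"
  obtains s where "s \<in> Q \<rightarrow> Q"
    "card (modified_cells I J \<pi> z\<^sub>0 w\<^sub>0 (\<lambda>i. s (z\<^sub>0 i)) w) \<le> card (modified_cells I J \<pi> z\<^sub>0 w\<^sub>0 z w)"
proof -
  define cost where "cost q q' = card {j\<in>J. \<pi> q (w\<^sub>0 j) \<noteq> \<pi> q' (w j)}" for q q'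
  define s where "s q = arg_min_on (cost q) Q" for q
  have s: "s q \<in> Q" "cost q (s q) \<le> cost q q'" if "q \<in> Q" "q' \<in> Q" for q q'
    using that fin(3) arg_min_if_finite(1)[of Q "cost q"] arg_min_least[of Q q' "cost q"]
    by (auto simp: s_def)
  show thesis
  proof
    show "s \<in> Q \<rightarrow> Q" using s by auto
    show "card (modified_cells I J \<pi> z\<^sub>0 w\<^sub>0 (\<lambda>i. s (z\<^sub>0 i)) w) \<le> card (modified_cells I J \<pi> z\<^sub>0 w\<^sub>0 z w)"
      unfolding card_modified_cells_rows[OF fin(1,2)] cost_def[symmetric]
      using z z\<^sub>0 by (intro sum_mono s(2)) auto
  qed
qed

lemma cheapest_column_relabelling:
  assumes fin: "finite I" "finite J" "finite L" and w\<^sub>0: "w\<^sub>0 \<in> J \<rightarrow> L" and w: "w \<in> J \<rightarrow> L"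
  obtains t where "t \<in> L \<rightarrow> L"
    "card (modified_cells I J \<pi> z\<^sub>0 w\<^sub>0 z (\<lambda>j. t (w\<^sub>0 j))) \<le> card (modified_cells I J \<pi> z\<^sub>0 w\<^sub>0 z w)"
proof -
  obtain t where "t \<in> L \<rightarrow> L" "card (modified_cells J I (\<lambda>l q. \<pi> q l) w\<^sub>0 z\<^sub>0 (\<lambda>j. t (w\<^sub>0 j)) z)
      \<le> card (modified_cells J I (\<lambda>l q. \<pi> q l) w\<^sub>0 z\<^sub>0 w z)"
    by (rule cheapest_row_relabelling[OF fin(2,1,3) w\<^sub>0 w, of "\<lambda>l q. \<pi> q l" z\<^sub>0 z])
  then show thesis by (intro that) (simp_all add: card_modified_cells_swap[of J I \<pi>])
qed

definition distinct_rows :: "'a set \<Rightarrow> 'b set \<Rightarrow> ('a \<Rightarrow> 'b \<Rightarrow> 'p) \<Rightarrow> bool" where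
  "distinct_rows Q L \<pi> \<longleftrightarrow> (\<forall>q\<in>Q. \<forall>q'\<in>Q. q \<noteq> q' \<longrightarrow> (\<exists>l\<in>L. \<pi> q l \<noteq> \<pi> q' l))"

definition automorphism :: "'a set \<Rightarrow> 'b set \<Rightarrow> ('a \<Rightarrow> 'b \<Rightarrow> 'p) \<Rightarrow> ('a \<Rightarrow> 'a) \<Rightarrow> ('b \<Rightarrow> 'b) \<Rightarrow> bool" where
  "automorphism Q L \<pi> s t \<longleftrightarrow>
     s permutes Q \<and> t permutes L \<and> (\<forall>q\<in>Q. \<forall>l\<in>L. \<pi> (s q) (t l) = \<pi> q l)"

lemma automorphism_swap: "automorphism L Q (\<lambda>l q. \<pi> q l) t s \<longleftrightarrow> automorphism Q L \<pi> s t"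
  by (auto simp: automorphism_def)

lemma inj_on_relabelling:
  assumes "distinct_rows Q L \<pi>" "\<And>q l. q \<in> Q \<Longrightarrow> l \<in> L \<Longrightarrow> \<pi> (s q) (t l) = \<pi> q l"
  shows "inj_on s Q"
proof (rule inj_onI, rule ccontr)
  fix q q' assume q: "q \<in> Q" "q' \<in> Q" "s q = s q'" "q \<noteq> q'"
  then obtain l where "l \<in> L" "\<pi> q l \<noteq> \<pi> q' l" using assms(1) by (auto simp: distinct_rows_def)
  then show False using assms(2)[of q l] assms(2)[of q' l] q by simp
qed

lemma extend_to_permutation:
  assumes "finite Q" "s \<in> Q \<rightarrow> Q" "inj_on s Q"
  shows "(\<lambda>q. if q \<in> Q then s q else q) permutes Q"
proof (rule bij_imp_permutes)
  have "s ` Q = Q" using assms by (intro endo_inj_surj) auto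
  then show "bij_betw (\<lambda>q. if q \<in> Q then s q else q) Q Q"
    using assms(3) by (simp add: bij_betw_def inj_on_def image_def)
qed simp

text \<open>Replace the new column labels, then the new row labels, by the cheapest relabellings
  \<open>t\<close> and \<open>s\<close> of the old ones. If \<open>(s, t)\<close> changes some entry
  of \<open>\<pi>\<close>, then a whole block of cells is modified. Otherwise \<open>(s, t)\<close>
  is an automorphism, as the rows and the columns of \<open>\<pi>\<close> are distinct; and with the
  columns relabelled by \<open>t\<close>, every row \<open>i\<close> with a label other than
  \<open>s (z\<^sub>0 i)\<close> differs from its old self on a whole class of columns.\<close>

lemma modified_cells_row_dichotomy:
  fixes A B :: real
  assumes fin: "finite I" "finite J" "finite Q" "finite L"
    and z\<^sub>0: "z\<^sub>0 \<in> I \<rightarrow> Q" and z: "z \<in> I \<rightarrow> Q" and w\<^sub>0: "w\<^sub>0 \<in> J \<rightarrow> L" and w: "w \<in> J \<rightarrow> L"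
    and rows: "distinct_rows Q L \<pi>" and cols: "distinct_rows L Q (\<lambda>l q. \<pi> q l)"
    and A: "\<And>q. q \<in> Q \<Longrightarrow> A \<le> card {i\<in>I. z\<^sub>0 i = q}"
    and B: "\<And>l. l \<in> L \<Longrightarrow> B \<le> card {j\<in>J. w\<^sub>0 j = l}" and "A \<ge> 0" "B \<ge> 0"
  shows "A * B \<le> card (modified_cells I J \<pi> z\<^sub>0 w\<^sub>0 z w) \<or>
    (\<exists>s t. automorphism Q L \<pi> s t \<and>
       B * card {i\<in>I. z i \<noteq> s (z\<^sub>0 i)} \<le> card (modified_cells I J \<pi> z\<^sub>0 w\<^sub>0 z w))"
proof -
  obtain t where t: "t \<in> L \<rightarrow> L" and
    le_t: "card (modified_cells I J \<pi> z\<^sub>0 w\<^sub>0 z (\<lambda>j. t (w\<^sub>0 j))) \<le> card (modified_cells I J \<pi> z\<^sub>0 w\<^sub>0 z w)"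
    by (rule cheapest_column_relabelling[OF fin(1,2,4) w\<^sub>0 w])
  obtain s where s: "s \<in> Q \<rightarrow> Q" and
    le_s: "card (modified_cells I J \<pi> z\<^sub>0 w\<^sub>0 (\<lambda>i. s (z\<^sub>0 i)) (\<lambda>j. t (w\<^sub>0 j)))
      \<le> card (modified_cells I J \<pi> z\<^sub>0 w\<^sub>0 z (\<lambda>j. t (w\<^sub>0 j)))"
    by (rule cheapest_row_relabelling[OF fin(1,2,3) z\<^sub>0 z])
  show ?thesis
  proof (cases "\<exists>q\<in>Q. \<exists>l\<in>L. \<pi> (s q) (t l) \<noteq> \<pi> q l")
    case True
    then obtain q l where ql: "q \<in> Q" "l \<in> L" "\<pi> (s q) (t l) \<noteq> \<pi> q l" by blast
    have "A * B \<le> real (card {i\<in>I. z\<^sub>0 i = q}) * real (card {j\<in>J. w\<^sub>0 j = l})"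
      using A[OF ql(1)] B[OF ql(2)] \<open>A \<ge> 0\<close> \<open>B \<ge> 0\<close> by (intro mult_mono) auto
    also have "\<dots> = card ({i\<in>I. z\<^sub>0 i = q} \<times> {j\<in>J. w\<^sub>0 j = l})" by (simp add: card_cartesian_product)
    also have "\<dots> \<le> card (modified_cells I J \<pi> z\<^sub>0 w\<^sub>0 (\<lambda>i. s (z\<^sub>0 i)) (\<lambda>j. t (w\<^sub>0 j)))"
      unfolding of_nat_le_iff
      using ql(3) fin by (intro card_mono finite_modified_cells) (auto simp: modified_cells_def)
    also have "\<dots> \<le> card (modified_cells I J \<pi> z\<^sub>0 w\<^sub>0 z w)" using le_s le_t by simp
    finally show ?thesis by simp
  next
    case False
    then have fix_st: "\<pi> (s q) (t l) = \<pi> q l" if "q \<in> Q" "l \<in> L" for q l using that by blast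
    define s' where "s' q = (if q \<in> Q then s q else q)" for q
    define t' where "t' l = (if l \<in> L then t l else l)" for l
    have "inj_on s Q" by (rule inj_on_relabelling[OF rows fix_st])
    moreover have "inj_on t L" by (rule inj_on_relabelling[OF cols]) (rule fix_st)
    ultimately have perm: "s' permutes Q" "t' permutes L"
      unfolding s'_def t'_def using extend_to_permutation fin s t by blast+
    have aut: "automorphism Q L \<pi> s' t'"
      using perm fix_st by (auto simp: automorphism_def s'_def t'_def)
    have row: "(if z i \<noteq> s' (z\<^sub>0 i) then B else 0) \<le> card {j\<in>J. \<pi> (z\<^sub>0 i) (w\<^sub>0 j) \<noteq> \<pi> (z i) (t (w\<^sub>0 j))}"
      if i: "i \<in> I" for i
    proof (cases "z i = s' (z\<^sub>0 i)")
      case False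
      have iQ: "z i \<in> Q" "z\<^sub>0 i \<in> Q" using z z\<^sub>0 i by auto
      then have "s' (z\<^sub>0 i) \<in> Q" using s by (auto simp: s'_def)
      then obtain l' where l': "l' \<in> L" "\<pi> (z i) l' \<noteq> \<pi> (s' (z\<^sub>0 i)) l'"
        using rows iQ False by (auto simp: distinct_rows_def)
      then obtain l where l: "l \<in> L" "l' = t l"
        using permutes_image[OF perm(2)] by (auto simp: t'_def)
      have "\<pi> (z\<^sub>0 i) l \<noteq> \<pi> (z i) (t l)"
        using l' l fix_st[OF iQ(2) l(1)] iQ by (simp add: s'_def)
      then have "card {j\<in>J. w\<^sub>0 j = l} \<le> card {j\<in>J. \<pi> (z\<^sub>0 i) (w\<^sub>0 j) \<noteq> \<pi> (z i) (t (w\<^sub>0 j))}"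
        using fin by (intro card_mono) auto
      then show ?thesis using B[OF l(1)] False by simp
    qed simp
    have "B * card {i\<in>I. z i \<noteq> s' (z\<^sub>0 i)} = (\<Sum>i\<in>I. if z i \<noteq> s' (z\<^sub>0 i) then B else 0)"
      using fin by (simp add: sum.If_cases Int_def mult.commute)
    also have "\<dots> \<le> (\<Sum>i\<in>I. real (card {j\<in>J. \<pi> (z\<^sub>0 i) (w\<^sub>0 j) \<noteq> \<pi> (z i) (t (w\<^sub>0 j))}))"
      by (intro sum_mono row)
    also have "\<dots> = card (modified_cells I J \<pi> z\<^sub>0 w\<^sub>0 z (\<lambda>j. t (w\<^sub>0 j)))"
      using fin by (simp add: card_modified_cells_rows)
    also have "\<dots> \<le> card (modified_cells I J \<pi> z\<^sub>0 w\<^sub>0 z w)" using le_t by simp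
    finally show ?thesis using aut by blast
  qed
qed

lemma modified_cells_column_dichotomy:
  fixes A B :: real
  assumes fin: "finite I" "finite J" "finite Q" "finite L"
    and z\<^sub>0: "z\<^sub>0 \<in> I \<rightarrow> Q" and z: "z \<in> I \<rightarrow> Q" and w\<^sub>0: "w\<^sub>0 \<in> J \<rightarrow> L" and w: "w \<in> J \<rightarrow> L"
    and rows: "distinct_rows Q L \<pi>" and cols: "distinct_rows L Q (\<lambda>l q. \<pi> q l)"
    and A: "\<And>q. q \<in> Q \<Longrightarrow> A \<le> card {i\<in>I. z\<^sub>0 i = q}"
    and B: "\<And>l. l \<in> L \<Longrightarrow> B \<le> card {j\<in>J. w\<^sub>0 j = l}" and "A \<ge> 0" "B \<ge> 0"
  shows "A * B \<le> card (modified_cells I J \<pi> z\<^sub>0 w\<^sub>0 z w) \<or>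
    (\<exists>s t. automorphism Q L \<pi> s t \<and>
       A * card {j\<in>J. w j \<noteq> t (w\<^sub>0 j)} \<le> card (modified_cells I J \<pi> z\<^sub>0 w\<^sub>0 z w))"
proof -
  have "B * A \<le> card (modified_cells J I (\<lambda>l q. \<pi> q l) w\<^sub>0 z\<^sub>0 w z) \<or>
    (\<exists>t s. automorphism L Q (\<lambda>l q. \<pi> q l) t s \<and>
       A * card {j\<in>J. w j \<noteq> t (w\<^sub>0 j)} \<le> card (modified_cells J I (\<lambda>l q. \<pi> q l) w\<^sub>0 z\<^sub>0 w z))"
    using assms by (intro modified_cells_row_dichotomy) auto
  then show ?thesis by (auto simp: card_modified_cells_swap[of J I \<pi>] automorphism_swap[of L Q \<pi>] mult.commute)
qed

text \<open>With the identity as its only automorphism, \<open>\<pi>\<close> makes every changed row label cost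
  a class of columns and every changed column label a class of rows, unless a whole block is
  modified, which costs more.\<close>

lemma modified_cells_ge_independent:
  fixes \<nu> :: real
  assumes fin: "finite I" "finite J" "finite Q" "finite L"
    and z\<^sub>0: "z\<^sub>0 \<in> I \<rightarrow> Q" and z: "z \<in> I \<rightarrow> Q" and w\<^sub>0: "w\<^sub>0 \<in> J \<rightarrow> L" and w: "w \<in> J \<rightarrow> L"
    and rows: "distinct_rows Q L \<pi>" and cols: "distinct_rows L Q (\<lambda>l q. \<pi> q l)"
    and A: "\<And>q. q \<in> Q \<Longrightarrow> card I * \<nu> \<le> card {i\<in>I. z\<^sub>0 i = q}"
    and B: "\<And>l. l \<in> L \<Longrightarrow> card J * \<nu> \<le> card {j\<in>J. w\<^sub>0 j = l}" and \<nu>: "0 \<le> \<nu>" "\<nu> \<le> 1"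
    and rigid: "\<And>s t. automorphism Q L \<pi> s t \<Longrightarrow> s = id \<and> t = id"
  shows "\<nu>\<^sup>2 / 2 * (card J * card {i\<in>I. z\<^sub>0 i \<noteq> z i} + card I * card {j\<in>J. w\<^sub>0 j \<noteq> w j})
    \<le> card (modified_cells I J \<pi> z\<^sub>0 w\<^sub>0 z w)"
proof -
  define D where "D = real (card (modified_cells I J \<pi> z\<^sub>0 w\<^sub>0 z w))"
  define N where "N = real (card I)"
  define M where "M = real (card J)"
  define r where "r = real (card {i\<in>I. z\<^sub>0 i \<noteq> z i})"
  define r' where "r' = real (card {j\<in>J. w\<^sub>0 j \<noteq> w j})"
  have r: "0 \<le> r" "r \<le> N" and r': "0 \<le> r'" "r' \<le> M"
    using fin by (auto simp: r_def r'_def N_def M_def intro!: card_mono)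
  have eq: "{i\<in>I. z i \<noteq> z\<^sub>0 i} = {i\<in>I. z\<^sub>0 i \<noteq> z i}" "{j\<in>J. w j \<noteq> w\<^sub>0 j} = {j\<in>J. w\<^sub>0 j \<noteq> w j}" by auto
  have nn: "0 \<le> card I * \<nu>" "0 \<le> card J * \<nu>" using \<nu> by auto
  have "N * \<nu> * (M * \<nu>) \<le> D \<or> M * \<nu> * r \<le> D"
    using modified_cells_row_dichotomy[OF fin z\<^sub>0 z w\<^sub>0 w rows cols A B nn]
    unfolding D_def N_def M_def r_def eq(1)[symmetric] by (auto dest: rigid)
  moreover have "N * \<nu> * (M * \<nu>) \<le> D \<or> N * \<nu> * r' \<le> D"
    using modified_cells_column_dichotomy[OF fin z\<^sub>0 z w\<^sub>0 w rows cols A B nn]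
    unfolding D_def N_def M_def r'_def eq(2)[symmetric] by (auto dest: rigid)
  ultimately consider "N * \<nu> * (M * \<nu>) \<le> D" | "M * \<nu> * r \<le> D" "N * \<nu> * r' \<le> D" by blast
  then have "\<nu>\<^sup>2 / 2 * (M * r + N * r') \<le> D"
  proof cases
    case 1
    have "M * r \<le> M * N" "N * r' \<le> N * M" using r r' by (auto intro!: mult_left_mono)
    then have "\<nu>\<^sup>2 / 2 * (M * r + N * r') \<le> \<nu>\<^sup>2 / 2 * (2 * (N * M))"
      by (intro mult_left_mono) (auto simp: mult.commute)
    also have "\<dots> = N * \<nu> * (M * \<nu>)" by (simp add: power2_eq_square)
    finally show ?thesis using 1 by simp
  next
    case 2
    have "\<nu>\<^sup>2 / 2 * (M * r + N * r') \<le> \<nu> / 2 * (M * r + N * r')"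
      using \<nu> r r' mult_right_mono[of \<nu> 1 \<nu>] by (intro mult_right_mono) (auto simp: power2_eq_square)
    then show ?thesis using 2 by (simp add: algebra_simps)
  qed
  then show ?thesis by (simp add: D_def N_def M_def r_def r'_def)
qed

text \<open>When rows and columns share their labels, only automorphisms of the form \<open>(s, s)\<close> are
  excluded. Rows and columns yield automorphisms with row part \<open>s\<close> and with column part
  \<open>t'\<close>. If \<open>s \<noteq> t'\<close>, the labels cannot follow both of them on a
  class where these two differ, so half a block is modified. If \<open>s = t'\<close> is not the
  identity, then \<open>(s, s)\<close> changes an entry of \<open>\<pi>\<close>: either many labels
  do not follow \<open>s\<close>, or most of a block is modified; the balance of these two effects
  gives the factor \<open>3/8\<close>.\<close>

lemma modified_cells_ge_shared:
  fixes \<nu> :: real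
  assumes fin: "finite I" "finite Q" and z\<^sub>0: "z\<^sub>0 \<in> I \<rightarrow> Q" and z: "z \<in> I \<rightarrow> Q"
    and rows: "distinct_rows Q Q \<pi>" and cols: "distinct_rows Q Q (\<lambda>l q. \<pi> q l)"
    and A: "\<And>q. q \<in> Q \<Longrightarrow> card I * \<nu> \<le> card {i\<in>I. z\<^sub>0 i = q}" and \<nu>: "0 \<le> \<nu>" "\<nu> \<le> 1"
    and rigid: "\<And>s. automorphism Q Q \<pi> s s \<Longrightarrow> s = id"
  shows "3 / 8 * \<nu>\<^sup>2 * (card I * card {i\<in>I. z\<^sub>0 i \<noteq> z i}) \<le> card (modified_cells I I \<pi> z\<^sub>0 z\<^sub>0 z z)"
proof -
  define D where "D = real (card (modified_cells I I \<pi> z\<^sub>0 z\<^sub>0 z z))"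
  define N where "N = real (card I)"
  define B where "B = N * \<nu>"
  define r where "r = real (card {i\<in>I. z\<^sub>0 i \<noteq> z i})"
  have r: "0 \<le> r" "r \<le> N" using fin by (auto simp: r_def N_def intro!: card_mono)
  have B0: "0 \<le> B" using \<nu> by (simp add: B_def N_def)
  have AB: "B \<le> card {i\<in>I. z\<^sub>0 i = q}" if "q \<in> Q" for q using A[OF that] by (simp add: B_def N_def)
  define a where "a s = real (card {i\<in>I. z i \<noteq> s (z\<^sub>0 i)})" for s
  have big: "3 / 8 * \<nu>\<^sup>2 * (N * r) \<le> D" if "3 / 8 * B\<^sup>2 \<le> D"
  proof -
    have "3 / 8 * \<nu>\<^sup>2 * (N * r) \<le> 3 / 8 * \<nu>\<^sup>2 * (N * N)"
      using r by (intro mult_left_mono) (auto simp: N_def)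
    also have "\<dots> = 3 / 8 * B\<^sup>2" by (simp add: B_def power2_eq_square)
    finally show ?thesis using that by linarith
  qed
  have "3 / 8 * \<nu>\<^sup>2 * (N * r) \<le> D"
  proof (cases "B * B \<le> D")
    case True
    moreover have "0 \<le> B * B" using B0 by simp
    ultimately have "3 / 8 * (B * B) \<le> D" by linarith
    then show ?thesis by (intro big) (simp add: power2_eq_square)
  next
    case False
    then obtain s t where s: "automorphism Q Q \<pi> s t" "B * a s \<le> D"
      using modified_cells_row_dichotomy[OF fin(1,1,2,2) z\<^sub>0 z z\<^sub>0 z rows cols AB AB B0 B0]
      by (auto simp: D_def a_def)
    obtain s' t' where t': "automorphism Q Q \<pi> s' t'" "B * a t' \<le> D"
      using False modified_cells_column_dichotomy[OF fin(1,1,2,2) z\<^sub>0 z z\<^sub>0 z rows cols AB AB B0 B0]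
      by (auto simp: D_def a_def)
    show ?thesis
    proof (cases "s = t'")
      case False
      then obtain q where "s q \<noteq> t' q" by auto
      moreover from this have q: "q \<in> Q"
        using s(1) t'(1) by (metis automorphism_def permutes_not_in)
      ultimately have "{i\<in>I. z\<^sub>0 i = q} \<subseteq> {i\<in>I. z i \<noteq> s (z\<^sub>0 i)} \<union> {i\<in>I. z i \<noteq> t' (z\<^sub>0 i)}" by auto
      then have "card {i\<in>I. z\<^sub>0 i = q} \<le> card {i\<in>I. z i \<noteq> s (z\<^sub>0 i)} + card {i\<in>I. z i \<noteq> t' (z\<^sub>0 i)}"
        using fin by (intro order_trans[OF card_mono card_Un_le]) auto
      then have "B \<le> a s + a t'" using AB[OF q] by (simp add: a_def)
      then have "B * B \<le> B * a s + B * a t'"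
        using B0 by (simp add: mult_left_mono distrib_left[symmetric])
      moreover have "0 \<le> B * B" using B0 by simp
      ultimately have "3 / 8 * (B * B) \<le> D" using s(2) t'(2) by linarith
      then show ?thesis by (intro big) (simp add: power2_eq_square)
    next
      case st: True
      show ?thesis
      proof (cases "s = id")
        case True
        have "a id = r" unfolding a_def r_def by (rule arg_cong[where f = "\<lambda>A. real (card A)"]) auto
        then have "B * r \<le> D" using s(2) True by simp
        moreover have "3 / 8 * \<nu>\<^sup>2 * (N * r) \<le> \<nu> * (N * r)"
          using \<nu> r mult_right_mono[of "3 / 8 * \<nu>" 1 \<nu>]
          by (intro mult_right_mono) (auto simp: power2_eq_square N_def)
        ultimately show ?thesis by (simp add: B_def ac_simps)
      next
        case False
        have perm: "s permutes Q" using s(1) by (simp add: automorphism_def)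
        then have "\<not> automorphism Q Q \<pi> s s" using rigid False by blast
        then obtain q l where ql: "q \<in> Q" "l \<in> Q" "\<pi> (s q) (s l) \<noteq> \<pi> q l"
          using perm by (auto simp: automorphism_def)
        define F where "F q = {i\<in>I. z\<^sub>0 i = q} - {i\<in>I. z i \<noteq> s (z\<^sub>0 i)}" for q
        have F: "B - a s \<le> card (F q)" if "q \<in> Q" for q
        proof -
          have "card {i\<in>I. z\<^sub>0 i = q} - card {i\<in>I. z i \<noteq> s (z\<^sub>0 i)} \<le> card (F q)"
            unfolding F_def using fin by (intro diff_card_le_card_Diff) auto
          then show ?thesis using AB[OF that] by (simp add: a_def)
        qed
        have "F q \<times> F l \<subseteq> modified_cells I I \<pi> z\<^sub>0 z\<^sub>0 z z"
          using ql(3) by (auto simp: F_def modified_cells_def)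
        then have "card (F q \<times> F l) \<le> card (modified_cells I I \<pi> z\<^sub>0 z\<^sub>0 z z)"
          using fin by (intro card_mono) auto
        then have FD: "real (card (F q)) * real (card (F l)) \<le> D"
          unfolding D_def by (simp add: card_cartesian_product flip: of_nat_mult)
        \<comment> \<open>The threshold \<open>3/8\<close> is chosen because \<open>(1 - 3/8)\<^sup>2 = 25/64\<close> is still at least \<open>3/8\<close>.\<close>
        show ?thesis
        proof (cases "3 / 8 * B \<le> a s")
          case True
          then have "B * (3 / 8 * B) \<le> B * a s" using B0 by (rule mult_left_mono)
          then show ?thesis using s(2) by (intro big) (simp add: power2_eq_square)
        next
          case False
          then have "5 / 8 * B \<le> card (F q)" "5 / 8 * B \<le> card (F l)"
            using F[OF ql(1)] F[OF ql(2)] by linarith+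
          then have "(5 / 8 * B) * (5 / 8 * B) \<le> real (card (F q)) * real (card (F l))"
            using B0 by (intro mult_mono) auto
          then have "25 / 64 * (B * B) \<le> D" using FD by simp
          moreover have "0 \<le> B * B" using B0 by simp
          ultimately have "3 / 8 * (B * B) \<le> D" by linarith
          then show ?thesis by (intro big) (simp add: power2_eq_square)
        qed
      qed
    qed
  qed
  then show ?thesis by (simp add: D_def N_def r_def)
qed

section \<open>Distances between configurations\<close>

text \<open>\<open>m r\<^sub>1 + n r\<^sub>2\<close>, where the configurations differ in
  \<open>r\<^sub>1\<close> rows and \<open>r\<^sub>2\<close> columns: it bounds the number of cells
  whose pair of labels changes, and is the scale of all the estimates below.\<close>

definition weighted_dist :: "nat \<Rightarrow> nat \<Rightarrow> config \<Rightarrow> config \<Rightarrow> real" where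
  "weighted_dist n m = (\<lambda>(z\<^sub>0, w\<^sub>0) (z, w).
     real m * real (card {i\<in>{1..n}. z\<^sub>0 i \<noteq> z i}) + real n * real (card {j\<in>{1..m}. w\<^sub>0 j \<noteq> w j}))"

text \<open>Regular configurations are the case \<open>\<nu> = mu_min / 2\<close>. For graphs, the count of
  modified cells below exceeds the rate in the definition of \<open>c\<close> only if
  \<open>\<nu>\<^sup>2 > 2/3 mu_min\<^sup>2\<close>; \<open>\<nu> = 9/10 mu_min\<close> achieves
  this and still holds with high probability.\<close>

definition balanced_configs :: "('x, 'p) block_model \<Rightarrow> real \<Rightarrow> nat \<Rightarrow> nat \<Rightarrow> config set" where
  "balanced_configs S \<nu> n m = {(z, w) \<in> configs S n m.
     (\<forall>q\<in>rgroups S. real n * \<nu> \<le> real (card {i\<in>{1..n}. z i = q})) \<and>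
     (\<forall>l\<in>cgroups S. real m * \<nu> \<le> real (card {j\<in>{1..m}. w j = l}))}"

lemma configs_PiE:
  assumes "valid_model S" "variant S \<noteq> LBM \<longrightarrow> m = n" "(z, w) \<in> configs S n m"
  shows "z \<in> {1..n} \<rightarrow>\<^sub>E rgroups S" "w \<in> {1..m} \<rightarrow>\<^sub>E cgroups S"
  using assms by (cases "variant S"; auto simp: configs_def valid_model_def)+

lemma misclassified_commute: "misclassified S n m c c' = misclassified S n m c' c"
proof -
  have *: "card {i\<in>A. f i \<noteq> g i} = card {i\<in>A. g i \<noteq> f i}" for A and f g :: "nat \<Rightarrow> nat"
    by (rule arg_cong[where f = card]) auto
  obtain z w z' w' where "c = (z, w)" "c' = (z', w')" by force
  then show ?thesis
    by (cases "variant S") (simp_all only: misclassified_def prod.case variant.case *[of _ z z'] *[of _ w w'])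
qed

lemma weighted_dist_nonneg: "weighted_dist n m c c' \<ge> 0"
  by (cases c; cases c') (simp add: weighted_dist_def)

lemma card_relabelled_cells_le:
  assumes "variant S \<noteq> LBM \<longrightarrow> m = n"
  shows "real (card {(i, j) \<in> index_set S n m. z\<^sub>0 i \<noteq> z i \<or> w\<^sub>0 j \<noteq> w j})
    \<le> weighted_dist n m (z\<^sub>0, w\<^sub>0) (z, w)"
proof -
  let ?A = "{i\<in>{1..n}. z\<^sub>0 i \<noteq> z i}" and ?B = "{j\<in>{1..m}. w\<^sub>0 j \<noteq> w j}"
  have "{(i, j) \<in> index_set S n m. z\<^sub>0 i \<noteq> z i \<or> w\<^sub>0 j \<noteq> w j} \<subseteq> ?A \<times> {1..m} \<union> {1..n} \<times> ?B"
    using assms by (auto simp: index_set_def split: variant.splits)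
  then have "card {(i, j) \<in> index_set S n m. z\<^sub>0 i \<noteq> z i \<or> w\<^sub>0 j \<noteq> w j} \<le> card (?A \<times> {1..m} \<union> {1..n} \<times> ?B)"
    by (intro card_mono) auto
  also have "\<dots> \<le> card (?A \<times> {1..m}) + card ({1..n} \<times> ?B)" by (rule card_Un_le)
  also have "\<dots> = card ?A * m + n * card ?B" by (simp only: card_cartesian_product card_atLeastAtMost) simp
  finally have "real (card {(i, j) \<in> index_set S n m. z\<^sub>0 i \<noteq> z i \<or> w\<^sub>0 j \<noteq> w j}) \<le> real (card ?A * m + n * card ?B)"
    by (rule of_nat_mono)
  then show ?thesis by (simp add: weighted_dist_def mult.commute)
qed

lemma mu_min_pos: "valid_model S \<Longrightarrow> mu_min S > 0"
  by (simp add: valid_model_def mu_min_def)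

lemma
  assumes "valid_model S" "\<theta> \<in> Theta S"
  shows alpha_ge: "q \<in> rgroups S \<Longrightarrow> mu_min S \<le> alpha \<theta> q"
    and beta_ge: "l \<in> cgroups S \<Longrightarrow> mu_min S \<le> beta \<theta> l"
    and alpha_pos: "q \<in> rgroups S \<Longrightarrow> 0 < alpha \<theta> q"
    and beta_pos: "l \<in> cgroups S \<Longrightarrow> 0 < beta \<theta> l"
    and sum_alpha: "(\<Sum>q\<in>rgroups S. alpha \<theta> q) = 1"
    and sum_beta: "(\<Sum>l\<in>cgroups S. beta \<theta> l) = 1"
proof -
  have pos: "alpha_min S > 0" "beta_min S > 0"
    using assms(1) by (auto simp: valid_model_def)
  have ge: "alpha_min S \<le> alpha \<theta> q" if "q \<in> rgroups S" for q
    using assms(2) that by (simp add: Theta_def)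
  have ge': "beta_min S \<le> beta \<theta> l" if "l \<in> cgroups S" for l
    using assms(2) that by (simp add: Theta_def)
  show "q \<in> rgroups S \<Longrightarrow> mu_min S \<le> alpha \<theta> q" "q \<in> rgroups S \<Longrightarrow> 0 < alpha \<theta> q"
    using ge[of q] pos unfolding mu_min_def by linarith+
  show "l \<in> cgroups S \<Longrightarrow> mu_min S \<le> beta \<theta> l" "l \<in> cgroups S \<Longrightarrow> 0 < beta \<theta> l"
    using ge'[of l] pos unfolding mu_min_def by linarith+
  show "(\<Sum>q\<in>rgroups S. alpha \<theta> q) = 1" "(\<Sum>l\<in>cgroups S. beta \<theta> l) = 1"
    using assms(2) by (simp_all add: Theta_def)
qed

lemma mu_min_le_1:
  assumes S: "valid_model S" and \<theta>: "\<theta> \<in> Theta S"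
  shows "mu_min S \<le> 1"
proof -
  have 1: "1 \<in> rgroups S" using S by (simp add: valid_model_def)
  have "alpha \<theta> 1 \<le> (\<Sum>q\<in>rgroups S. alpha \<theta> q)"
    using alpha_pos[OF S \<theta>] by (intro member_le_sum 1 less_imp_le) auto
  then show ?thesis using alpha_ge[OF S \<theta> 1] sum_alpha[OF S \<theta>] by simp
qed

text \<open>For graphs, the pairs \<open>(i, j)\<close> and \<open>(j, i)\<close> are both modified or both
  unmodified when the graph is undirected; so at least half of the modified cells are observed,
  apart from those on the diagonal, where the label of a modified cell has changed.\<close>

lemma modified_cells_SBM_le:
  assumes S: "valid_model S" and var: "variant S = SBM loops dir" and \<pi>: "\<pi> \<in> conn_set S"
    and z\<^sub>0: "z\<^sub>0 \<in> {1..n} \<rightarrow> rgroups S" and z: "z \<in> {1..n} \<rightarrow> rgroups S"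
  shows "card (modified_cells {1..n} {1..n} \<pi> z\<^sub>0 z\<^sub>0 z z) \<le>
    2 * card {(i, j) \<in> index_set S n m. \<pi> (z\<^sub>0 i) (z\<^sub>0 j) \<noteq> \<pi> (z i) (z j)} +
    card {i\<in>{1..n}. z\<^sub>0 i \<noteq> z i}"
proof -
  let ?D = "{(i, j) \<in> index_set S n m. \<pi> (z\<^sub>0 i) (z\<^sub>0 j) \<noteq> \<pi> (z i) (z j)}"
  let ?r = "{i\<in>{1..n}. z\<^sub>0 i \<noteq> z i}"
  have cols: "ncols S = nrows S" using S var by (simp add: valid_model_def)
  have sym: "\<pi> (z\<^sub>0 i) (z\<^sub>0 j) = \<pi> (z\<^sub>0 j) (z\<^sub>0 i)" "\<pi> (z i) (z j) = \<pi> (z j) (z i)"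
    if "\<not> dir" "i \<in> {1..n}" "j \<in> {1..n}" for i j
    using S var \<pi> z\<^sub>0 z that cols unfolding valid_model_def by (auto simp: Pi_iff)
  have "modified_cells {1..n} {1..n} \<pi> z\<^sub>0 z\<^sub>0 z z \<subseteq> (?D \<union> prod.swap ` ?D) \<union> (\<lambda>i. (i, i)) ` ?r"
  proof
    fix ij assume ij: "ij \<in> modified_cells {1..n} {1..n} \<pi> z\<^sub>0 z\<^sub>0 z z"
    obtain i j where [simp]: "ij = (i, j)" by force
    have n: "i \<in> {1..n}" "j \<in> {1..n}" and ne: "\<pi> (z\<^sub>0 i) (z\<^sub>0 j) \<noteq> \<pi> (z i) (z j)"
      using ij by (auto simp: modified_cells_def)
    consider "i = j" | "i \<noteq> j" "i \<le> j \<or> dir" | "j < i" "\<not> dir" by linarith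
    then show "ij \<in> (?D \<union> prod.swap ` ?D) \<union> (\<lambda>i. (i, i)) ` ?r"
    proof cases
      case 1
      then show ?thesis using n ne by (auto intro!: image_eqI)
    next
      case 2
      then have "(i, j) \<in> ?D" using n ne var by (auto simp: index_set_def)
      then show ?thesis by simp
    next
      case 3
      then have "(j, i) \<in> ?D" using n ne var sym[OF 3(2) n] by (auto simp: index_set_def)
      then have "prod.swap (j, i) \<in> prod.swap ` ?D" by (rule imageI)
      then show ?thesis by simp
    qed
  qed
  moreover have fin: "finite ?D" by (rule finite_subset[OF _ finite_index_set]) auto
  ultimately have "card (modified_cells {1..n} {1..n} \<pi> z\<^sub>0 z\<^sub>0 z z) \<le>
      card ((?D \<union> prod.swap ` ?D) \<union> (\<lambda>i. (i, i)) ` ?r)"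
    by (intro card_mono) auto
  also have "\<dots> \<le> card (?D \<union> prod.swap ` ?D) + card ((\<lambda>i. (i, i)) ` ?r)" by (rule card_Un_le)
  also have "\<dots> \<le> (card ?D + card (prod.swap ` ?D)) + card ((\<lambda>i. (i, i)) ` ?r)"
    by (intro add_right_mono card_Un_le)
  also have "\<dots> \<le> (card ?D + card ?D) + card ?r"
    using fin by (intro add_mono card_image_le) auto
  finally show ?thesis by simp
qed

text \<open>The constant \<open>7/100\<close> exceeds the \<open>1/16\<close> in the definition of
  \<open>c\<close>; the difference absorbs the deviations of the log-likelihood ratios and the
  number of labels available at each site.\<close>

proposition modified_observed_cells_ge:
  assumes S: "valid_model S" and ident: "identifiability S" and sym: "symmetry_group S {(id, id)}"
    and \<pi>: "\<pi> \<in> conn_set S" and mu1: "mu_min S \<le> 1"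
    and mn: "variant S \<noteq> LBM \<longrightarrow> m = n" and n: "real n * (mu_min S)\<^sup>2 \<ge> 50"
    and c\<^sub>0: "(z\<^sub>0, w\<^sub>0) \<in> balanced_configs S (9 / 10 * mu_min S) n m" and c: "(z, w) \<in> configs S n m"
  shows "7 / 100 * (mu_min S)\<^sup>2 * weighted_dist n m (z\<^sub>0, w\<^sub>0) (z, w) \<le>
    real (card {(i, j) \<in> index_set S n m. \<pi> (z\<^sub>0 i) (w\<^sub>0 j) \<noteq> \<pi> (z i) (w j)})"
proof -
  define \<mu> where "\<mu> = mu_min S"
  have mu: "0 < \<mu>" "\<mu> \<le> 1" using mu_min_pos[OF S] mu1 by (simp_all add: \<mu>_def)
  have rows: "distinct_rows (rgroups S) (cgroups S) \<pi>"
    and cols: "distinct_rows (cgroups S) (rgroups S) (\<lambda>l q. \<pi> q l)"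
    using ident \<pi> by (auto simp: identifiability_def distinct_rows_def)
  have rigid: "s = id \<and> t = id" if "automorphism (rgroups S) (cgroups S) \<pi> s t" "(s, t) \<in> group_perms S" for s t
  proof -
    have "fixes_conn S (s, t) \<pi>" using that(1) by (simp add: automorphism_def fixes_conn_def)
    then have "(s, t) \<notin> group_perms S - {(id, id)}"
      using sym \<pi> unfolding symmetry_group_def by blast
    then show ?thesis using that(2) by simp
  qed
  have c\<^sub>0': "(z\<^sub>0, w\<^sub>0) \<in> configs S n m" using c\<^sub>0 by (simp add: balanced_configs_def)
  have z\<^sub>0: "z\<^sub>0 \<in> {1..n} \<rightarrow> rgroups S" and w\<^sub>0: "w\<^sub>0 \<in> {1..m} \<rightarrow> cgroups S"
    and z: "z \<in> {1..n} \<rightarrow> rgroups S" and w: "w \<in> {1..m} \<rightarrow> cgroups S"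
    using configs_PiE[OF S mn c\<^sub>0'] configs_PiE[OF S mn c] by (auto simp: PiE_def)
  have A: "real (card {1..n}) * (9 / 10 * \<mu>) \<le> card {i\<in>{1..n}. z\<^sub>0 i = q}" if "q \<in> rgroups S" for q
    using c\<^sub>0 that by (simp add: balanced_configs_def \<mu>_def)
  have B: "real (card {1..m}) * (9 / 10 * \<mu>) \<le> card {j\<in>{1..m}. w\<^sub>0 j = l}" if "l \<in> cgroups S" for l
    using c\<^sub>0 that by (simp add: balanced_configs_def \<mu>_def)
  show ?thesis
  proof (cases "variant S")
    case LBM
    have I: "{(i, j) \<in> index_set S n m. \<pi> (z\<^sub>0 i) (w\<^sub>0 j) \<noteq> \<pi> (z i) (w j)} =
        modified_cells {1..n} {1..m} \<pi> z\<^sub>0 w\<^sub>0 z w"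
      using LBM by (auto simp: index_set_def modified_cells_def)
    have "(9 / 10 * \<mu>)\<^sup>2 / 2 * weighted_dist n m (z\<^sub>0, w\<^sub>0) (z, w) \<le>
        card (modified_cells {1..n} {1..m} \<pi> z\<^sub>0 w\<^sub>0 z w)"
    proof -
      have "s = id \<and> t = id" if "automorphism (rgroups S) (cgroups S) \<pi> s t" for s t
        using that LBM by (intro rigid) (auto simp: automorphism_def group_perms_def)
      from modified_cells_ge_independent[OF _ _ _ _ z\<^sub>0 z w\<^sub>0 w rows cols A B _ _ this]
      show ?thesis using mu by (simp add: weighted_dist_def)
    qed
    moreover have "7 / 100 * \<mu>\<^sup>2 * weighted_dist n m (z\<^sub>0, w\<^sub>0) (z, w) \<le>
        (9 / 10 * \<mu>)\<^sup>2 / 2 * weighted_dist n m (z\<^sub>0, w\<^sub>0) (z, w)"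
      by (intro mult_right_mono weighted_dist_nonneg) (simp add: power_mult_distrib power2_eq_square)
    ultimately show ?thesis unfolding I \<mu>_def by linarith
  next
    case (SBM loops dir)
    have [simp]: "m = n" "ncols S = nrows S" using mn S SBM by (auto simp: valid_model_def)
    have [simp]: "w = z" "w\<^sub>0 = z\<^sub>0" using c c\<^sub>0' SBM by (auto simp: configs_def)
    define r where "r = real (card {i\<in>{1..n}. z\<^sub>0 i \<noteq> z i})"
    define D where "D = real (card {(i, j) \<in> index_set S n m. \<pi> (z\<^sub>0 i) (w\<^sub>0 j) \<noteq> \<pi> (z i) (w j)})"
    have "s = id" if "automorphism (rgroups S) (rgroups S) \<pi> s s" for s
      using that SBM rigid[of s s] by (auto simp: automorphism_def group_perms_def)
    from modified_cells_ge_shared[OF _ _ z\<^sub>0 z _ _ A _ _ this]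
    have "3 / 8 * (9 / 10 * \<mu>)\<^sup>2 * (real n * r) \<le> card (modified_cells {1..n} {1..n} \<pi> z\<^sub>0 z\<^sub>0 z z)"
      using rows cols mu by (simp add: r_def)
    also have "\<dots> \<le> real (2 * card {(i, j) \<in> index_set S n m. \<pi> (z\<^sub>0 i) (z\<^sub>0 j) \<noteq> \<pi> (z i) (z j)} +
        card {i\<in>{1..n}. z\<^sub>0 i \<noteq> z i})"
      by (intro of_nat_mono modified_cells_SBM_le[OF S SBM \<pi> z\<^sub>0 z])
    also have "\<dots> = 2 * D + r" by (simp add: D_def r_def)
    finally have "243 / 800 * (real n * \<mu>\<^sup>2 * r) \<le> 2 * D + r"
      by (simp add: power_mult_distrib power2_eq_square ac_simps)
    moreover have "50 * r \<le> real n * \<mu>\<^sup>2 * r"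
      using n unfolding \<mu>_def by (intro mult_right_mono) (auto simp: r_def)
    ultimately have "7 / 100 * (2 * (real n * \<mu>\<^sup>2 * r)) \<le> D"
    proof -
      assume "243 / 800 * (real n * \<mu>\<^sup>2 * r) \<le> 2 * D + r" "50 * r \<le> real n * \<mu>\<^sup>2 * r"
      moreover have "0 \<le> r" by (simp add: r_def)
      ultimately show ?thesis by linarith
    qed
    moreover have "weighted_dist n m (z\<^sub>0, w\<^sub>0) (z, w) = 2 * (real n * r)"
      by (simp add: weighted_dist_def r_def)
    ultimately show ?thesis by (simp add: D_def \<mu>_def ac_simps)
  qed
qed

section \<open>Sums over configurations\<close>

lemma sum_power_hamming_le:
  fixes u :: real
  assumes fin: "finite I" "finite Q" and u: "u \<ge> 0"
  shows "(\<Sum>z\<in>I \<rightarrow>\<^sub>E Q. u ^ card {i\<in>I. z\<^sub>0 i \<noteq> z i}) \<le> exp (card I * (card Q * u))"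
proof -
  have "(\<Sum>z\<in>I \<rightarrow>\<^sub>E Q. u ^ card {i\<in>I. z\<^sub>0 i \<noteq> z i}) = (\<Sum>z\<in>I \<rightarrow>\<^sub>E Q. \<Prod>i\<in>I. if z\<^sub>0 i \<noteq> z i then u else 1)"
    using fin by (simp add: prod.If_cases Int_def)
  also have "\<dots> = (\<Prod>i\<in>I. \<Sum>q\<in>Q. if z\<^sub>0 i \<noteq> q then u else 1)"
    using fin by (simp add: prod_sum_PiE)
  also have "\<dots> \<le> (\<Prod>i\<in>I. exp (card Q * u))"
  proof (intro prod_mono conjI sum_nonneg)
    fix i
    have "(\<Sum>q\<in>Q. if z\<^sub>0 i \<noteq> q then u else 1) \<le> (\<Sum>q\<in>Q. u + (if q = z\<^sub>0 i then 1 else 0))"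
      using u by (intro sum_mono) auto
    also have "\<dots> \<le> 1 + card Q * u" using fin by (simp add: sum.distrib)
    also have "\<dots> \<le> exp (card Q * u)" by simp
    finally show "(\<Sum>q\<in>Q. if z\<^sub>0 i \<noteq> q then u else 1) \<le> exp (card Q * u)" .
  qed (use u in auto)
  also have "\<dots> = exp (card I * (card Q * u))" by (simp add: exp_of_nat_mult)
  finally show ?thesis .
qed

lemma exp_minus_one_le: "exp x - 1 \<le> x * exp x" for x :: real
proof -
  have "(1 - x) * exp x \<le> exp (- x) * exp x"
    using exp_ge_add_one_self[of "- x"] by (intro mult_right_mono) auto
  then show ?thesis by (simp add: exp_minus algebra_simps)
qed

text \<open>Each site is either left alone or gets one of at most \<open>N = Q + L\<close> labels, so the sum
  over all configurations factorises over the sites; removing the reference configuration, which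
  contributes \<open>1\<close>, leaves at most \<open>exp x - 1\<close>.\<close>

lemma sum_exp_weighted_dist_le:
  fixes \<gamma> K :: real
  assumes S: "valid_model S" and mn: "variant S \<noteq> LBM \<longrightarrow> m = n" and c\<^sub>0: "c\<^sub>0 \<in> configs S n m"
  defines "x \<equiv> a_bound S \<gamma> (K + ln (nrows S + ncols S)) n m"
  shows "(\<Sum>c\<in>configs S n m - {c\<^sub>0}. exp (K * misclassified S n m c c\<^sub>0 - \<gamma> * weighted_dist n m c\<^sub>0 c)) \<le> x * exp x"
proof -
  obtain z\<^sub>0 w\<^sub>0 where c\<^sub>0_eq: "c\<^sub>0 = (z\<^sub>0, w\<^sub>0)" by force
  let ?e = "\<lambda>c. exp (K * misclassified S n m c c\<^sub>0 - \<gamma> * weighted_dist n m c\<^sub>0 c)"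
  define N where "N = real (nrows S + ncols S)"
  have N: "real (nrows S) \<le> N" "real (ncols S) \<le> N" "N > 0"
    using S by (auto simp: N_def valid_model_def)
  have "(\<Sum>c\<in>configs S n m. ?e c) \<le> exp x"
  proof (cases "variant S")
    case LBM
    define u where "u = exp (K - \<gamma> * m)"
    define v where "v = exp (K - \<gamma> * n)"
    have "?e c = u ^ card {i\<in>{1..n}. z\<^sub>0 i \<noteq> fst c i} * v ^ card {j\<in>{1..m}. w\<^sub>0 j \<noteq> snd c j}" for c
      unfolding misclassified_commute[of S n m c]
      by (cases c) (simp add: u_def v_def exp_of_nat_mult[symmetric] exp_add[symmetric] c\<^sub>0_eq LBM misclassified_def
          weighted_dist_def algebra_simps)
    then have "(\<Sum>c\<in>configs S n m. ?e c) =
        (\<Sum>z\<in>{1..n} \<rightarrow>\<^sub>E rgroups S. \<Sum>w\<in>{1..m} \<rightarrow>\<^sub>E cgroups S.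
          u ^ card {i\<in>{1..n}. z\<^sub>0 i \<noteq> z i} * v ^ card {j\<in>{1..m}. w\<^sub>0 j \<noteq> w j})"
      using LBM by (simp add: configs_def sum.cartesian_product case_prod_unfold)
    also have "\<dots> = (\<Sum>z\<in>{1..n} \<rightarrow>\<^sub>E rgroups S. u ^ card {i\<in>{1..n}. z\<^sub>0 i \<noteq> z i}) *
        (\<Sum>w\<in>{1..m} \<rightarrow>\<^sub>E cgroups S. v ^ card {j\<in>{1..m}. w\<^sub>0 j \<noteq> w j})"
      by (simp add: sum_product)
    also have "\<dots> \<le> exp (n * (nrows S * u)) * exp (m * (ncols S * v))"
      using sum_power_hamming_le[of "{1..n}" "rgroups S" u z\<^sub>0] sum_power_hamming_le[of "{1..m}" "cgroups S" v w\<^sub>0]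
      by (intro mult_mono sum_nonneg) (auto simp: u_def v_def)
    also have "\<dots> \<le> exp (n * (N * u) + m * (N * v))"
      unfolding exp_add[symmetric] exp_le_cancel_iff
      using N by (intro add_mono mult_left_mono mult_right_mono) (auto simp: u_def v_def)
    also have "n * (N * u) + m * (N * v) = x"
      using N by (simp add: x_def a_bound_def LBM N_def u_def v_def exp_add exp_diff exp_minus field_simps)
    finally show ?thesis .
  next
    case (SBM loops dir)
    have [simp]: "m = n" using mn SBM by simp
    define u where "u = exp (K - 2 * n * \<gamma>)"
    have "configs S n m = (\<lambda>z. (z, z)) ` ({1..n} \<rightarrow>\<^sub>E rgroups S)"
      using SBM by (auto simp: configs_def)
    then have "(\<Sum>c\<in>configs S n m. ?e c) = (\<Sum>z\<in>{1..n} \<rightarrow>\<^sub>E rgroups S. ?e (z, z))"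
      by (simp add: sum.reindex inj_on_def)
    also have "\<dots> = (\<Sum>z\<in>{1..n} \<rightarrow>\<^sub>E rgroups S. u ^ card {i\<in>{1..n}. z\<^sub>0 i \<noteq> z i})"
    proof (intro sum.cong refl)
      fix z
      have "w\<^sub>0 = z\<^sub>0" using c\<^sub>0 SBM by (auto simp: configs_def c\<^sub>0_eq)
      then show "?e (z, z) = u ^ card {i\<in>{1..n}. z\<^sub>0 i \<noteq> z i}"
        unfolding misclassified_commute[of S n m "(z, z)"]
        by (simp add: u_def exp_of_nat_mult[symmetric] c\<^sub>0_eq SBM misclassified_def weighted_dist_def
            algebra_simps)
    qed
    also have "\<dots> \<le> exp (n * (nrows S * u))"
      using sum_power_hamming_le[of "{1..n}" "rgroups S" u z\<^sub>0] by (simp add: u_def)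
    also have "\<dots> \<le> exp (n * (N * u))"
      using N by (auto simp: u_def intro!: mult_left_mono)
    also have "n * (N * u) = x"
      using N by (simp add: x_def a_bound_def SBM N_def u_def exp_add exp_diff exp_minus field_simps)
    finally show ?thesis .
  qed
  moreover have "(\<Sum>c\<in>configs S n m. ?e c) = ?e c\<^sub>0 + (\<Sum>c\<in>configs S n m - {c\<^sub>0}. ?e c)"
    using c\<^sub>0 finite_configs by (intro sum.remove) auto
  moreover have "?e c\<^sub>0 = 1"
    by (simp add: c\<^sub>0_eq misclassified_def weighted_dist_def split: variant.splits)
  ultimately show ?thesis using exp_minus_one_le[of x] by linarith
qed

section \<open>The prior\<close>

lemma sum_iid_weights:
  assumes "finite I" "finite Q" "(\<Sum>q\<in>Q. a q) = (1::real)"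
  shows "(\<Sum>z\<in>I \<rightarrow>\<^sub>E Q. \<Prod>i\<in>I. a (z i)) = 1"
  using assms prod_sum_PiE[of I "\<lambda>_. Q" "\<lambda>_. a"] by simp

text \<open>Chernoff's bound with exponent \<open>1/10\<close>: each site contributes a factor at most \<open>1
  - \<mu> (1 - exp (- 1/10)) \<le> exp (- 19 \<mu> / 200)\<close>, against \<open>exp (18 \<mu> /
  200)\<close> from the threshold.\<close>

lemma sum_iid_small_class_le:
  fixes a :: "'a \<Rightarrow> real" and \<mu> :: real
  assumes fin: "finite I" "finite Q" and a: "\<And>q. q \<in> Q \<Longrightarrow> a q \<ge> 0" "(\<Sum>q\<in>Q. a q) = 1"
    and q: "q \<in> Q" "\<mu> \<le> a q"
  shows "(\<Sum>z | z \<in> I \<rightarrow>\<^sub>E Q \<and> card {i\<in>I. z i = q} < card I * (9 / 10 * \<mu>). \<Prod>i\<in>I. a (z i))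
    \<le> exp (- (card I * \<mu> / 200))"
proof -
  define e :: real where "e = exp (- 1 / 10)"
  have e: "e \<le> 181 / 200"
  proof -
    have "1 + 1 / 10 + (1 / 10)\<^sup>2 / 2 \<le> exp (1 / 10 :: real)" by (intro exp_lower_Taylor_quadratic) simp
    then have "200 / 181 \<le> exp (1 / 10 :: real)" by (simp add: power2_eq_square)
    then have "inverse (exp (1 / 10 :: real)) \<le> inverse (200 / 181)" by (intro le_imp_inverse_le) auto
    then show ?thesis by (simp add: e_def exp_minus)
  qed
  have e0: "0 < e" by (simp add: e_def)
  define T where "T = card I * (9 / 10 * \<mu>)"
  have "(\<Sum>z | z \<in> I \<rightarrow>\<^sub>E Q \<and> card {i\<in>I. z i = q} < T. \<Prod>i\<in>I. a (z i))
      \<le> (\<Sum>z\<in>I \<rightarrow>\<^sub>E Q. exp (T / 10) * (\<Prod>i\<in>I. (if z i = q then e else 1) * a (z i)))"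
  proof -
    have "(\<Prod>i\<in>I. a (z i)) \<le> exp (T / 10) * (\<Prod>i\<in>I. (if z i = q then e else 1) * a (z i))"
      if "z \<in> I \<rightarrow>\<^sub>E Q" "card {i\<in>I. z i = q} < T" for z
    proof -
      have "exp (T / 10) * e ^ card {i\<in>I. z i = q} = exp ((T - card {i\<in>I. z i = q}) / 10)"
        by (simp add: e_def exp_of_nat_mult[symmetric] exp_add[symmetric] field_simps)
      then have "1 \<le> exp (T / 10) * e ^ card {i\<in>I. z i = q}" using that(2) by simp
      then have "1 * (\<Prod>i\<in>I. a (z i)) \<le> (exp (T / 10) * e ^ card {i\<in>I. z i = q}) * (\<Prod>i\<in>I. a (z i))"
        using that(1) a by (intro mult_right_mono prod_nonneg) auto
      then show ?thesis using fin by (simp add: prod.distrib prod.If_cases Int_def)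
    qed
    moreover have "0 \<le> exp (T / 10) * (\<Prod>i\<in>I. (if z i = q then e else 1) * a (z i))"
      if "z \<in> I \<rightarrow>\<^sub>E Q" for z
      using that a e0 by (intro mult_nonneg_nonneg prod_nonneg) (auto simp: PiE_iff)
    ultimately show ?thesis
      using fin by (intro order_trans[OF sum_mono sum_mono2]) (auto intro: finite_PiE)
  qed
  also have "\<dots> = exp (T / 10) * (\<Prod>i\<in>I. \<Sum>q'\<in>Q. (if q' = q then e else 1) * a q')"
    unfolding sum_distrib_left[symmetric] by (subst prod_sum_PiE) (use fin in auto)
  also have "(\<Sum>q'\<in>Q. (if q' = q then e else 1) * a q') = 1 - a q * (1 - e)"
  proof -
    have "(\<Sum>q'\<in>Q. (if q' = q then e else 1) * a q') = (\<Sum>q'\<in>Q. a q' - (if q' = q then a q * (1 - e) else 0))"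
      by (intro sum.cong) (auto simp: algebra_simps)
    then show ?thesis using fin q a by (simp add: sum_subtractf)
  qed
  also have "exp (T / 10) * (\<Prod>i\<in>I. 1 - a q * (1 - e)) \<le> exp (T / 10) * (\<Prod>i\<in>I. exp (- (19 / 200 * \<mu>)))"
  proof (intro mult_left_mono prod_mono conjI)
    have "a q \<le> 1" using a q member_le_sum[of q Q a] fin by simp
    then show "0 \<le> 1 - a q * (1 - e)" using e0 e q a(1)[OF q(1)] mult_mono[of "a q" 1 "1 - e" 1] by simp
    have "19 / 200 * a q \<le> (1 - e) * a q" using e a(1)[OF q(1)] by (intro mult_right_mono) auto
    then have "19 / 200 * \<mu> \<le> a q * (1 - e)" using q(2) by (simp add: mult.commute)
    then have "1 - a q * (1 - e) \<le> 1 + - (19 / 200 * \<mu>)" by simp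
    also have "\<dots> \<le> exp (- (19 / 200 * \<mu>))" by (rule exp_ge_add_one_self)
    finally show "1 - a q * (1 - e) \<le> exp (- (19 / 200 * \<mu>))" .
  qed simp
  also have "\<dots> = exp (- (card I * \<mu> / 200))"
    by (simp add: T_def exp_of_nat_mult[symmetric] exp_add[symmetric] field_simps)
  finally show ?thesis by (simp add: T_def)
qed

lemma sum_prior:
  assumes S: "valid_model S" and \<theta>: "\<theta> \<in> Theta S"
  shows "(\<Sum>c\<in>configs S n m. prior S n m \<theta> c) = 1"
proof (cases "variant S")
  case LBM
  have "(\<Sum>c\<in>configs S n m. prior S n m \<theta> c) =
      (\<Sum>z\<in>{1..n} \<rightarrow>\<^sub>E rgroups S. \<Prod>i\<in>{1..n}. alpha \<theta> (z i)) *
      (\<Sum>w\<in>{1..m} \<rightarrow>\<^sub>E cgroups S. \<Prod>j\<in>{1..m}. beta \<theta> (w j))"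
    using LBM by (simp add: configs_def prior_def sum.cartesian_product case_prod_unfold sum_product)
  then show ?thesis using sum_alpha[OF S \<theta>] sum_beta[OF S \<theta>] by (simp add: sum_iid_weights)
next
  case (SBM loops dir)
  then have "configs S n m = (\<lambda>z. (z, z)) ` ({1..n} \<rightarrow>\<^sub>E rgroups S)" by (auto simp: configs_def)
  then have "(\<Sum>c\<in>configs S n m. prior S n m \<theta> c) =
      (\<Sum>z\<in>{1..n} \<rightarrow>\<^sub>E rgroups S. \<Prod>i\<in>{1..n}. alpha \<theta> (z i))"
    using SBM by (simp add: sum.reindex inj_on_def prior_def)
  then show ?thesis using sum_alpha[OF S \<theta>] by (simp add: sum_iid_weights)
qed

lemma sum_prior_small_row_class_le:
  assumes S: "valid_model S" and \<theta>: "\<theta> \<in> Theta S" and q: "q \<in> rgroups S"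
  shows "(\<Sum>c | c \<in> configs S n m \<and> card {i\<in>{1..n}. fst c i = q} < n * (9 / 10 * mu_min S).
    prior S n m \<theta> c) \<le> exp (- (n * mu_min S / 200))"
proof -
  define Z where "Z = {z. z \<in> {1..n} \<rightarrow>\<^sub>E rgroups S \<and> card {i\<in>{1..n}. z i = q} < n * (9 / 10 * mu_min S)}"
  have "(\<Sum>z\<in>Z. \<Prod>i\<in>{1..n}. alpha \<theta> (z i)) \<le> exp (- (n * mu_min S / 200))"
    using sum_iid_small_class_le[where I = "{1..n}" and Q = "rgroups S" and a = "alpha \<theta>" and q = q and \<mu> = "mu_min S"]
      alpha_pos[OF S \<theta>] alpha_ge[OF S \<theta>] sum_alpha[OF S \<theta>] q
    by (simp add: Z_def less_imp_le)
  moreover have "(\<Sum>c | c \<in> configs S n m \<and> card {i\<in>{1..n}. fst c i = q} < n * (9 / 10 * mu_min S).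
    prior S n m \<theta> c) = (\<Sum>z\<in>Z. \<Prod>i\<in>{1..n}. alpha \<theta> (z i))"
  proof (cases "variant S")
    case LBM
    then have "{c \<in> configs S n m. card {i\<in>{1..n}. fst c i = q} < n * (9 / 10 * mu_min S)} =
        Z \<times> ({1..m} \<rightarrow>\<^sub>E cgroups S)"
      by (auto simp: configs_def Z_def)
    then have "(\<Sum>c | c \<in> configs S n m \<and> card {i\<in>{1..n}. fst c i = q} < n * (9 / 10 * mu_min S).
        prior S n m \<theta> c) = (\<Sum>z\<in>Z. \<Prod>i\<in>{1..n}. alpha \<theta> (z i)) *
        (\<Sum>w\<in>{1..m} \<rightarrow>\<^sub>E cgroups S. \<Prod>j\<in>{1..m}. beta \<theta> (w j))"
      using LBM by (simp add: prior_def sum.cartesian_product case_prod_unfold sum_product)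
    then show ?thesis using sum_beta[OF S \<theta>] by (simp add: sum_iid_weights)
  next
    case (SBM loops dir)
    then have "{c \<in> configs S n m. card {i\<in>{1..n}. fst c i = q} < n * (9 / 10 * mu_min S)} =
        (\<lambda>z. (z, z)) ` Z"
      by (auto simp: configs_def Z_def)
    then show ?thesis using SBM by (simp add: sum.reindex inj_on_def prior_def)
  qed
  ultimately show ?thesis by simp
qed

lemma sum_prior_small_column_class_le:
  assumes S: "valid_model S" and \<theta>: "\<theta> \<in> Theta S" and l: "l \<in> cgroups S"
    and mn: "variant S \<noteq> LBM \<longrightarrow> m = n"
  shows "(\<Sum>c | c \<in> configs S n m \<and> card {j\<in>{1..m}. snd c j = l} < m * (9 / 10 * mu_min S).
    prior S n m \<theta> c) \<le> exp (- (m * mu_min S / 200))"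
proof (cases "variant S")
  case LBM
  define W where "W = {w. w \<in> {1..m} \<rightarrow>\<^sub>E cgroups S \<and> card {j\<in>{1..m}. w j = l} < m * (9 / 10 * mu_min S)}"
  have "{c \<in> configs S n m. card {j\<in>{1..m}. snd c j = l} < m * (9 / 10 * mu_min S)} =
      ({1..n} \<rightarrow>\<^sub>E rgroups S) \<times> W"
    using LBM by (auto simp: configs_def W_def)
  then have "(\<Sum>c | c \<in> configs S n m \<and> card {j\<in>{1..m}. snd c j = l} < m * (9 / 10 * mu_min S).
      prior S n m \<theta> c) = (\<Sum>z\<in>{1..n} \<rightarrow>\<^sub>E rgroups S. \<Prod>i\<in>{1..n}. alpha \<theta> (z i)) *
      (\<Sum>w\<in>W. \<Prod>j\<in>{1..m}. beta \<theta> (w j))"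
    using LBM by (simp add: prior_def sum.cartesian_product case_prod_unfold sum_product)
  also have "\<dots> \<le> exp (- (m * mu_min S / 200))"
    using sum_iid_small_class_le[where I = "{1..m}" and Q = "cgroups S" and a = "beta \<theta>" and q = l and \<mu> = "mu_min S"]
      beta_pos[OF S \<theta>] beta_ge[OF S \<theta>] sum_alpha[OF S \<theta>] sum_beta[OF S \<theta>] l
    by (simp add: W_def less_imp_le sum_iid_weights)
  finally show ?thesis .
next
  case (SBM loops dir)
  then have *: "m = n" "l \<in> rgroups S" using mn S l by (auto simp: valid_model_def)
  have "{c \<in> configs S n m. card {j\<in>{1..m}. snd c j = l} < m * (9 / 10 * mu_min S)} =
      {c \<in> configs S n m. card {i\<in>{1..n}. fst c i = l} < n * (9 / 10 * mu_min S)}"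
    using SBM * by (auto simp: configs_def)
  then show ?thesis using sum_prior_small_row_class_le[OF S \<theta> *(2), of n m] * by simp
qed

lemma sum_Un_le:
  fixes f :: "'a \<Rightarrow> real"
  assumes "finite A" "finite B" "\<And>x. x \<in> A \<Longrightarrow> 0 \<le> f x"
  shows "sum f (A \<union> B) \<le> sum f A + sum f B"
proof -
  have "0 \<le> sum f (A \<inter> B)" using assms(3) by (intro sum_nonneg) auto
  then show ?thesis using sum.union_inter[OF assms(1,2), of f] by linarith
qed

lemma sum_UN_le:
  fixes f :: "'a \<Rightarrow> real"
  assumes "finite I" "\<And>i. i \<in> I \<Longrightarrow> finite (A i)" "\<And>i x. i \<in> I \<Longrightarrow> x \<in> A i \<Longrightarrow> 0 \<le> f x"
  shows "sum f (\<Union>i\<in>I. A i) \<le> (\<Sum>i\<in>I. sum f (A i))"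
  using assms
proof (induction I rule: finite_induct)
  case (insert i I)
  then have "sum f (A i \<union> (\<Union>i\<in>I. A i)) \<le> sum f (A i) + sum f (\<Union>i\<in>I. A i)"
    by (intro sum_Un_le) auto
  then show ?case using insert by fastforce
qed simp

lemma sum_prior_unbalanced_le:
  assumes S: "valid_model S" and \<theta>: "\<theta> \<in> Theta S" and mn: "variant S \<noteq> LBM \<longrightarrow> m = n"
  shows "(\<Sum>c\<in>configs S n m - balanced_configs S (9 / 10 * mu_min S) n m. prior S n m \<theta> c) \<le>
    nrows S * exp (- (n * mu_min S / 200)) + ncols S * exp (- (m * mu_min S / 200))"
proof -
  define Z where "Z q = {c. c \<in> configs S n m \<and> card {i\<in>{1..n}. fst c i = q} < n * (9 / 10 * mu_min S)}" for q
  define W where "W l = {c. c \<in> configs S n m \<and> card {j\<in>{1..m}. snd c j = l} < m * (9 / 10 * mu_min S)}" for l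
  have fin: "finite (Z q)" "finite (W q)" for q
    unfolding Z_def W_def using finite_configs[of S n m] by auto
  have nn: "c \<in> Z q \<Longrightarrow> prior S n m \<theta> c \<ge> 0" "c \<in> W q \<Longrightarrow> prior S n m \<theta> c \<ge> 0" for c q
    using prior_nonneg[OF S \<theta>, of c n m] by (simp_all add: Z_def W_def)
  have "configs S n m - balanced_configs S (9 / 10 * mu_min S) n m \<subseteq>
      (\<Union>q\<in>rgroups S. Z q) \<union> (\<Union>l\<in>cgroups S. W l)"
    by (fastforce simp: balanced_configs_def Z_def W_def not_le)
  then have "(\<Sum>c\<in>configs S n m - balanced_configs S (9 / 10 * mu_min S) n m. prior S n m \<theta> c) \<le>
      (\<Sum>c\<in>(\<Union>q\<in>rgroups S. Z q) \<union> (\<Union>l\<in>cgroups S. W l). prior S n m \<theta> c)"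
    using fin nn by (intro sum_mono2) auto
  also have "\<dots> \<le> (\<Sum>c\<in>(\<Union>q\<in>rgroups S. Z q). prior S n m \<theta> c) + (\<Sum>c\<in>(\<Union>l\<in>cgroups S. W l). prior S n m \<theta> c)"
    using fin nn by (intro sum_Un_le) auto
  also have "\<dots> \<le> (\<Sum>q\<in>rgroups S. \<Sum>c\<in>Z q. prior S n m \<theta> c) + (\<Sum>l\<in>cgroups S. \<Sum>c\<in>W l. prior S n m \<theta> c)"
    using fin nn by (intro add_mono sum_UN_le) auto
  also have "\<dots> \<le> (\<Sum>q\<in>rgroups S. exp (- (n * mu_min S / 200))) + (\<Sum>l\<in>cgroups S. exp (- (m * mu_min S / 200)))"
    unfolding Z_def W_def
    by (intro add_mono sum_mono sum_prior_small_row_class_le[OF S \<theta>]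
        sum_prior_small_column_class_le[OF S \<theta> _ mn])
  finally show ?thesis by simp
qed

lemma
  assumes S: "valid_model S" and \<theta>: "\<theta> \<in> Theta S"
  shows alpha_le_alpha_max: "q \<in> rgroups S \<Longrightarrow> alpha \<theta> q \<le> alpha_max S"
    and beta_le_beta_max: "l \<in> cgroups S \<Longrightarrow> beta \<theta> l \<le> beta_max S"
proof -
  have "alpha \<theta>' q \<le> 1" if "\<theta>' \<in> Theta S" "q \<in> rgroups S" for \<theta>' q
    using member_le_sum[of q "rgroups S" "alpha \<theta>'"] alpha_pos[OF S that(1)] sum_alpha[OF S that(1)] that(2)
    by (auto simp: less_imp_le)
  then show "q \<in> rgroups S \<Longrightarrow> alpha \<theta> q \<le> alpha_max S"
    unfolding alpha_max_def using \<theta> by (intro cSup_upper) (auto intro!: bdd_aboveI[of _ 1])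
  have "beta \<theta>' l \<le> 1" if "\<theta>' \<in> Theta S" "l \<in> cgroups S" for \<theta>' l
    using member_le_sum[of l "cgroups S" "beta \<theta>'"] beta_pos[OF S that(1)] sum_beta[OF S that(1)] that(2)
    by (auto simp: less_imp_le)
  then show "l \<in> cgroups S \<Longrightarrow> beta \<theta> l \<le> beta_max S"
    unfolding beta_max_def using \<theta> by (intro cSup_upper) (auto intro!: bdd_aboveI[of _ 1])
qed

lemma weight_ratio_le:
  fixes a :: "nat \<Rightarrow> real"
  assumes "\<And>q. q \<in> Q \<Longrightarrow> lo \<le> a q" "\<And>q. q \<in> Q \<Longrightarrow> a q \<le> hi" "0 < lo" "ln (hi / lo) \<le> K"
    and "q \<in> Q" "q' \<in> Q"
  shows "a q \<le> exp K * a q'"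
proof -
  have "lo \<le> hi" using assms(1,2,5) by (meson order_trans)
  then have "hi / lo = exp (ln (hi / lo))" using assms(3) by simp
  also have "\<dots> \<le> exp K" using assms(4) by simp
  finally have "hi \<le> exp K * lo" using assms(3) by (simp add: field_simps)
  also have "\<dots> \<le> exp K * a q'" using assms by simp
  finally show ?thesis using assms(2,5) by force
qed

lemma prod_weight_ratio_le:
  fixes a :: "'a \<Rightarrow> real"
  assumes "finite I" "z \<in> I \<rightarrow> Q" "z' \<in> I \<rightarrow> Q" "\<And>q. q \<in> Q \<Longrightarrow> 0 \<le> a q"
    and "\<And>q q'. q \<in> Q \<Longrightarrow> q' \<in> Q \<Longrightarrow> a q \<le> exp K * a q'"
  shows "(\<Prod>i\<in>I. a (z i)) \<le> exp (K * card {i\<in>I. z i \<noteq> z' i}) * (\<Prod>i\<in>I. a (z' i))"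
proof -
  have "(\<Prod>i\<in>I. a (z i)) \<le> (\<Prod>i\<in>I. (if z i \<noteq> z' i then exp K else 1) * a (z' i))"
    using assms by (intro prod_mono) (auto simp: Pi_iff)
  also have "\<dots> = exp (K * card {i\<in>I. z i \<noteq> z' i}) * (\<Prod>i\<in>I. a (z' i))"
    using assms(1) by (simp add: prod.distrib prod.If_cases Int_def exp_of_nat_mult[symmetric] mult.commute)
  finally show ?thesis .
qed

lemma prior_ratio_le:
  assumes S: "valid_model S" and \<theta>: "\<theta> \<in> Theta S" and mn: "variant S \<noteq> LBM \<longrightarrow> m = n"
    and c: "c \<in> configs S n m" and c': "c' \<in> configs S n m"
    and K: "ln (alpha_max S / alpha_min S) \<le> K" "ln (beta_max S / beta_min S) \<le> K"
  shows "prior S n m \<theta> c \<le> exp (K * misclassified S n m c c') * prior S n m \<theta> c'"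
proof -
  obtain z w z' w' where zw: "c = (z, w)" "c' = (z', w')" by force
  have PiE: "z \<in> {1..n} \<rightarrow> rgroups S" "z' \<in> {1..n} \<rightarrow> rgroups S"
      "w \<in> {1..m} \<rightarrow> cgroups S" "w' \<in> {1..m} \<rightarrow> cgroups S"
    using configs_PiE[OF S mn] c c' by (auto simp: zw PiE_def)
  have pos: "alpha_min S > 0" "beta_min S > 0" using S by (auto simp: valid_model_def)
  have a: "alpha \<theta> q \<le> exp K * alpha \<theta> q'" if "q \<in> rgroups S" "q' \<in> rgroups S" for q q'
    using that \<theta> alpha_le_alpha_max[OF S \<theta>] pos K
    by (intro weight_ratio_le[of "rgroups S" "alpha_min S" _ "alpha_max S"]) (auto simp: Theta_def)
  have b: "beta \<theta> l \<le> exp K * beta \<theta> l'" if "l \<in> cgroups S" "l' \<in> cgroups S" for l l'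
    using that \<theta> beta_le_beta_max[OF S \<theta>] pos K
    by (intro weight_ratio_le[of "cgroups S" "beta_min S" _ "beta_max S"]) (auto simp: Theta_def)
  have A: "(\<Prod>i\<in>{1..n}. alpha \<theta> (z i)) \<le>
      exp (K * card {i\<in>{1..n}. z i \<noteq> z' i}) * (\<Prod>i\<in>{1..n}. alpha \<theta> (z' i))"
    using PiE a alpha_pos[OF S \<theta>] by (intro prod_weight_ratio_le[of _ _ "rgroups S"]) (auto simp: less_imp_le)
  have B: "(\<Prod>j\<in>{1..m}. beta \<theta> (w j)) \<le>
      exp (K * card {j\<in>{1..m}. w j \<noteq> w' j}) * (\<Prod>j\<in>{1..m}. beta \<theta> (w' j))"
    using PiE b beta_pos[OF S \<theta>] by (intro prod_weight_ratio_le[of _ _ "cgroups S"]) (auto simp: less_imp_le)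
  show ?thesis
  proof (cases "variant S")
    case LBM
    have nn: "0 \<le> (\<Prod>i\<in>{1..n}. alpha \<theta> (z' i))" "0 \<le> (\<Prod>j\<in>{1..m}. beta \<theta> (w j))"
      by (intro prod_nonneg less_imp_le alpha_pos[OF S \<theta>] beta_pos[OF S \<theta>] ballI funcset_mem[OF PiE(2)]
          funcset_mem[OF PiE(3)], assumption)+
    have "(\<Prod>i\<in>{1..n}. alpha \<theta> (z i)) * (\<Prod>j\<in>{1..m}. beta \<theta> (w j)) \<le>
        (exp (K * card {i\<in>{1..n}. z i \<noteq> z' i}) * (\<Prod>i\<in>{1..n}. alpha \<theta> (z' i))) *
        (exp (K * card {j\<in>{1..m}. w j \<noteq> w' j}) * (\<Prod>j\<in>{1..m}. beta \<theta> (w' j)))"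
      using nn by (intro mult_mono A B) auto
    then show ?thesis
      using LBM by (simp add: zw prior_def misclassified_def distrib_left exp_add ac_simps)
  next
    case (SBM loops dir)
    then show ?thesis using A by (simp add: zw prior_def misclassified_def)
  qed
qed

section \<open>Posterior odds\<close>

definition likelihood ::
  "('x, 'p) block_model \<Rightarrow> nat \<Rightarrow> nat \<Rightarrow> (nat \<Rightarrow> nat \<Rightarrow> 'p) \<Rightarrow> (nat \<times> nat \<Rightarrow> 'x) \<Rightarrow> config \<Rightarrow> real"
  where "likelihood S n m \<pi> x = (\<lambda>(z, w).
    \<Prod>(i, j)\<in>index_set S n m. density_fn S (\<pi> (z i) (w j)) (x (i, j)))"

lemma joint_density_eq_likelihood:
  "joint_density S n m \<theta> x c = prior S n m \<theta> c * likelihood S n m (conn \<theta>) x c"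
  by (cases c) (simp add: joint_density_def likelihood_def)

text \<open>A log-likelihood ratio within a finite distance of a number is itself finite; since an infinite term
  makes the whole sum infinite, no density involved in it vanishes.\<close>

lemma likelihood_bounds:
  assumes S: "valid_model S" and \<pi>: "\<pi> \<in> conn_set S" and x: "x \<in> space (data_space S n m)"
    and c\<^sub>0: "c\<^sub>0 \<in> configs S n m" and c: "c \<in> configs S n m"
    and dev: "\<bar>log_lik_ratio S n m \<pi> c\<^sub>0 c x - ereal E\<bar> < ereal \<delta>"
  shows "0 < likelihood S n m \<pi> x c\<^sub>0"
    and "likelihood S n m \<pi> x c \<le> exp (- (E - \<delta>)) * likelihood S n m \<pi> x c\<^sub>0"
    and "exp (- (E + \<delta>)) * likelihood S n m \<pi> x c\<^sub>0 \<le> likelihood S n m \<pi> x c"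
proof -
  obtain z\<^sub>0 w\<^sub>0 z w where zw: "c\<^sub>0 = (z\<^sub>0, w\<^sub>0)" "c = (z, w)" by force
  let ?I = "index_set S n m"
  define f\<^sub>0 where "f\<^sub>0 ij = density_fn S (\<pi> (z\<^sub>0 (fst ij)) (w\<^sub>0 (snd ij))) (x ij)" for ij
  define f where "f ij = density_fn S (\<pi> (z (fst ij)) (w (snd ij))) (x ij)" for ij
  have nn: "f\<^sub>0 ij \<ge> 0" "f ij \<ge> 0" if "ij \<in> ?I" for ij
  proof -
    have "x ij \<in> space (base S)"
      using x that by (auto simp: data_space_def space_PiM dest: PiE_mem)
    then show "f\<^sub>0 ij \<ge> 0" "f ij \<ge> 0"
      using entry_in_entry_set[OF S \<pi>, of _ _ n m "fst ij" "snd ij"] c\<^sub>0 c that S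
      by (auto simp: zw f\<^sub>0_def f_def valid_model_def)
  qed
  have llr: "log_lik_ratio S n m \<pi> c\<^sub>0 c x = (\<Sum>ij\<in>?I. elog (f\<^sub>0 ij) - elog (f ij))"
    by (simp add: zw log_lik_ratio_def f\<^sub>0_def f_def case_prod_unfold)
  have "\<bar>log_lik_ratio S n m \<pi> c\<^sub>0 c x\<bar> \<noteq> \<infinity>"
    using dev by (cases "log_lik_ratio S n m \<pi> c\<^sub>0 c x") auto
  then have fin: "\<bar>elog (f\<^sub>0 ij) - elog (f ij)\<bar> \<noteq> \<infinity>" if "ij \<in> ?I" for ij
    using that finite_index_set[of S n m] unfolding llr by (auto simp: sum_Inf)
  have pos: "f\<^sub>0 ij > 0" "f ij > 0" if "ij \<in> ?I" for ij
    using fin[OF that] nn[OF that] by (auto simp: elog_def less_le split: if_splits)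
  have "log_lik_ratio S n m \<pi> c\<^sub>0 c x = (\<Sum>ij\<in>?I. ereal (ln (f\<^sub>0 ij) - ln (f ij)))"
    unfolding llr
  proof (intro sum.cong refl)
    fix ij assume "ij \<in> ?I"
    then show "elog (f\<^sub>0 ij) - elog (f ij) = ereal (ln (f\<^sub>0 ij) - ln (f ij))"
      using pos[of ij] by (simp add: elog_def)
  qed
  then have "log_lik_ratio S n m \<pi> c\<^sub>0 c x = ereal ((\<Sum>ij\<in>?I. ln (f\<^sub>0 ij)) - (\<Sum>ij\<in>?I. ln (f ij)))"
    by (simp add: sum_subtractf)
  then have close: "\<bar>(\<Sum>ij\<in>?I. ln (f\<^sub>0 ij)) - (\<Sum>ij\<in>?I. ln (f ij)) - E\<bar> < \<delta>" using dev by simp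
  have L: "likelihood S n m \<pi> x c\<^sub>0 = exp (\<Sum>ij\<in>?I. ln (f\<^sub>0 ij))" "likelihood S n m \<pi> x c = exp (\<Sum>ij\<in>?I. ln (f ij))"
    using pos finite_index_set[of S n m]
    by (auto simp: exp_sum zw likelihood_def f\<^sub>0_def f_def case_prod_unfold intro!: prod.cong)
  show "0 < likelihood S n m \<pi> x c\<^sub>0"
    and "likelihood S n m \<pi> x c \<le> exp (- (E - \<delta>)) * likelihood S n m \<pi> x c\<^sub>0"
    and "exp (- (E + \<delta>)) * likelihood S n m \<pi> x c\<^sub>0 \<le> likelihood S n m \<pi> x c"
    using close unfolding L exp_add[symmetric] by auto
qed

lemma posterior_from_odds:
  assumes c\<^sub>0: "c\<^sub>0 \<in> configs S n m" and pos: "0 < joint_density S n m \<theta> x c\<^sub>0"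
    and nn: "\<And>c. c \<in> configs S n m \<Longrightarrow> 0 \<le> joint_density S n m \<theta> x c"
  shows posterior_ge_from_odds:
      "(\<Sum>c\<in>configs S n m - {c\<^sub>0}. joint_density S n m \<theta> x c) \<le> s * joint_density S n m \<theta> x c\<^sub>0 \<Longrightarrow>
       1 - s \<le> posterior S n m \<theta> x c\<^sub>0"
    and posterior_le_from_odds:
      "s * joint_density S n m \<theta> x c\<^sub>0 \<le> (\<Sum>c\<in>configs S n m - {c\<^sub>0}. joint_density S n m \<theta> x c) \<Longrightarrow> 0 \<le> s \<Longrightarrow>
       posterior S n m \<theta> x c\<^sub>0 \<le> inverse (1 + s)"
proof -
  define J where "J = joint_density S n m \<theta> x c\<^sub>0"
  define T where "T = (\<Sum>c\<in>configs S n m - {c\<^sub>0}. joint_density S n m \<theta> x c)"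
  have p: "posterior S n m \<theta> x c\<^sub>0 = J / (J + T)"
    unfolding posterior_def J_def T_def using c\<^sub>0 finite_configs by (subst sum.remove[of _ c\<^sub>0]) auto
  have J: "J > 0" and T: "T \<ge> 0" using pos nn by (auto simp: J_def T_def intro!: sum_nonneg)
  { assume "T \<le> s * J"
    moreover from this have "0 \<le> s * J" using T by linarith
    then have "0 \<le> s * T" using J T by (simp add: zero_le_mult_iff)
    ultimately have "(1 - s) * (J + T) \<le> J" by (simp add: algebra_simps)
    then show "1 - s \<le> posterior S n m \<theta> x c\<^sub>0" using J T by (simp add: p field_simps) }
  { assume "s * J \<le> T" "0 \<le> s"
    then have "J * (1 + s) \<le> J + T" by (simp add: algebra_simps)
    then show "posterior S n m \<theta> x c\<^sub>0 \<le> inverse (1 + s)"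
      using J T \<open>0 \<le> s\<close> by (simp add: p field_simps) }
qed

text \<open>The single relabellings whose odds bound the posterior from above. For graphs the rows and the
  columns are relabelled together, which doubles the distance.\<close>

definition row_flip :: "('x, 'p) block_model \<Rightarrow> config \<Rightarrow> nat \<Rightarrow> nat \<Rightarrow> config" where
  "row_flip S = (\<lambda>(z, w) i q. (z(i := q), case variant S of LBM \<Rightarrow> w | SBM _ _ \<Rightarrow> z(i := q)))"

definition flip_dist :: "('x, 'p) block_model \<Rightarrow> nat \<Rightarrow> nat \<Rightarrow> real" where
  "flip_dist S n m = (case variant S of LBM \<Rightarrow> real m | SBM _ _ \<Rightarrow> 2 * real n)"

lemma
  assumes S: "valid_model S" and mn: "variant S \<noteq> LBM \<longrightarrow> m = n" and c: "(z, w) \<in> configs S n m"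
    and i: "i \<in> {1..n}" and q: "q \<in> rgroups S" "q \<noteq> z i"
  shows row_flip_in_configs: "row_flip S (z, w) i q \<in> configs S n m"
    and row_flip_neq: "row_flip S (z, w) i q \<noteq> (z, w)"
    and misclassified_row_flip: "misclassified S n m (z, w) (row_flip S (z, w) i q) = 1"
    and weighted_dist_row_flip: "weighted_dist n m (z, w) (row_flip S (z, w) i q) = flip_dist S n m"
proof -
  have one: "card {k \<in> {1..n}. z k \<noteq> (z(i := q)) k} = 1"
  proof -
    have "{k \<in> {1..n}. z k \<noteq> (z(i := q)) k} = {i}" using i q by auto
    then show ?thesis by simp
  qed
  have upd: "z(i := q) \<in> {1..n} \<rightarrow>\<^sub>E rgroups S"
    using configs_PiE(1)[OF S mn c] i q by (auto simp: PiE_iff extensional_def)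
  show "row_flip S (z, w) i q \<in> configs S n m"
    using c upd by (cases "variant S") (simp_all only: row_flip_def configs_def prod.case variant.case, auto)
  show "row_flip S (z, w) i q \<noteq> (z, w)"
    using q by (auto simp: row_flip_def fun_eq_iff)
  show "misclassified S n m (z, w) (row_flip S (z, w) i q) = 1"
    unfolding misclassified_def row_flip_def prod.case one by (simp split: variant.splits)
  have "w = z" "m = n" if "variant S \<noteq> LBM"
    using that c mn by (auto simp: configs_def split: variant.splits)
  then show "weighted_dist n m (z, w) (row_flip S (z, w) i q) = flip_dist S n m"
    using one
    by (cases "variant S") (simp_all only: weighted_dist_def row_flip_def flip_dist_def prod.case variant.case, auto)
qed

lemma ex_other_config:
  assumes S: "valid_model S" and mn: "variant S \<noteq> LBM \<longrightarrow> m = n" and c: "c \<in> configs S n m"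
    and nm: "n \<ge> 1" "m \<ge> 1" and two: "nrows S \<ge> 2 \<or> ncols S \<ge> 2"
  shows "configs S n m - {c} \<noteq> {}"
proof -
  obtain z w where zw: "c = (z, w)" by force
  have other: "\<exists>q. q \<in> {1..k} \<and> q \<noteq> a" if "k \<ge> 2" for k a :: nat
    using that by (intro exI[of _ "if a = 1 then 2 else 1"]) auto
  show ?thesis
  proof (cases "nrows S \<ge> 2")
    case True
    then obtain q where "q \<in> rgroups S" "q \<noteq> z 1" using other by blast
    then show ?thesis
      using row_flip_in_configs[OF S mn c[unfolded zw], of 1 q]
        row_flip_neq[OF S mn c[unfolded zw], of 1 q] nm zw by auto
  next
    case False
    then have LBM: "variant S = LBM" and "ncols S \<ge> 2"
      using S two by (auto simp: valid_model_def)
    then obtain l where l: "l \<in> cgroups S" "l \<noteq> w 1" using other by blast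
    have "(z, w(1 := l)) \<in> configs S n m"
      using c LBM l nm by (auto simp: zw configs_def PiE_iff extensional_def)
    moreover have "(z, w(1 := l)) \<noteq> c" using l by (auto simp: zw fun_eq_iff)
    ultimately show ?thesis by blast
  qed
qed

section \<open>Likelihood ratios at typical observations\<close>

text \<open>The real number \<open>\<kappa>\<close> is the least divergence between distinct entries of the true
  matrix; that it is finite and positive follows from \<open>c > 0\<close>, hence from the existence
  of an admissible \<open>\<eta>\<close>.\<close>

locale recovery = bounded_KL_model S
  for S :: "('x, 'p::real_normed_vector) block_model" +
  fixes \<theta>\<^sub>0 :: "'p param" and L\<^sub>0 \<kappa> :: real
  assumes \<theta>\<^sub>0: "\<theta>\<^sub>0 \<in> Theta S"
    and ident: "identifiability S" and no_symmetry: "symmetry_group S {(id, id)}"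
    and lipschitz: "lipschitz_condition S L\<^sub>0"
    and kappa_min_eq: "kappa_min S (conn \<theta>\<^sub>0) = ereal \<kappa>" and kappa_pos: "\<kappa> > 0"
begin

abbreviation (input) \<pi>\<^sub>0 where "\<pi>\<^sub>0 \<equiv> conn \<theta>\<^sub>0"
abbreviation (input) \<mu> where "\<mu> \<equiv> mu_min S"
abbreviation (input) \<kappa>' where "\<kappa>' \<equiv> real_of_ereal (kappa_max S)"

lemma \<pi>\<^sub>0: "\<pi>\<^sub>0 \<in> conn_set S"
  using \<theta>\<^sub>0 by (simp add: Theta_def)

lemma entry_\<pi>\<^sub>0: "q \<in> rgroups S \<Longrightarrow> l \<in> cgroups S \<Longrightarrow> \<pi>\<^sub>0 q l \<in> entry_set S"
  using valid \<pi>\<^sub>0 by (simp add: valid_model_def)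

lemma kl_ge_kappa:
  assumes "q \<in> rgroups S" "l \<in> cgroups S" "q' \<in> rgroups S" "l' \<in> cgroups S" "\<pi>\<^sub>0 q l \<noteq> \<pi>\<^sub>0 q' l'"
  shows "\<kappa> \<le> kl (\<pi>\<^sub>0 q l) (\<pi>\<^sub>0 q' l')"
proof -
  have "kappa_min S \<pi>\<^sub>0 \<le> KL S (\<pi>\<^sub>0 q l) (\<pi>\<^sub>0 q' l')"
    unfolding kappa_min_def using assms by (intro Inf_lower) blast
  then show ?thesis using assms by (simp add: kappa_min_eq KL_eq_kl entry_\<pi>\<^sub>0)
qed

text \<open>A finite minimum is not the minimum of the empty set.\<close>

lemma ex_distinct_entries:
  obtains q l q' l' where "q \<in> rgroups S" "l \<in> cgroups S" "q' \<in> rgroups S" "l' \<in> cgroups S"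
    "\<pi>\<^sub>0 q l \<noteq> \<pi>\<^sub>0 q' l'"
proof -
  have "{KL S (\<pi>\<^sub>0 q l) (\<pi>\<^sub>0 q' l') | q l q' l'. q \<in> rgroups S \<and> l \<in> cgroups S \<and>
      q' \<in> rgroups S \<and> l' \<in> cgroups S \<and> \<pi>\<^sub>0 q l \<noteq> \<pi>\<^sub>0 q' l'} \<noteq> {}"
  proof
    assume "{KL S (\<pi>\<^sub>0 q l) (\<pi>\<^sub>0 q' l') | q l q' l'. q \<in> rgroups S \<and> l \<in> cgroups S \<and>
      q' \<in> rgroups S \<and> l' \<in> cgroups S \<and> \<pi>\<^sub>0 q l \<noteq> \<pi>\<^sub>0 q' l'} = {}"
    then show False using kappa_min_eq unfolding kappa_min_def by (simp only: Inf_empty top_ereal_def) simp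
  qed
  then show thesis using that by blast
qed

lemma two_groups: "nrows S \<ge> 2 \<or> ncols S \<ge> 2"
proof (rule ccontr)
  assume "\<not> (nrows S \<ge> 2 \<or> ncols S \<ge> 2)"
  then have "rgroups S \<subseteq> {1}" "cgroups S \<subseteq> {1}" by auto
  then show False by (rule_tac ex_distinct_entries) blast
qed

lemma kappa_le_kappa_max: "\<kappa> \<le> \<kappa>'"
proof -
  obtain q l q' l' where *: "q \<in> rgroups S" "l \<in> cgroups S" "q' \<in> rgroups S" "l' \<in> cgroups S"
    "\<pi>\<^sub>0 q l \<noteq> \<pi>\<^sub>0 q' l'" by (rule ex_distinct_entries)
  have "\<kappa> \<le> kl (\<pi>\<^sub>0 q l) (\<pi>\<^sub>0 q' l')" using kl_ge_kappa * .
  also have "\<dots> \<le> \<kappa>'" using * by (intro kl_le_kappa_max entry_\<pi>\<^sub>0)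
  finally show ?thesis .
qed

lemma mu_bounds: "0 < \<mu>" "\<mu> \<le> 1"
  using mu_min_pos mu_min_le_1 valid \<theta>\<^sub>0 by auto

definition mean_llr :: "nat \<Rightarrow> nat \<Rightarrow> (nat \<Rightarrow> nat \<Rightarrow> 'p) \<Rightarrow> config \<Rightarrow> config \<Rightarrow> real" where
  "mean_llr n m \<pi> = (\<lambda>(z\<^sub>0, w\<^sub>0) (z, w). \<Sum>(i, j)\<in>index_set S n m.
     kl (\<pi>\<^sub>0 (z\<^sub>0 i) (w\<^sub>0 j)) (\<pi> (z i) (w j)) - kl (\<pi>\<^sub>0 (z\<^sub>0 i) (w\<^sub>0 j)) (\<pi> (z\<^sub>0 i) (w\<^sub>0 j)))"

lemma xintegral_llr:
  assumes "c\<^sub>0 \<in> configs S n m" "c \<in> configs S n m" "\<pi> \<in> conn_set S"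
  shows "xintegral (cond_law S n m \<pi>\<^sub>0 c\<^sub>0) (log_lik_ratio S n m \<pi> c\<^sub>0 c) = ereal (mean_llr n m \<pi> c\<^sub>0 c)"
  using assms xintegral_log_lik_ratio[OF _ _ \<pi>\<^sub>0 assms(3), of "fst c\<^sub>0" "snd c\<^sub>0" n m "fst c" "snd c"]
  by (simp add: mean_llr_def case_prod_unfold)

lemma labels_in_groups:
  assumes mn: "variant S \<noteq> LBM \<longrightarrow> m = n" and c: "(z, w) \<in> configs S n m" and ij: "(i, j) \<in> index_set S n m"
  shows "z i \<in> rgroups S" "w j \<in> cgroups S"
proof -
  have "i \<in> {1..n}" "j \<in> {1..m}" using ij mn by (auto simp: index_set_def split: variant.splits)
  then show "z i \<in> rgroups S" "w j \<in> cgroups S"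
    using configs_PiE[OF valid mn c] by (blast dest: PiE_mem)+
qed

lemma sum_relabelled_le:
  assumes mn: "variant S \<noteq> LBM \<longrightarrow> m = n" and "a \<ge> 0"
  shows "(\<Sum>(i, j)\<in>index_set S n m. if z\<^sub>0 i \<noteq> z i \<or> w\<^sub>0 j \<noteq> w j then a else 0)
    \<le> a * weighted_dist n m (z\<^sub>0, w\<^sub>0) (z, w)"
proof -
  have "(\<Sum>(i, j)\<in>index_set S n m. if z\<^sub>0 i \<noteq> z i \<or> w\<^sub>0 j \<noteq> w j then a else 0) =
      a * card {(i, j) \<in> index_set S n m. z\<^sub>0 i \<noteq> z i \<or> w\<^sub>0 j \<noteq> w j}"
    by (simp add: case_prod_unfold sum.If_cases finite_index_set Int_def mult.commute)
  then show ?thesis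
    using mult_left_mono[OF card_relabelled_cells_le[OF mn] assms(2)] by simp
qed

text \<open>Replacing \<open>\<pi>\<close> by \<open>\<pi>\<^sub>0\<close> costs at most \<open>2 L\<^sub>0
  \<eta>\<close> per relabelled cell, by the Lipschitz condition; under \<open>\<pi>\<^sub>0\<close>
  every modified cell contributes at least \<open>\<kappa>\<close>.\<close>

lemma mean_llr_ge:
  assumes \<pi>: "\<pi> \<in> conn_set S" and close: "conn_dist S \<pi> \<pi>\<^sub>0 \<le> \<eta>" and \<eta>: "\<eta> \<ge> 0"
    and mn: "variant S \<noteq> LBM \<longrightarrow> m = n" and n: "real n * \<mu>\<^sup>2 \<ge> 50"
    and c\<^sub>0: "c\<^sub>0 \<in> balanced_configs S (9 / 10 * \<mu>) n m" and c: "c \<in> configs S n m"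
  shows "(7 / 100 * \<mu>\<^sup>2 * \<kappa> - 2 * L\<^sub>0 * \<eta>) * weighted_dist n m c\<^sub>0 c \<le> mean_llr n m \<pi> c\<^sub>0 c"
proof -
  obtain z\<^sub>0 w\<^sub>0 z w where zw: "c\<^sub>0 = (z\<^sub>0, w\<^sub>0)" "c = (z, w)" by force
  have c\<^sub>0': "(z\<^sub>0, w\<^sub>0) \<in> configs S n m" using c\<^sub>0 by (simp add: balanced_configs_def zw)
  have L0: "L\<^sub>0 > 0" using lipschitz by (simp add: lipschitz_condition_def)
  let ?I = "index_set S n m"
  let ?D = "{(i, j) \<in> ?I. \<pi>\<^sub>0 (z\<^sub>0 i) (w\<^sub>0 j) \<noteq> \<pi>\<^sub>0 (z i) (w j)}"
  have lip: "kl (\<pi>\<^sub>0 q' l') (\<pi>\<^sub>0 q l) - kl (\<pi>\<^sub>0 q' l') (\<pi> q l) \<le> L\<^sub>0 * \<eta>"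
      "- (L\<^sub>0 * \<eta>) \<le> kl (\<pi>\<^sub>0 q' l') (\<pi>\<^sub>0 q l) - kl (\<pi>\<^sub>0 q' l') (\<pi> q l)"
    if "q \<in> rgroups S" "l \<in> cgroups S" "q' \<in> rgroups S" "l' \<in> cgroups S" for q l q' l'
  proof -
    have "\<pi> q l \<in> entry_set S" using valid \<pi> that by (simp add: valid_model_def)
    moreover have "\<bar>mean_log_ratio S (\<pi>\<^sub>0 q l) (\<pi> q l) (\<pi>\<^sub>0 q' l')\<bar> \<le> ereal (L\<^sub>0 * conn_dist S \<pi>\<^sub>0 \<pi>)"
      by (rule lipschitz[unfolded lipschitz_condition_def, THEN conjunct2, rule_format, OF \<pi>\<^sub>0 \<pi> that])
    moreover have "conn_dist S \<pi>\<^sub>0 \<pi> = conn_dist S \<pi> \<pi>\<^sub>0"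
      unfolding conn_dist_def by (simp only: norm_minus_commute)
    ultimately have "\<bar>kl (\<pi>\<^sub>0 q' l') (\<pi>\<^sub>0 q l) - kl (\<pi>\<^sub>0 q' l') (\<pi> q l)\<bar> \<le> L\<^sub>0 * conn_dist S \<pi> \<pi>\<^sub>0"
      using that by (simp add: mean_log_ratio_eq_kl entry_\<pi>\<^sub>0 abs_minus_commute)
    also have "\<dots> \<le> L\<^sub>0 * \<eta>" using close L0 by (intro mult_left_mono) auto
    finally show "kl (\<pi>\<^sub>0 q' l') (\<pi>\<^sub>0 q l) - kl (\<pi>\<^sub>0 q' l') (\<pi> q l) \<le> L\<^sub>0 * \<eta>"
      "- (L\<^sub>0 * \<eta>) \<le> kl (\<pi>\<^sub>0 q' l') (\<pi>\<^sub>0 q l) - kl (\<pi>\<^sub>0 q' l') (\<pi> q l)" by linarith+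
  qed
  have cell: "(if \<pi>\<^sub>0 (z\<^sub>0 i) (w\<^sub>0 j) \<noteq> \<pi>\<^sub>0 (z i) (w j) then \<kappa> else 0) -
      (if z\<^sub>0 i \<noteq> z i \<or> w\<^sub>0 j \<noteq> w j then 2 * L\<^sub>0 * \<eta> else 0) \<le>
      kl (\<pi>\<^sub>0 (z\<^sub>0 i) (w\<^sub>0 j)) (\<pi> (z i) (w j)) - kl (\<pi>\<^sub>0 (z\<^sub>0 i) (w\<^sub>0 j)) (\<pi> (z\<^sub>0 i) (w\<^sub>0 j))"
    if ij: "(i, j) \<in> ?I" for i j
  proof (cases "z\<^sub>0 i \<noteq> z i \<or> w\<^sub>0 j \<noteq> w j")
    case True
    note g = labels_in_groups[OF mn c\<^sub>0' ij] labels_in_groups[OF mn c[unfolded zw] ij]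
    have "(if \<pi>\<^sub>0 (z\<^sub>0 i) (w\<^sub>0 j) \<noteq> \<pi>\<^sub>0 (z i) (w j) then \<kappa> else 0) \<le> kl (\<pi>\<^sub>0 (z\<^sub>0 i) (w\<^sub>0 j)) (\<pi>\<^sub>0 (z i) (w j))"
      using g kl_ge_kappa by (auto intro!: kl_nonneg entry_\<pi>\<^sub>0)
    then show ?thesis
      using True lip(1)[OF g(3,4,1,2)] lip(2)[OF g(1,2,1,2)] by (simp del: kl_ge_kappa)
  qed auto
  have "(\<Sum>(i, j)\<in>?I. if \<pi>\<^sub>0 (z\<^sub>0 i) (w\<^sub>0 j) \<noteq> \<pi>\<^sub>0 (z i) (w j) then \<kappa> else 0) = \<kappa> * card ?D"
    by (simp add: case_prod_unfold sum.If_cases finite_index_set Int_def mult.commute)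
  moreover have "\<kappa> * (7 / 100 * \<mu>\<^sup>2 * weighted_dist n m (z\<^sub>0, w\<^sub>0) (z, w)) \<le> \<kappa> * card ?D"
    using modified_observed_cells_ge[OF valid ident no_symmetry \<pi>\<^sub>0 mu_bounds(2) mn n] c\<^sub>0 c kappa_pos
    unfolding zw by (intro mult_left_mono) auto
  moreover have "(\<Sum>(i, j)\<in>?I. if z\<^sub>0 i \<noteq> z i \<or> w\<^sub>0 j \<noteq> w j then 2 * L\<^sub>0 * \<eta> else 0)
      \<le> 2 * L\<^sub>0 * \<eta> * weighted_dist n m (z\<^sub>0, w\<^sub>0) (z, w)"
    using L0 \<eta> by (intro sum_relabelled_le mn) simp
  moreover have "(\<Sum>(i, j)\<in>?I. if \<pi>\<^sub>0 (z\<^sub>0 i) (w\<^sub>0 j) \<noteq> \<pi>\<^sub>0 (z i) (w j) then \<kappa> else 0) -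
      (\<Sum>(i, j)\<in>?I. if z\<^sub>0 i \<noteq> z i \<or> w\<^sub>0 j \<noteq> w j then 2 * L\<^sub>0 * \<eta> else 0) \<le> mean_llr n m \<pi> c\<^sub>0 c"
    unfolding zw mean_llr_def prod.case sum_subtractf[symmetric]
    using cell by (intro sum_mono) auto
  ultimately show ?thesis by (simp add: zw algebra_simps)
qed

lemma mean_llr_le:
  assumes \<pi>: "\<pi> \<in> conn_set S" and mn: "variant S \<noteq> LBM \<longrightarrow> m = n"
    and c\<^sub>0: "c\<^sub>0 \<in> configs S n m" and c: "c \<in> configs S n m"
  shows "mean_llr n m \<pi> c\<^sub>0 c \<le> \<kappa>' * weighted_dist n m c\<^sub>0 c"
proof -
  obtain z\<^sub>0 w\<^sub>0 z w where zw: "c\<^sub>0 = (z\<^sub>0, w\<^sub>0)" "c = (z, w)" by force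
  let ?I = "index_set S n m"
  have cell: "kl (\<pi>\<^sub>0 (z\<^sub>0 i) (w\<^sub>0 j)) (\<pi> (z i) (w j)) - kl (\<pi>\<^sub>0 (z\<^sub>0 i) (w\<^sub>0 j)) (\<pi> (z\<^sub>0 i) (w\<^sub>0 j))
      \<le> (if z\<^sub>0 i \<noteq> z i \<or> w\<^sub>0 j \<noteq> w j then \<kappa>' else 0)"
    if ij: "(i, j) \<in> ?I" for i j
  proof (cases "z\<^sub>0 i \<noteq> z i \<or> w\<^sub>0 j \<noteq> w j")
    case True
    have "kl (\<pi>\<^sub>0 (z\<^sub>0 i) (w\<^sub>0 j)) (\<pi> (z i) (w j)) \<le> \<kappa>'" "0 \<le> kl (\<pi>\<^sub>0 (z\<^sub>0 i) (w\<^sub>0 j)) (\<pi> (z\<^sub>0 i) (w\<^sub>0 j))"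
      using entry_in_entry_set[OF valid _ _ ij] \<pi> \<pi>\<^sub>0 c\<^sub>0 c unfolding zw
      by (blast intro: kl_le_kappa_max kl_nonneg)+
    then show ?thesis using True by simp
  qed auto
  have "mean_llr n m \<pi> c\<^sub>0 c \<le> (\<Sum>(i, j)\<in>?I. if z\<^sub>0 i \<noteq> z i \<or> w\<^sub>0 j \<noteq> w j then \<kappa>' else 0)"
    unfolding zw mean_llr_def prod.case using cell by (intro sum_mono) auto
  also have "\<dots> \<le> \<kappa>' * weighted_dist n m c\<^sub>0 c"
    unfolding zw using kappa_le_kappa_max kappa_pos by (intro sum_relabelled_le mn) simp
  finally show ?thesis .
qed

text \<open>The deviations are bounded for all matrices at once, so that the parameter may depend on the data.\<close>

definition typical_data :: "nat \<Rightarrow> nat \<Rightarrow> real \<Rightarrow> config \<Rightarrow> (nat \<times> nat \<Rightarrow> 'x) set" where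
  "typical_data n m \<rho> c\<^sub>0 = {x \<in> space (data_space S n m). \<forall>c\<in>configs S n m - {c\<^sub>0}. \<forall>\<pi>\<in>conn_set S.
     \<bar>log_lik_ratio S n m \<pi> c\<^sub>0 c x -
      xintegral (cond_law S n m \<pi>\<^sub>0 c\<^sub>0) (log_lik_ratio S n m \<pi> c\<^sub>0 c)\<bar> < ereal (\<rho> * weighted_dist n m c\<^sub>0 c)}"

lemma typical_likelihood:
  assumes x: "x \<in> typical_data n m \<rho> c\<^sub>0" and \<pi>: "\<pi> \<in> conn_set S"
    and c\<^sub>0: "c\<^sub>0 \<in> configs S n m" and c: "c \<in> configs S n m" "c \<noteq> c\<^sub>0"
  shows "0 < likelihood S n m \<pi> x c\<^sub>0"
    and "likelihood S n m \<pi> x c \<le>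
      exp (- (mean_llr n m \<pi> c\<^sub>0 c - \<rho> * weighted_dist n m c\<^sub>0 c)) * likelihood S n m \<pi> x c\<^sub>0"
    and "exp (- (mean_llr n m \<pi> c\<^sub>0 c + \<rho> * weighted_dist n m c\<^sub>0 c)) * likelihood S n m \<pi> x c\<^sub>0
      \<le> likelihood S n m \<pi> x c"
proof -
  have "x \<in> space (data_space S n m)" using x by (simp add: typical_data_def)
  moreover have "\<bar>log_lik_ratio S n m \<pi> c\<^sub>0 c x - ereal (mean_llr n m \<pi> c\<^sub>0 c)\<bar> <
      ereal (\<rho> * weighted_dist n m c\<^sub>0 c)"
    unfolding xintegral_llr[OF c\<^sub>0 c(1) \<pi>, symmetric] using x \<pi> c by (simp add: typical_data_def)
  ultimately show "0 < likelihood S n m \<pi> x c\<^sub>0"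
    and "likelihood S n m \<pi> x c \<le>
      exp (- (mean_llr n m \<pi> c\<^sub>0 c - \<rho> * weighted_dist n m c\<^sub>0 c)) * likelihood S n m \<pi> x c\<^sub>0"
    and "exp (- (mean_llr n m \<pi> c\<^sub>0 c + \<rho> * weighted_dist n m c\<^sub>0 c)) * likelihood S n m \<pi> x c\<^sub>0
      \<le> likelihood S n m \<pi> x c"
    by (rule likelihood_bounds[OF valid \<pi> _ c\<^sub>0 c(1)])+
qed

lemma typical_joint_density_pos:
  assumes x: "x \<in> typical_data n m \<rho> c\<^sub>0" and \<theta>: "\<theta> \<in> Theta S" and mn: "variant S \<noteq> LBM \<longrightarrow> m = n"
    and c\<^sub>0: "c\<^sub>0 \<in> configs S n m" and nm: "n \<ge> 1" "m \<ge> 1"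
  shows "0 < joint_density S n m \<theta> x c\<^sub>0"
proof -
  obtain z w where zw: "c\<^sub>0 = (z, w)" by force
  obtain c where c: "c \<in> configs S n m" "c \<noteq> c\<^sub>0"
    using ex_other_config[OF valid mn c\<^sub>0 nm two_groups] by blast
  have "conn \<theta> \<in> conn_set S" using \<theta> by (simp add: Theta_def)
  then have "0 < likelihood S n m (conn \<theta>) x c\<^sub>0" using typical_likelihood(1)[OF x _ c\<^sub>0 c] by blast
  moreover have "0 < prior S n m \<theta> c\<^sub>0"
  proof -
    note PiE = configs_PiE[OF valid mn c\<^sub>0[unfolded zw]]
    have "0 < (\<Prod>i\<in>{1..n}. alpha \<theta> (z i))" "0 < (\<Prod>j\<in>{1..m}. beta \<theta> (w j))"
      by (rule prod_pos, rule alpha_pos[OF valid \<theta>], rule PiE_mem[OF PiE(1)], assumption)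
        (rule prod_pos, rule beta_pos[OF valid \<theta>], rule PiE_mem[OF PiE(2)], assumption)
    then show ?thesis by (simp add: zw prior_def split: variant.splits)
  qed
  ultimately show ?thesis by (simp add: joint_density_eq_likelihood)
qed

lemma typical_joint_density_nonneg:
  assumes "x \<in> typical_data n m \<rho> c\<^sub>0" "\<theta> \<in> Theta S" "c \<in> configs S n m"
  shows "0 \<le> joint_density S n m \<theta> x c"
  using joint_density_nonneg[OF valid assms(2,3)] assms(1) by (simp add: typical_data_def)

text \<open>The true configuration dominates: the odds of any other one decay exponentially in its weighted
  distance, fast enough for the sum over all of them.\<close>

proposition typical_posterior_ge:
  assumes x: "x \<in> typical_data n m \<rho> c\<^sub>0" and \<theta>: "\<theta> \<in> Theta S"
    and close: "conn_dist S (conn \<theta>) \<pi>\<^sub>0 \<le> \<eta>" and \<eta>: "\<eta> \<ge> 0"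
    and mn: "variant S \<noteq> LBM \<longrightarrow> m = n" and n: "real n * \<mu>\<^sup>2 \<ge> 50" and nm: "n \<ge> 1" "m \<ge> 1"
    and c\<^sub>0: "c\<^sub>0 \<in> balanced_configs S (9 / 10 * \<mu>) n m"
    and K: "ln (alpha_max S / alpha_min S) \<le> K" "ln (beta_max S / beta_min S) \<le> K"
    and a: "a_bound S (7 / 100 * \<mu>\<^sup>2 * \<kappa> - 2 * L\<^sub>0 * \<eta> - \<rho>) (K + ln (nrows S + ncols S)) n m \<le> a"
  shows "1 - a * exp a \<le> posterior S n m \<theta> x c\<^sub>0"
proof -
  let ?g = "7 / 100 * \<mu>\<^sup>2 * \<kappa> - 2 * L\<^sub>0 * \<eta> - \<rho>"
  define y where "y = a_bound S ?g (K + ln (nrows S + ncols S)) n m"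
  have c\<^sub>0': "c\<^sub>0 \<in> configs S n m" using c\<^sub>0 by (auto simp: balanced_configs_def)
  have \<pi>: "conn \<theta> \<in> conn_set S" using \<theta> by (simp add: Theta_def)
  have pos: "0 < joint_density S n m \<theta> x c\<^sub>0" by (rule typical_joint_density_pos[OF x \<theta> mn c\<^sub>0' nm])
  have odds: "joint_density S n m \<theta> x c \<le>
      exp (K * misclassified S n m c c\<^sub>0 - ?g * weighted_dist n m c\<^sub>0 c) * joint_density S n m \<theta> x c\<^sub>0"
    if "c \<in> configs S n m - {c\<^sub>0}" for c
  proof -
    have c: "c \<in> configs S n m" "c \<noteq> c\<^sub>0" using that by auto
    let ?L = "likelihood S n m (conn \<theta>) x" and ?R = "weighted_dist n m c\<^sub>0 c"
    have L0: "0 < ?L c\<^sub>0" by (rule typical_likelihood(1)[OF x \<pi> c\<^sub>0' c])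
    have "?L c \<le> exp (- (mean_llr n m (conn \<theta>) c\<^sub>0 c - \<rho> * ?R)) * ?L c\<^sub>0"
      by (rule typical_likelihood(2)[OF x \<pi> c\<^sub>0' c])
    also have "\<dots> \<le> exp (- (?g * ?R)) * ?L c\<^sub>0"
      using mean_llr_ge[OF \<pi> close \<eta> mn n c\<^sub>0 c(1)] L0 by (intro mult_right_mono) (auto simp: algebra_simps)
    finally have L: "?L c \<le> exp (- (?g * ?R)) * ?L c\<^sub>0" .
    have "prior S n m \<theta> c * ?L c \<le>
        (exp (K * misclassified S n m c c\<^sub>0) * prior S n m \<theta> c\<^sub>0) * (exp (- (?g * ?R)) * ?L c\<^sub>0)"
      using L L0 prior_nonneg[OF valid \<theta> c(1)] prior_nonneg[OF valid \<theta> c\<^sub>0']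
        order_trans[OF mult_nonneg_nonneg[OF exp_ge_zero less_imp_le[OF L0]] typical_likelihood(3)[OF x \<pi> c\<^sub>0' c]]
      by (intro mult_mono prior_ratio_le[OF valid \<theta> mn c(1) c\<^sub>0' K]) (auto intro: c\<^sub>0')
    moreover have "exp (s - t) = exp s * exp (- t)" for s t :: real
      by (simp add: exp_add[symmetric])
    ultimately show ?thesis
      unfolding joint_density_eq_likelihood by (simp only: ac_simps)
  qed
  have "(\<Sum>c\<in>configs S n m - {c\<^sub>0}. joint_density S n m \<theta> x c) \<le>
      (\<Sum>c\<in>configs S n m - {c\<^sub>0}. exp (K * misclassified S n m c c\<^sub>0 - ?g * weighted_dist n m c\<^sub>0 c)) *
      joint_density S n m \<theta> x c\<^sub>0"
    unfolding sum_distrib_right by (intro sum_mono odds)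
  also have "\<dots> \<le> (y * exp y) * joint_density S n m \<theta> x c\<^sub>0"
    unfolding y_def using pos by (intro mult_right_mono sum_exp_weighted_dist_le[OF valid mn c\<^sub>0']) simp
  finally have "1 - y * exp y \<le> posterior S n m \<theta> x c\<^sub>0"
    by (intro posterior_ge_from_odds[OF c\<^sub>0' pos typical_joint_density_nonneg[OF x \<theta>]])
  moreover have "y * exp y \<le> a * exp a"
    using a unfolding y_def[symmetric]
    by (intro mult_mono) (auto simp: y_def a_bound_def intro: order_trans[rotated] split: variant.splits)
  ultimately show ?thesis by simp
qed

text \<open>Conversely, each of the \<open>n\<close> configurations that relabel a single row keeps odds of at
  least \<open>exp (- K - (\<kappa>' + \<rho>) d)\<close>, where \<open>\<kappa>'\<close> is the
  largest divergence and \<open>d\<close> the weighted distance of such a change.\<close>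

proposition typical_posterior_le:
  assumes x: "x \<in> typical_data n m \<rho> c\<^sub>0" and \<theta>: "\<theta> \<in> Theta S"
    and mn: "variant S \<noteq> LBM \<longrightarrow> m = n" and nm: "n \<ge> 1" "m \<ge> 1" and two: "nrows S \<ge> 2"
    and c\<^sub>0: "c\<^sub>0 \<in> configs S n m"
    and K: "ln (alpha_max S / alpha_min S) \<le> K" "ln (beta_max S / beta_min S) \<le> K"
    and s: "s \<le> n * exp (- K - (\<kappa>' + \<rho>) * flip_dist S n m)" "0 \<le> s"
  shows "posterior S n m \<theta> x c\<^sub>0 \<le> inverse (1 + s)"
proof -
  obtain z w where zw: "c\<^sub>0 = (z, w)" by force
  have c\<^sub>0': "(z, w) \<in> configs S n m" using c\<^sub>0 zw by simp
  have \<pi>: "conn \<theta> \<in> conn_set S" using \<theta> by (simp add: Theta_def)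
  have pos: "0 < joint_density S n m \<theta> x c\<^sub>0" by (rule typical_joint_density_pos[OF x \<theta> mn c\<^sub>0 nm])
  \<comment> \<open>Any label other than \<open>z i\<close>.\<close>
  define q where "q i = (if z i = 1 then 2 else (1::nat))" for i
  have q: "q i \<in> rgroups S" "q i \<noteq> z i" for i using two by (auto simp: q_def)
  define f where "f i = row_flip S c\<^sub>0 i (q i)" for i
  have f: "f i \<in> configs S n m" "f i \<noteq> c\<^sub>0" "misclassified S n m c\<^sub>0 (f i) = 1"
    "weighted_dist n m c\<^sub>0 (f i) = flip_dist S n m" if "i \<in> {1..n}" for i
    unfolding f_def zw using row_flip_in_configs[OF valid mn c\<^sub>0' that q]
      row_flip_neq[OF valid mn c\<^sub>0' that q] misclassified_row_flip[OF valid mn c\<^sub>0' that q]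
      weighted_dist_row_flip[OF valid mn c\<^sub>0' that q] by auto
  have inj: "inj_on f {1..n}"
  proof (rule inj_onI, rule ccontr)
    fix i k assume "f i = f k" "i \<noteq> k"
    then have "fst (f i) i = fst (f k) i" by simp
    then show False using q(2)[of i] \<open>i \<noteq> k\<close> by (simp add: f_def zw row_flip_def)
  qed
  have odds: "exp (- K - (\<kappa>' + \<rho>) * flip_dist S n m) * joint_density S n m \<theta> x c\<^sub>0 \<le>
      joint_density S n m \<theta> x (f i)" if i: "i \<in> {1..n}" for i
  proof -
    let ?L = "likelihood S n m (conn \<theta>) x" and ?R = "flip_dist S n m"
    note t = typical_likelihood[OF x \<pi> c\<^sub>0 f(1,2)[OF i]]
    have "mean_llr n m (conn \<theta>) c\<^sub>0 (f i) \<le> \<kappa>' * ?R"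
      using mean_llr_le[OF \<pi> mn c\<^sub>0 f(1)[OF i]] f(4)[OF i] by simp
    then have "exp (- ((\<kappa>' + \<rho>) * ?R)) * ?L c\<^sub>0 \<le>
        exp (- (mean_llr n m (conn \<theta>) c\<^sub>0 (f i) + \<rho> * ?R)) * ?L c\<^sub>0"
      using t(1) by (intro mult_right_mono) (auto simp: algebra_simps)
    also have "\<dots> \<le> ?L (f i)" using t(3) f(4)[OF i] by simp
    finally have L: "exp (- ((\<kappa>' + \<rho>) * ?R)) * ?L c\<^sub>0 \<le> ?L (f i)" .
    have "prior S n m \<theta> c\<^sub>0 \<le> exp K * prior S n m \<theta> (f i)"
      using prior_ratio_le[OF valid \<theta> mn c\<^sub>0 f(1)[OF i] K] f(3)[OF i] by simp
    then have P: "exp (- K) * prior S n m \<theta> c\<^sub>0 \<le> prior S n m \<theta> (f i)"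
      by (simp add: exp_minus field_simps)
    have "(exp (- K) * prior S n m \<theta> c\<^sub>0) * (exp (- ((\<kappa>' + \<rho>) * ?R)) * ?L c\<^sub>0) \<le>
        prior S n m \<theta> (f i) * ?L (f i)"
      using t(1) prior_nonneg[OF valid \<theta>] c\<^sub>0 f(1)[OF i] by (intro mult_mono P L) auto
    then show ?thesis
      unfolding joint_density_eq_likelihood diff_conv_add_uminus exp_add by (simp only: ac_simps)
  qed
  have "s * joint_density S n m \<theta> x c\<^sub>0 \<le>
      (n * exp (- K - (\<kappa>' + \<rho>) * flip_dist S n m)) * joint_density S n m \<theta> x c\<^sub>0"
    using s pos by (intro mult_right_mono) auto
  also have "\<dots> = (\<Sum>i\<in>{1..n}. exp (- K - (\<kappa>' + \<rho>) * flip_dist S n m) * joint_density S n m \<theta> x c\<^sub>0)"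
    by simp
  also have "\<dots> \<le> (\<Sum>i\<in>{1..n}. joint_density S n m \<theta> x (f i))" by (intro sum_mono odds)
  also have "\<dots> = (\<Sum>c\<in>f ` {1..n}. joint_density S n m \<theta> x c)" using inj by (simp add: sum.reindex)
  also have "\<dots> \<le> (\<Sum>c\<in>configs S n m - {c\<^sub>0}. joint_density S n m \<theta> x c)"
  proof (intro sum_mono2)
    show "f ` {1..n} \<subseteq> configs S n m - {c\<^sub>0}" using f(1,2) by blast
  qed (use typical_joint_density_nonneg[OF x \<theta>] finite_configs in auto)
  finally show ?thesis
    using s(2) by (intro posterior_le_from_odds[OF c\<^sub>0 pos typical_joint_density_nonneg[OF x \<theta>]])
qed

end

section \<open>Asymptotics of the bounds\<close>

lemma b_bound_eq_a_bound: "b_bound S C K n m = a_bound S C (- K) n m"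
  by (simp add: a_bound_def b_bound_def mult_ac split: variant.splits)

lemma a_bound_nonneg: "a_bound S \<gamma> K n m \<ge> 0"
  by (simp add: a_bound_def split: variant.splits)

lemma a_bound_le_flip:
  assumes "m \<le> n" "variant S \<noteq> LBM \<longrightarrow> m = n" "\<gamma> \<ge> 0"
  shows "a_bound S \<gamma> K n m \<le> 2 * (real n * exp (K - \<gamma> * flip_dist S n m))"
proof (cases "variant S")
  case LBM
  have "real m * exp (- \<gamma> * real n + K) \<le> real n * exp (- \<gamma> * real m + K)"
    using assms by (intro mult_mono) (auto intro!: mult_left_mono)
  then show ?thesis using LBM by (simp add: a_bound_def flip_dist_def)
next
  case (SBM loops dir)
  then show ?thesis by (simp add: a_bound_def flip_dist_def mult_ac)
qed

lemma flip_dist_ge: "variant S \<noteq> LBM \<longrightarrow> m = n \<Longrightarrow> real m \<le> flip_dist S n m"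
  by (simp add: flip_dist_def split: variant.splits)

text \<open>A slightly larger exponent absorbs any constant factor.\<close>

lemma a_bound_absorb_factor:
  assumes "m \<le> n" "variant S \<noteq> LBM \<longrightarrow> m = n" "t \<le> \<rho> * real m" "\<rho> \<ge> 0"
  shows "a_bound S (\<gamma> + \<rho>) (K + t) n m \<le> a_bound S \<gamma> K n m"
proof -
  have tn: "t \<le> \<rho> * real n" using assms(1,3,4) mult_left_mono[of "real m" "real n" \<rho>] by simp
  show ?thesis
  proof (cases "variant S")
    case LBM
    have "real n * exp (- (\<gamma> + \<rho>) * real m + (K + t)) \<le> real n * exp (- \<gamma> * real m + K)"
      "real m * exp (- (\<gamma> + \<rho>) * real n + (K + t)) \<le> real m * exp (- \<gamma> * real n + K)"
      using assms(3) tn by (auto intro!: mult_left_mono simp: algebra_simps)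
    then show ?thesis using LBM unfolding a_bound_def by simp
  next
    case (SBM loops dir)
    have "0 \<le> \<rho> * real n" using assms(4) by simp
    then have "real n * exp (- 2 * real n * (\<gamma> + \<rho>) + (K + t)) \<le> real n * exp (- 2 * real n * \<gamma> + K)"
      using tn by (intro mult_left_mono) (auto simp: algebra_simps)
    then show ?thesis using SBM unfolding a_bound_def by simp
  qed
qed

lemma mult_exp_le_triple: "0 \<le> x \<Longrightarrow> x \<le> 1 \<Longrightarrow> x * exp x \<le> 3 * (x::real)"
  using exp_le mult_left_mono[of "exp x" 3 x] order_trans[of "exp x" "exp 1" 3] by simp

context
  fixes S :: "('x, 'p) block_model" and m :: "nat \<Rightarrow> nat"
  assumes asymp: "asymptotic_setup S m"
begin

lemma m_le: "m n \<le> n" and m_at_top: "filterlim m at_top sequentially"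
  and m_SBM: "variant S \<noteq> LBM \<longrightarrow> m n = n"
  using asymp by (simp_all add: asymptotic_setup_def)

lemma eventually_real_m_ge: "eventually (\<lambda>n. t \<le> real (m n)) sequentially"
  using filterlim_compose[OF filterlim_real_sequentially m_at_top] by (simp add: filterlim_at_top)

text \<open>As \<open>ln n\<close> is negligible compared with \<open>m\<close>, eventually \<open>\<gamma> m
  \<ge> 3 ln n\<close>, and the exponential is at most \<open>n\<^sup>-\<^sup>3\<close>.\<close>

lemma eventually_mult_exp_m_le:
  assumes \<gamma>: "\<gamma> > 0"
  shows "eventually (\<lambda>n. real n * exp (- \<gamma> * real (m n)) \<le> inverse (real n ^ 2)) sequentially"
proof -
  have "(\<lambda>n. ln (real n) / real (m n)) \<longlonglongrightarrow> 0" using asymp by (simp add: asymptotic_setup_def)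
  then have "eventually (\<lambda>n. ln (real n) / real (m n) < \<gamma> / 3) sequentially"
    using \<gamma> by (intro order_tendstoD) auto
  then show ?thesis
    using eventually_real_m_ge[of 1] eventually_ge_at_top[of 1]
  proof eventually_elim
    case (elim n)
    then have "3 * ln (real n) \<le> \<gamma> * real (m n)" by (simp add: field_simps)
    then have "exp (- \<gamma> * real (m n)) \<le> exp (- (3 * ln (real n)))" by simp
    also have "\<dots> = inverse (real n ^ 3)"
      using elim by (simp add: exp_minus exp_of_nat_mult[of 3 "ln (real n)", simplified])
    finally have "real n * exp (- \<gamma> * real (m n)) \<le> real n * inverse (real n ^ 3)"
      by (intro mult_left_mono) auto
    also have "\<dots> = inverse (real n ^ 2)" using elim by (simp add: field_simps power2_eq_square power3_eq_cube)
    finally show ?case .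
  qed
qed

lemma summable_inverse_square: "summable (\<lambda>n. inverse (real n ^ 2))"
  using inverse_power_summable[of 2, where 'a = real] by simp

lemma summable_exp_m:
  assumes "\<gamma> > 0"
  shows "summable (\<lambda>n. exp (- \<gamma> * real (m n)))"
proof (rule summable_comparison_test_ev[OF _ summable_inverse_square])
  show "eventually (\<lambda>n. norm (exp (- \<gamma> * real (m n))) \<le> inverse (real n ^ 2)) sequentially"
    using eventually_mult_exp_m_le[OF assms] eventually_ge_at_top[of 1]
  proof eventually_elim
    case (elim n)
    then have "1 * exp (- \<gamma> * real (m n)) \<le> real n * exp (- \<gamma> * real (m n))"
      by (intro mult_right_mono) auto
    then have "exp (- \<gamma> * real (m n)) \<le> inverse (real n ^ 2)" using elim(1) by linarith
    then show ?case by simp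
  qed
qed

lemma eventually_a_bound_le:
  assumes \<gamma>: "\<gamma> > 0"
  shows "eventually (\<lambda>n. a_bound S \<gamma> K n (m n) \<le> 2 * exp K * inverse (real n ^ 2)) sequentially"
  using eventually_mult_exp_m_le[OF \<gamma>]
proof eventually_elim
  case (elim n)
  have "a_bound S \<gamma> K n (m n) \<le> 2 * (real n * exp (K - \<gamma> * flip_dist S n (m n)))"
    using \<gamma> by (intro a_bound_le_flip m_le m_SBM) simp
  also have "\<dots> \<le> 2 * (real n * exp (K - \<gamma> * real (m n)))"
    using flip_dist_ge[OF m_SBM] \<gamma> by (intro mult_left_mono) auto
  also have "\<dots> = 2 * exp K * (real n * exp (- \<gamma> * real (m n)))"
    by (simp add: exp_diff exp_minus field_simps)
  also have "\<dots> \<le> 2 * exp K * inverse (real n ^ 2)" using elim by (intro mult_left_mono) auto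
  finally show ?case .
qed

lemma a_bound_tendsto_0:
  assumes \<gamma>: "\<gamma> > 0"
  shows "(\<lambda>n. a_bound S \<gamma> K n (m n)) \<longlonglongrightarrow> 0"
proof (rule tendsto_sandwich)
  show "eventually (\<lambda>n. 0 \<le> a_bound S \<gamma> K n (m n)) sequentially" by (simp add: a_bound_nonneg)
  show "eventually (\<lambda>n. a_bound S \<gamma> K n (m n) \<le> 2 * exp K * inverse (real n ^ 2)) sequentially"
    by (rule eventually_a_bound_le[OF \<gamma>])
  show "(\<lambda>n. 2 * exp K * inverse (real n ^ 2)) \<longlonglongrightarrow> 0"
    using summable_LIMSEQ_zero[OF summable_inverse_square] by (rule tendsto_mult_right_zero)
qed simp

lemma eventually_a_bound_le_1:
  assumes "\<gamma> > 0"
  shows "eventually (\<lambda>n. a_bound S \<gamma> K n (m n) \<le> 1) sequentially"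
  using order_tendstoD(2)[OF a_bound_tendsto_0[OF assms], of 1 K] by (auto elim: eventually_mono)

lemma summable_a_bound_exp:
  assumes \<gamma>: "\<gamma> > 0"
  shows "summable (\<lambda>n. a_bound S \<gamma> K n (m n) * exp (a_bound S \<gamma> K n (m n)))"
proof (rule summable_comparison_test_ev)
  show "summable (\<lambda>n. 3 * (2 * exp K * inverse (real n ^ 2)))"
    by (intro summable_mult summable_inverse_square)
  show "eventually (\<lambda>n. norm (a_bound S \<gamma> K n (m n) * exp (a_bound S \<gamma> K n (m n)))
      \<le> 3 * (2 * exp K * inverse (real n ^ 2))) sequentially"
    using eventually_a_bound_le_1[OF \<gamma>, of K] eventually_a_bound_le[OF \<gamma>, of K]
  proof eventually_elim
    case (elim n)
    then show ?case
      using mult_exp_le_triple[OF a_bound_nonneg[of S \<gamma> K n "m n"]] a_bound_nonneg[of S \<gamma> K n "m n"] by simp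
  qed
qed

text \<open>The rate \<open>C\<close> is twice the largest divergence \<open>\<kappa>'\<close>, so the odds of a
  single relabelling exceed \<open>b exp b\<close> by an exponential factor.\<close>

lemma eventually_b_bound_le:
  assumes \<rho>: "0 \<le> \<rho>" "\<rho> < \<kappa>'"
  shows "eventually (\<lambda>n. b_bound S (2 * \<kappa>') K n (m n) * exp (b_bound S (2 * \<kappa>') K n (m n))
    \<le> real n * exp (- K - (\<kappa>' + \<rho>) * flip_dist S n (m n))) sequentially"
proof -
  have C: "2 * \<kappa>' > 0" using \<rho> by simp
  show ?thesis
    using eventually_a_bound_le_1[OF C, of "- K"] eventually_real_m_ge[of "6 / (\<kappa>' - \<rho>)"]
  proof eventually_elim
    case (elim n)
    let ?b = "b_bound S (2 * \<kappa>') K n (m n)" and ?d = "flip_dist S n (m n)"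
    have "6 \<le> (\<kappa>' - \<rho>) * real (m n)" using elim(2) \<rho> by (simp add: field_simps)
    also have "\<dots> \<le> (\<kappa>' - \<rho>) * ?d" using flip_dist_ge[OF m_SBM] \<rho> by (intro mult_left_mono) auto
    finally have six: "6 \<le> exp ((\<kappa>' - \<rho>) * ?d)"
      using exp_ge_add_one_self[of "(\<kappa>' - \<rho>) * ?d"] by linarith
    have "?b * exp ?b \<le> 3 * ?b"
      using elim(1) by (intro mult_exp_le_triple) (simp_all add: b_bound_eq_a_bound a_bound_nonneg)
    also have "\<dots> \<le> 6 * (real n * exp (- K - 2 * \<kappa>' * ?d))"
      using a_bound_le_flip[OF m_le m_SBM, of "2 * \<kappa>'" "- K" n] C by (simp add: b_bound_eq_a_bound)
    also have "\<dots> \<le> exp ((\<kappa>' - \<rho>) * ?d) * (real n * exp (- K - 2 * \<kappa>' * ?d))"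
      using six by (intro mult_right_mono) auto
    also have "\<dots> = real n * (exp ((\<kappa>' - \<rho>) * ?d) * exp (- K - 2 * \<kappa>' * ?d))" by simp
    also have "exp ((\<kappa>' - \<rho>) * ?d) * exp (- K - 2 * \<kappa>' * ?d) = exp (- K - (\<kappa>' + \<rho>) * ?d)"
      unfolding exp_add[symmetric] by (simp add: algebra_simps)
    finally show ?case .
  qed
qed

end

section \<open>Typical events\<close>

lemma (in bounded_KL_model) prob_space_cond_law:
  assumes "\<pi> \<in> conn_set S" "c \<in> configs S n m"
  shows "prob_space (cond_law S n m \<pi> c)"
proof -
  obtain z w where zw: "c = (z, w)" by force
  have "cond_law S n m \<pi> c = (\<Pi>\<^sub>M ij\<in>index_set S n m. entry_law (\<pi> (z (fst ij)) (w (snd ij))))"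
    by (simp add: zw cond_law_def entry_law_def case_prod_unfold)
  moreover have "prob_space (\<Pi>\<^sub>M ij\<in>index_set S n m. entry_law (\<pi> (z (fst ij)) (w (snd ij))))"
    using entry_in_entry_set[OF valid assms(1), of z w n m] assms(2) zw
    by (intro prob_space_PiM prob_space_entry_law) auto
  ultimately show ?thesis by simp
qed

context recovery begin

text \<open>The concentration inequality for balanced configurations and the trivial symmetry group, whose
  distance is attained by the identity.\<close>

lemma concentration_event:
  assumes conc: "concentration S {(id, id)} m \<pi>\<^sub>0 \<psi>" and n: "n \<ge> 1" and mn: "variant S \<noteq> LBM \<longrightarrow> m n = n"
    and c\<^sub>0: "c\<^sub>0 \<in> balanced_configs S (9 / 10 * \<mu>) n (m n)" and c: "c \<in> configs S n (m n)" "c \<noteq> c\<^sub>0"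
    and \<rho>: "\<rho> > 0" and \<psi>': "ereal \<psi>' \<le> \<psi> \<rho>"
  shows "\<exists>A\<in>sets (data_space S n (m n)).
    {x \<in> space (data_space S n (m n)). \<exists>\<pi>\<in>conn_set S.
       \<bar>log_lik_ratio S n (m n) \<pi> c\<^sub>0 c x -
        xintegral (cond_law S n (m n) \<pi>\<^sub>0 c\<^sub>0) (log_lik_ratio S n (m n) \<pi> c\<^sub>0 c)\<bar>
       \<ge> ereal (\<rho> * weighted_dist n (m n) c\<^sub>0 c)} \<subseteq> A \<and>
    measure (cond_law S n (m n) \<pi>\<^sub>0 c\<^sub>0) A \<le> 2 * exp (- (\<psi>' * weighted_dist n (m n) c\<^sub>0 c))"
proof -
  obtain z\<^sub>0 w\<^sub>0 z w where zw: "c\<^sub>0 = (z\<^sub>0, w\<^sub>0)" "c = (z, w)" by force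
  define k where "k = m n"
  define r\<^sub>1 where "r\<^sub>1 = moved n z\<^sub>0 id z"
  define r\<^sub>2 where "r\<^sub>2 = moved k w\<^sub>0 id w"
  have R: "weighted_dist n k c\<^sub>0 c = real k * real r\<^sub>1 + real n * real r\<^sub>2"
    by (simp add: zw weighted_dist_def r\<^sub>1_def r\<^sub>2_def moved_def)
  have c\<^sub>0': "(z\<^sub>0, w\<^sub>0) \<in> configs S n k" using c\<^sub>0 by (auto simp: balanced_configs_def zw k_def)
  have reg: "(z\<^sub>0, w\<^sub>0) \<in> regular_configs S n k"
  proof -
    have "real N * \<mu> / 2 \<le> real N * (9 / 10 * \<mu>)" for N :: nat using mu_bounds by simp
    then show ?thesis
      using c\<^sub>0 order_trans unfolding zw balanced_configs_def regular_configs_def k_def by fastforce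
  qed
  have neq: "\<not> equivalent {(id, id)} n k (z, w) (z\<^sub>0, w\<^sub>0)"
  proof
    assume "equivalent {(id, id)} n k (z, w) (z\<^sub>0, w\<^sub>0)"
    then have "\<forall>i\<in>{1..n}. z\<^sub>0 i = z i" "\<forall>j\<in>{1..k}. w\<^sub>0 j = w j" by (auto simp: equivalent_def)
    moreover note configs_PiE[OF valid mn c(1)[unfolded zw]]
      configs_PiE[OF valid mn c\<^sub>0'[unfolded k_def]]
    ultimately have "z\<^sub>0 = z" "w\<^sub>0 = w" unfolding k_def by (blast intro: PiE_ext)+
    then show False using c(2) zw by simp
  qed
  have dist: "r\<^sub>1 + r\<^sub>2 = config_dist {(id, id)} n k (z\<^sub>0, w\<^sub>0) (z, w)"
  proof -
    have "{moved n z\<^sub>0 s z + moved k w\<^sub>0 t w | s t. (s, t) \<in> {(id, id)}} = {r\<^sub>1 + r\<^sub>2}"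
      by (auto simp: r\<^sub>1_def r\<^sub>2_def)
    then show ?thesis unfolding config_dist_def by simp
  qed
  have "\<exists>A\<in>sets (data_space S n k).
    {x \<in> space (data_space S n k). \<exists>\<pi>\<in>conn_set S.
       \<bar>log_lik_ratio S n k \<pi> (z\<^sub>0, w\<^sub>0) (z, w) x -
        xintegral (cond_law S n k \<pi>\<^sub>0 (z\<^sub>0, w\<^sub>0)) (log_lik_ratio S n k \<pi> (z\<^sub>0, w\<^sub>0) (z, w))\<bar>
       \<ge> ereal (\<rho> * (real k * real r\<^sub>1 + real n * real r\<^sub>2))} \<subseteq> A \<and>
    measure (cond_law S n k \<pi>\<^sub>0 (z\<^sub>0, w\<^sub>0)) A
      \<le> 2 * exp_minus (\<psi> \<rho> * ereal (real k * real r\<^sub>1 + real n * real r\<^sub>2))"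
    using conc[unfolded concentration_def, THEN conjunct2, rule_format, OF n, folded k_def,
        rule_format, OF reg, simplified prod.case, rule_format, OF c(1)[unfolded zw, folded k_def],
        simplified prod.case, rule_format, OF neq] dist \<rho>
    by (simp add: r\<^sub>1_def r\<^sub>2_def)
  moreover have "exp_minus (\<psi> \<rho> * ereal (real k * real r\<^sub>1 + real n * real r\<^sub>2)) \<le>
      exp (- (\<psi>' * weighted_dist n k c\<^sub>0 c))"
  proof -
    have le: "exp_minus (p * ereal R) \<le> exp (- (\<psi>' * R))" if "R \<ge> 0" "ereal \<psi>' \<le> p" for p R
    proof (cases p)
      case (real r)
      then show ?thesis using that by (simp add: exp_minus_def mult_right_mono)
    next
      case PInf
      then show ?thesis using that by (cases "R = 0") (auto simp: exp_minus_def zero_ereal_def[symmetric])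
    qed (use that in auto)
    show ?thesis unfolding R by (rule le[OF _ \<psi>']) simp
  qed
  ultimately show ?thesis
    unfolding k_def[symmetric] R[symmetric] zw[symmetric] by (meson order_trans mult_left_mono zero_le_numeral)
qed

text \<open>A union bound over the unbalanced configurations, and over the pairs of a balanced
  configuration and another one, whose log-likelihood ratio deviates.\<close>

lemma typical_event:
  assumes M: "prob_space M" and data: "block_data S n (m n) \<theta>\<^sub>0 M ZW X"
    and conc: "concentration S {(id, id)} m \<pi>\<^sub>0 \<psi>" and n: "n \<ge> 1" and mn: "variant S \<noteq> LBM \<longrightarrow> m n = n"
    and \<rho>: "\<rho> > 0" and \<psi>': "ereal \<psi>' \<le> \<psi> \<rho>"
  defines "y \<equiv> a_bound S \<psi>' (ln (nrows S + ncols S)) n (m n)"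
  shows "\<exists>B\<in>sets M.
    (\<forall>\<omega>\<in>B. ZW \<omega> \<in> balanced_configs S (9 / 10 * \<mu>) n (m n) \<and> X \<omega> \<in> typical_data n (m n) \<rho> (ZW \<omega>)) \<and>
    1 - measure M B \<le> nrows S * exp (- (n * \<mu> / 200)) + ncols S * exp (- (m n * \<mu> / 200)) + 2 * (y * exp y)"
proof -
  interpret M: prob_space M by (rule M)
  define k where "k = m n"
  let ?C = "configs S n k" and ?B = "balanced_configs S (9 / 10 * \<mu>) n k" and ?N = "data_space S n k"
  let ?R = "weighted_dist n k"
  define dev where "dev c\<^sub>0 c = {x \<in> space ?N. \<exists>\<pi>\<in>conn_set S.
       \<bar>log_lik_ratio S n k \<pi> c\<^sub>0 c x - xintegral (cond_law S n k \<pi>\<^sub>0 c\<^sub>0) (log_lik_ratio S n k \<pi> c\<^sub>0 c)\<bar>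
       \<ge> ereal (\<rho> * ?R c\<^sub>0 c)}" for c\<^sub>0 c
  have BC: "?B \<subseteq> ?C" by (auto simp: balanced_configs_def)
  have fin: "finite ?C" "finite ?B" using finite_configs finite_subset[OF BC] by auto
  have mk: "variant S \<noteq> LBM \<longrightarrow> k = n" using mn by (simp add: k_def)
  have ZW: "ZW \<in> M \<rightarrow>\<^sub>M count_space ?C" and X: "X \<in> M \<rightarrow>\<^sub>M ?N"
    and law: "\<And>c A. c \<in> ?C \<Longrightarrow> A \<in> sets ?N \<Longrightarrow>
      measure M {\<omega>\<in>space M. ZW \<omega> = c \<and> X \<omega> \<in> A} = prior S n k \<theta>\<^sub>0 c * measure (cond_law S n k \<pi>\<^sub>0 c) A"
    using data by (auto simp: block_data_def k_def)
  have "\<forall>c\<^sub>0\<in>?B. \<forall>c\<in>?C - {c\<^sub>0}. \<exists>A. A \<in> sets ?N \<and> dev c\<^sub>0 c \<subseteq> A \<and>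
      measure (cond_law S n k \<pi>\<^sub>0 c\<^sub>0) A \<le> 2 * exp (- (\<psi>' * ?R c\<^sub>0 c))"
  proof (intro ballI)
    fix c\<^sub>0 c assume "c\<^sub>0 \<in> ?B" "c \<in> ?C - {c\<^sub>0}"
    then show "\<exists>A. A \<in> sets ?N \<and> dev c\<^sub>0 c \<subseteq> A \<and>
        measure (cond_law S n k \<pi>\<^sub>0 c\<^sub>0) A \<le> 2 * exp (- (\<psi>' * ?R c\<^sub>0 c))"
      using concentration_event[OF conc n mn _ _ _ \<rho> \<psi>', of c\<^sub>0 c] unfolding dev_def k_def by blast
  qed
  then obtain A where A: "\<And>c\<^sub>0 c. c\<^sub>0 \<in> ?B \<Longrightarrow> c \<in> ?C - {c\<^sub>0} \<Longrightarrow> A c\<^sub>0 c \<in> sets ?N"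
    "\<And>c\<^sub>0 c. c\<^sub>0 \<in> ?B \<Longrightarrow> c \<in> ?C - {c\<^sub>0} \<Longrightarrow> dev c\<^sub>0 c \<subseteq> A c\<^sub>0 c"
    "\<And>c\<^sub>0 c. c\<^sub>0 \<in> ?B \<Longrightarrow> c \<in> ?C - {c\<^sub>0} \<Longrightarrow>
      measure (cond_law S n k \<pi>\<^sub>0 c\<^sub>0) (A c\<^sub>0 c) \<le> 2 * exp (- (\<psi>' * ?R c\<^sub>0 c))"
    by metis
  define F where "F c A = {\<omega>\<in>space M. ZW \<omega> = c \<and> X \<omega> \<in> A}" for c A
  have F_sets: "F c A \<in> sets M" if "c \<in> ?C" "A \<in> sets ?N" for c A
  proof -
    have "F c A = (ZW -` {c} \<inter> space M) \<inter> (X -` A \<inter> space M)" by (auto simp: F_def)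
    then show ?thesis using that by (auto intro!: sets.Int measurable_sets[OF ZW] measurable_sets[OF X])
  qed
  define U where "U = (\<Union>c\<in>?C - ?B. F c (space ?N))"
  define V where "V = (\<Union>c\<^sub>0\<in>?B. \<Union>c\<in>?C - {c\<^sub>0}. F c\<^sub>0 (A c\<^sub>0 c))"
  have U: "U \<in> sets M" unfolding U_def using fin F_sets by (intro sets.finite_UN) auto
  have FA: "F c\<^sub>0 (A c\<^sub>0 c) \<in> sets M" if "c\<^sub>0 \<in> ?B" "c \<in> ?C - {c\<^sub>0}" for c\<^sub>0 c
    using F_sets A(1)[OF that] that(1) BC by blast
  have V1: "(\<Union>c\<in>?C - {c\<^sub>0}. F c\<^sub>0 (A c\<^sub>0 c)) \<in> sets M" if "c\<^sub>0 \<in> ?B" for c\<^sub>0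
    using fin FA[OF that] by (intro sets.finite_UN) auto
  have V: "V \<in> sets M" unfolding V_def by (intro sets.finite_UN fin(2) V1)
  have prior_nn: "c \<in> ?C \<Longrightarrow> 0 \<le> prior S n k \<theta>\<^sub>0 c" for c by (rule prior_nonneg[OF valid \<theta>\<^sub>0])
  have "measure M U \<le> (\<Sum>c\<in>?C - ?B. measure M (F c (space ?N)))"
    unfolding U_def using fin F_sets by (intro M.finite_measure_subadditive_finite) auto
  also have "\<dots> \<le> (\<Sum>c\<in>?C - ?B. prior S n k \<theta>\<^sub>0 c)"
  proof (intro sum_mono)
    fix c assume c: "c \<in> ?C - ?B"
    interpret P: prob_space "cond_law S n k \<pi>\<^sub>0 c" using c by (intro prob_space_cond_law \<pi>\<^sub>0) auto
    have "prior S n k \<theta>\<^sub>0 c * measure (cond_law S n k \<pi>\<^sub>0 c) (space ?N) \<le> prior S n k \<theta>\<^sub>0 c * 1"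
      using c prior_nn by (intro mult_left_mono P.prob_le_1) auto
    then show "measure M (F c (space ?N)) \<le> prior S n k \<theta>\<^sub>0 c"
      using law[of c "space ?N"] c by (simp add: F_def)
  qed
  also have "\<dots> \<le> nrows S * exp (- (n * \<mu> / 200)) + ncols S * exp (- (k * \<mu> / 200))"
    by (rule sum_prior_unbalanced_le[OF valid \<theta>\<^sub>0 mk])
  finally have Ule: "measure M U \<le> nrows S * exp (- (n * \<mu> / 200)) + ncols S * exp (- (k * \<mu> / 200))" .
  have "measure M V \<le> (\<Sum>c\<^sub>0\<in>?B. measure M (\<Union>c\<in>?C - {c\<^sub>0}. F c\<^sub>0 (A c\<^sub>0 c)))"
    unfolding V_def by (intro M.finite_measure_subadditive_finite fin(2) image_subsetI V1)
  also have "\<dots> \<le> (\<Sum>c\<^sub>0\<in>?B. prior S n k \<theta>\<^sub>0 c\<^sub>0 * (2 * (y * exp y)))"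
  proof (intro sum_mono)
    fix c\<^sub>0 assume c\<^sub>0: "c\<^sub>0 \<in> ?B"
    then have c\<^sub>0': "c\<^sub>0 \<in> ?C" using BC by auto
    have "measure M (\<Union>c\<in>?C - {c\<^sub>0}. F c\<^sub>0 (A c\<^sub>0 c)) \<le> (\<Sum>c\<in>?C - {c\<^sub>0}. measure M (F c\<^sub>0 (A c\<^sub>0 c)))"
      using fin FA[OF c\<^sub>0] by (intro M.finite_measure_subadditive_finite) auto
    also have "\<dots> \<le> (\<Sum>c\<in>?C - {c\<^sub>0}. prior S n k \<theta>\<^sub>0 c\<^sub>0 * (2 * exp (- (\<psi>' * ?R c\<^sub>0 c))))"
      unfolding F_def using A c\<^sub>0 c\<^sub>0' prior_nn by (intro sum_mono) (simp add: law mult_left_mono)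
    also have "\<dots> = prior S n k \<theta>\<^sub>0 c\<^sub>0 * (2 * (\<Sum>c\<in>?C - {c\<^sub>0}. exp (- (\<psi>' * ?R c\<^sub>0 c))))"
      by (simp add: sum_distrib_left)
    also have "\<dots> \<le> prior S n k \<theta>\<^sub>0 c\<^sub>0 * (2 * (y * exp y))"
      using sum_exp_weighted_dist_le[OF valid mk c\<^sub>0', of 0 \<psi>'] prior_nn[OF c\<^sub>0']
      by (intro mult_left_mono) (auto simp: y_def k_def)
    finally show "measure M (\<Union>c\<in>?C - {c\<^sub>0}. F c\<^sub>0 (A c\<^sub>0 c)) \<le> prior S n k \<theta>\<^sub>0 c\<^sub>0 * (2 * (y * exp y))" .
  qed
  also have "\<dots> = (\<Sum>c\<^sub>0\<in>?B. prior S n k \<theta>\<^sub>0 c\<^sub>0) * (2 * (y * exp y))" by (simp add: sum_distrib_right)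
  also have "\<dots> \<le> 1 * (2 * (y * exp y))"
  proof (rule mult_right_mono)
    have "(\<Sum>c\<^sub>0\<in>?B. prior S n k \<theta>\<^sub>0 c\<^sub>0) \<le> (\<Sum>c\<^sub>0\<in>?C. prior S n k \<theta>\<^sub>0 c\<^sub>0)"
      using fin BC prior_nn by (intro sum_mono2) auto
    then show "(\<Sum>c\<^sub>0\<in>?B. prior S n k \<theta>\<^sub>0 c\<^sub>0) \<le> 1" by (simp only: sum_prior[OF valid \<theta>\<^sub>0])
  qed (simp add: y_def a_bound_nonneg)
  finally have Vle: "measure M V \<le> 2 * (y * exp y)" by simp
  have "measure M (U \<union> V) \<le> nrows S * exp (- (n * \<mu> / 200)) + ncols S * exp (- (k * \<mu> / 200)) + 2 * (y * exp y)"
    using measure_Un_le[OF U V] Ule Vle by linarith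
  then have "1 - measure M (space M - (U \<union> V)) \<le>
      nrows S * exp (- (n * \<mu> / 200)) + ncols S * exp (- (k * \<mu> / 200)) + 2 * (y * exp y)"
    using U V by (simp add: M.prob_compl)
  moreover have "ZW \<omega> \<in> ?B \<and> X \<omega> \<in> typical_data n k \<rho> (ZW \<omega>)" if \<omega>: "\<omega> \<in> space M - (U \<union> V)" for \<omega>
  proof -
    have c\<^sub>0: "ZW \<omega> \<in> ?C" and x: "X \<omega> \<in> space ?N"
      using \<omega> measurable_space[OF ZW] measurable_space[OF X] by auto
    have B: "ZW \<omega> \<in> ?B" using \<omega> c\<^sub>0 x by (auto simp: U_def F_def)
    have "X \<omega> \<notin> dev (ZW \<omega>) c" if "c \<in> ?C - {ZW \<omega>}" for c
      using \<omega> A(2)[OF B that] B that by (auto simp: V_def F_def)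
    then have "X \<omega> \<in> typical_data n k \<rho> (ZW \<omega>)"
      using x by (auto simp: typical_data_def dev_def not_le)
    then show ?thesis using B by simp
  qed
  moreover have "space M - (U \<union> V) \<in> sets M" using U V by auto
  ultimately show ?thesis unfolding k_def by blast
qed

end

text \<open>Two configurations cannot share a total posterior mass of \<open>1\<close> if both have more than
  half of it.\<close>

lemma unique_MAP:
  assumes S: "valid_model S" and \<theta>: "\<theta> \<in> Theta S" and x: "x \<in> space (data_space S n m)"
    and c\<^sub>0: "c\<^sub>0 \<in> configs S n m" and half: "posterior S n m \<theta> x c\<^sub>0 > 1 / 2"
    and MAP: "is_MAP S n m \<theta> x c"
  shows "c = c\<^sub>0"
proof (rule ccontr)
  assume "c \<noteq> c\<^sub>0"
  have c: "c \<in> configs S n m" and "\<not> posterior S n m \<theta> x c < posterior S n m \<theta> x c\<^sub>0"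
    using MAP c\<^sub>0 unfolding is_MAP_def is_arg_max_def by blast+
  then have "1 < (\<Sum>c\<in>{c, c\<^sub>0}. posterior S n m \<theta> x c)" using half \<open>c \<noteq> c\<^sub>0\<close> by simp
  also have "\<dots> \<le> (\<Sum>c\<in>configs S n m. posterior S n m \<theta> x c)"
    using c c\<^sub>0 finite_configs posterior_bounds(1)[OF S \<theta> _ x] by (intro sum_mono2) auto
  also have "\<dots> \<le> 1"
    unfolding posterior_def sum_divide_distrib[symmetric] by simp
  finally show False by simp
qed

theorem corollary1:
  fixes S :: "('x, 'p::real_normed_vector) block_model"
    and \<theta>\<^sub>0 :: "'p param"
    and G :: "((nat \<Rightarrow> nat) \<times> (nat \<Rightarrow> nat)) set"
    and m :: "nat \<Rightarrow> nat"
    and \<psi> :: "real \<Rightarrow> ereal"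
    and M :: "'o measure"
    and ZW :: "nat \<Rightarrow> 'o \<Rightarrow> config"
    and X :: "nat \<Rightarrow> 'o \<Rightarrow> nat \<times> nat \<Rightarrow> 'x"
    and L\<^sub>0 c C K :: real
  assumes "valid_model S"
    and "\<theta>\<^sub>0 \<in> Theta S"
    and "prob_space M"
    and "\<And>n. block_data S n (m n) \<theta>\<^sub>0 M (ZW n) (X n)"
    and "identifiability S"
    and "symmetry_group S G"
    and "concentration S G m (conn \<theta>\<^sub>0) \<psi>"
    and "kappa_max S < \<infinity>"
    and "lipschitz_condition S L\<^sub>0"
    and "asymptotic_setup S m"
    and "G = {(id, id)}"
    and "c = (mu_min S)\<^sup>2 * real_of_ereal (kappa_min S (conn \<theta>\<^sub>0)) / 16"
    and "C = 2 * real_of_ereal (kappa_max S)"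
    and "K = max (ln (alpha_max S / alpha_min S)) (ln (beta_max S / beta_min S))"
  shows "\<forall>\<eta>. 0 < \<eta> \<and> \<eta> < c / (2 * L\<^sub>0) \<longrightarrow>
    (\<exists>(\<epsilon> :: nat \<Rightarrow> nat \<Rightarrow> real) (\<Omega>\<^sub>1 :: nat \<Rightarrow> 'o set).
       (\<forall>n k. \<epsilon> n k > 0) \<and> summable (\<lambda>n. \<epsilon> n (m n)) \<and>
       (\<forall>n. \<Omega>\<^sub>1 n \<in> sets M \<and> measure M (\<Omega>\<^sub>1 n) \<ge> 1 - \<epsilon> n (m n)) \<and>
       (\<forall>n. \<forall>\<omega>\<in>\<Omega>\<^sub>1 n. \<forall>\<theta>\<in>Theta S. conn_dist S (conn \<theta>) (conn \<theta>\<^sub>0) \<le> \<eta> \<longrightarrow>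
          (let a = a_bound S (c - 2 * L\<^sub>0 * \<eta>) K n (m n);
               b = b_bound S C K n (m n);
               p = posterior S n (m n) \<theta> (X n \<omega>) (ZW n \<omega>)
           in p \<ge> 1 - a * exp a \<and> (nrows S \<ge> 2 \<longrightarrow> p \<le> inverse (1 + b * exp b)))) \<and>
       (\<lambda>n. a_bound S (c - 2 * L\<^sub>0 * \<eta>) K n (m n)) \<longlonglongrightarrow> 0 \<and>
       (\<lambda>n. b_bound S C K n (m n)) \<longlonglongrightarrow> 0 \<and>
       (\<forall>(\<theta>' :: nat \<Rightarrow> 'o \<Rightarrow> 'p param) (ZW' :: nat \<Rightarrow> 'o \<Rightarrow> config). \<forall>\<omega>\<in>space M.
          (\<forall>n. \<theta>' n \<omega> \<in> Theta S) \<and>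
          (\<lambda>n. conn_dist S (conn (\<theta>' n \<omega>)) (conn \<theta>\<^sub>0)) \<longlonglongrightarrow> 0 \<and>
          (\<forall>n. is_MAP S n (m n) (\<theta>' n \<omega>) (X n \<omega>) (ZW' n \<omega>)) \<longrightarrow>
          (\<forall>\<^sub>F n in sequentially. \<omega> \<in> \<Omega>\<^sub>1 n \<longrightarrow>
             misclassified S n (m n) (ZW' n \<omega>) (ZW n \<omega>) = 0)))"
proof (intro allI impI, elim conjE)
  fix \<eta> assume \<eta>: "0 < \<eta>" "\<eta> < c / (2 * L\<^sub>0)"
  note S = assms(1) and \<theta>\<^sub>0 = assms(2) and M = assms(3) and data = assms(4) and asy = assms(10)
    and c_def = assms(12) and C_def = assms(13) and K_def = assms(14)
  interpret M: prob_space M by (rule M)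
  have L0: "L\<^sub>0 > 0" using assms(9) by (simp add: lipschitz_condition_def)
  have m_SBM: "variant S \<noteq> LBM \<longrightarrow> m n = n" for n by (rule m_SBM[OF asy])
  define \<kappa> where "\<kappa> = real_of_ereal (kappa_min S (conn \<theta>\<^sub>0))"
  have "0 < c" using \<eta> L0 by (simp add: field_simps) (smt (verit) mult_pos_pos)
  then have \<kappa>: "\<kappa> > 0" unfolding c_def \<kappa>_def by (simp add: zero_less_mult_iff)
  then have kmin: "kappa_min S (conn \<theta>\<^sub>0) = ereal \<kappa>"
    unfolding \<kappa>_def by (cases "kappa_min S (conn \<theta>\<^sub>0)") auto
  interpret recovery S \<theta>\<^sub>0 L\<^sub>0 \<kappa>
    using assms kmin \<kappa> by unfold_locales auto
  define \<mu> where "\<mu> = mu_min S"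
  have \<mu>: "0 < \<mu>" "\<mu> \<le> 1" using mu_bounds by (simp_all add: \<mu>_def)
  define \<gamma> where "\<gamma> = c - 2 * L\<^sub>0 * \<eta>"
  have \<gamma>: "\<gamma> > 0" using \<eta> L0 by (simp add: \<gamma>_def field_simps)
  \<comment> \<open>Half of the margin \<open>7/100 - 1/16 = 6/800\<close>: one half for the deviations, the other for the number of labels.\<close>
  define \<rho> where "\<rho> = 3 / 800 * \<mu>\<^sup>2 * \<kappa>"
  have \<rho>: "\<rho> > 0" using \<mu> \<kappa> by (simp add: \<rho>_def)
  have rate: "7 / 100 * \<mu>\<^sup>2 * \<kappa> - 2 * L\<^sub>0 * \<eta> - \<rho> = \<gamma> + \<rho>"
    by (simp add: \<gamma>_def \<rho>_def c_def \<mu>_def \<kappa>_def)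
  have C: "C = 2 * real_of_ereal (kappa_max S)" by (rule C_def)
  have \<rho>_less: "\<rho> < real_of_ereal (kappa_max S)"
  proof -
    have "\<mu>\<^sup>2 * \<kappa> \<le> 1 * \<kappa>" using \<mu> \<kappa> by (intro mult_right_mono) (auto simp: power_le_one)
    moreover have "\<rho> = 3 / 800 * (\<mu>\<^sup>2 * \<kappa>)" by (simp add: \<rho>_def)
    ultimately show ?thesis using kappa_le_kappa_max \<kappa> by linarith
  qed
  have C_pos: "C > 0" using \<rho> \<rho>_less by (simp add: C)
  have K: "ln (alpha_max S / alpha_min S) \<le> K" "ln (beta_max S / beta_min S) \<le> K" by (simp_all add: K_def)
  have conc: "concentration S {(id, id)} m (conn \<theta>\<^sub>0) \<psi>" using assms by simp
  have "\<psi> \<rho> > 0" using conc \<rho> by (simp add: concentration_def)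
  \<comment> \<open>The rate may be infinite; any smaller positive real number serves.\<close>
  then obtain \<psi>' :: real where \<psi>': "\<psi>' > 0" "ereal \<psi>' \<le> \<psi> \<rho>"
    using ereal_dense2[of 0 "\<psi> \<rho>"] by (auto simp: less_imp_le)
  let ?a = "\<lambda>n. a_bound S \<gamma> K n (m n)" and ?b = "\<lambda>n. b_bound S C K n (m n)"
  let ?y = "\<lambda>n. a_bound S \<psi>' (ln (nrows S + ncols S)) n (m n)"
  define tail where "tail n = nrows S * exp (- (n * \<mu> / 200)) + ncols S * exp (- (m n * \<mu> / 200)) + 2 * (?y n * exp (?y n))" for n
  have "\<forall>n\<in>{1..}. \<exists>B. B \<in> sets M \<and>
    (\<forall>\<omega>\<in>B. ZW n \<omega> \<in> balanced_configs S (9 / 10 * \<mu>) n (m n) \<and> X n \<omega> \<in> typical_data n (m n) \<rho> (ZW n \<omega>)) \<and>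
    1 - measure M B \<le> tail n"
    using typical_event[OF M data conc _ m_SBM \<rho> \<psi>'(2)] unfolding tail_def \<mu>_def by (simp add: Bex_def)
  then obtain B where B: "\<And>n. n \<ge> 1 \<Longrightarrow> B n \<in> sets M"
    "\<And>n \<omega>. n \<ge> 1 \<Longrightarrow> \<omega> \<in> B n \<Longrightarrow> ZW n \<omega> \<in> balanced_configs S (9 / 10 * \<mu>) n (m n)"
    "\<And>n \<omega>. n \<ge> 1 \<Longrightarrow> \<omega> \<in> B n \<Longrightarrow> X n \<omega> \<in> typical_data n (m n) \<rho> (ZW n \<omega>)"
    "\<And>n. n \<ge> 1 \<Longrightarrow> 1 - measure M (B n) \<le> tail n"
    by (auto dest!: bchoice)
  define large where "large n \<longleftrightarrow> n \<ge> 1 \<and> m n \<ge> 1 \<and> real n * \<mu>\<^sup>2 \<ge> 50 \<and>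
    ln (nrows S + ncols S) \<le> \<rho> * real (m n) \<and>
    ?b n * exp (?b n) \<le> real n * exp (- K - (real_of_ereal (kappa_max S) + \<rho>) * flip_dist S n (m n))" for n
  have large: "eventually large sequentially"
  proof -
    have "eventually (\<lambda>n. 50 / \<mu>\<^sup>2 \<le> real (m n)) sequentially"
      "eventually (\<lambda>n. ln (nrows S + ncols S) / \<rho> \<le> real (m n)) sequentially"
      "eventually (\<lambda>n. 1 \<le> real (m n)) sequentially"
      by (intro eventually_real_m_ge[OF asy])+
    moreover have "eventually (\<lambda>n. ?b n * exp (?b n) \<le>
        real n * exp (- K - (real_of_ereal (kappa_max S) + \<rho>) * flip_dist S n (m n))) sequentially"
      unfolding C using \<rho> \<rho>_less by (intro eventually_b_bound_le[OF asy]) auto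
    ultimately show ?thesis
    proof eventually_elim
      case (elim n)
      have "m n \<le> n" by (rule m_le[OF asy])
      then have "50 / \<mu>\<^sup>2 \<le> real n" using elim(1) by linarith
      then show ?case
        using elim \<open>m n \<le> n\<close> \<mu> \<rho> by (auto simp: large_def field_simps)
    qed
  qed
  \<comment> \<open>The geometric term makes \<open>\<epsilon>\<close> positive even where the event has probability one.\<close>
  define \<Omega> where "\<Omega> n = (if large n then B n else {})" for n
  define \<epsilon> :: "nat \<Rightarrow> nat \<Rightarrow> real" where "\<epsilon> n k = 1 - measure M (\<Omega> n) + (1 / 2) ^ n" for n k
  have \<Omega>_sets: "\<Omega> n \<in> sets M" for n using B(1) by (auto simp: \<Omega>_def large_def)
  have \<epsilon>_pos: "\<epsilon> n k > 0" for n k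
    unfolding \<epsilon>_def using M.prob_le_1[of "\<Omega> n"] by (intro add_nonneg_pos) auto
  have \<epsilon>_summable: "summable (\<lambda>n. \<epsilon> n (m n))"
    unfolding \<epsilon>_def
  proof (intro summable_add summable_geometric)
    have "summable tail"
      unfolding tail_def
    proof (intro summable_add summable_mult)
      have exp_m: "summable (\<lambda>n. exp (- (m n * \<mu> / 200)))"
        using summable_exp_m[OF asy, of "\<mu> / 200"] \<mu> by (simp add: mult.commute)
      then show "summable (\<lambda>n. exp (- (m n * \<mu> / 200)))" .
      show "summable (\<lambda>n. exp (- (n * \<mu> / 200)))"
        by (rule summable_comparison_test_ev[OF _ exp_m])
          (use m_le[OF asy] \<mu> in \<open>auto intro!: always_eventually mult_right_mono divide_right_mono\<close>)
      show "summable (\<lambda>n. ?y n * exp (?y n))" by (rule summable_a_bound_exp[OF asy \<psi>'(1)])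
    qed
    then show "summable (\<lambda>n. 1 - measure M (\<Omega> n))"
    proof (rule summable_comparison_test_ev[rotated])
      show "eventually (\<lambda>n. norm (1 - measure M (\<Omega> n)) \<le> tail n) sequentially"
        using large
      proof eventually_elim
        case (elim n)
        then show ?case using B(4)[of n] M.prob_le_1[of "\<Omega> n"] by (simp add: \<Omega>_def large_def)
      qed
    qed
  qed simp
  have post: "1 - ?a n * exp (?a n) \<le> posterior S n (m n) \<theta> (X n \<omega>) (ZW n \<omega>)"
      "nrows S \<ge> 2 \<Longrightarrow> posterior S n (m n) \<theta> (X n \<omega>) (ZW n \<omega>) \<le> inverse (1 + ?b n * exp (?b n))"
    if \<omega>: "\<omega> \<in> \<Omega> n" and \<theta>: "\<theta> \<in> Theta S" "conn_dist S (conn \<theta>) (conn \<theta>\<^sub>0) \<le> \<eta>" for n \<omega> \<theta>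
  proof -
    have n: "large n" and \<omega>B: "\<omega> \<in> B n" using \<omega> by (auto simp: \<Omega>_def split: if_splits)
    then have n1: "n \<ge> 1" "m n \<ge> 1" by (auto simp: large_def)
    note bal = B(2)[OF n1(1) \<omega>B] and typical = B(3)[OF n1(1) \<omega>B]
    have cfg: "ZW n \<omega> \<in> configs S n (m n)" using bal by (auto simp: balanced_configs_def)
    have "a_bound S (\<gamma> + \<rho>) (K + ln (nrows S + ncols S)) n (m n) \<le> ?a n"
      using n \<rho> by (intro a_bound_absorb_factor m_le[OF asy] m_SBM) (auto simp: large_def)
    then show "1 - ?a n * exp (?a n) \<le> posterior S n (m n) \<theta> (X n \<omega>) (ZW n \<omega>)"
      using n \<eta> n1 bal unfolding rate[symmetric] \<mu>_def
      by (intro typical_posterior_ge[OF typical \<theta> _ m_SBM _ _ _ _ K]) (auto simp: large_def \<mu>_def)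
    show "posterior S n (m n) \<theta> (X n \<omega>) (ZW n \<omega>) \<le> inverse (1 + ?b n * exp (?b n))" if "nrows S \<ge> 2"
      using n that n1
      by (intro typical_posterior_le[OF typical \<theta>(1) m_SBM _ _ _ cfg K])
        (auto simp: large_def b_bound_eq_a_bound a_bound_nonneg)
  qed
  have a_lim: "?a \<longlonglongrightarrow> 0" by (rule a_bound_tendsto_0[OF asy \<gamma>])
  have b_lim: "?b \<longlonglongrightarrow> 0" unfolding b_bound_eq_a_bound by (rule a_bound_tendsto_0[OF asy C_pos])
  have MAP: "eventually (\<lambda>n. \<omega> \<in> \<Omega> n \<longrightarrow> misclassified S n (m n) (ZW' n \<omega>) (ZW n \<omega>) = 0) sequentially"
    if \<omega>: "\<omega> \<in> space M" and \<theta>': "\<And>n. \<theta>' n \<omega> \<in> Theta S"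
      and conv: "(\<lambda>n. conn_dist S (conn (\<theta>' n \<omega>)) (conn \<theta>\<^sub>0)) \<longlonglongrightarrow> 0"
      and ZW': "\<And>n. is_MAP S n (m n) (\<theta>' n \<omega>) (X n \<omega>) (ZW' n \<omega>)"
    for \<theta>' :: "nat \<Rightarrow> 'o \<Rightarrow> 'p param" and ZW' :: "nat \<Rightarrow> 'o \<Rightarrow> config" and \<omega>
  proof -
    have "(\<lambda>n. ?a n * exp (?a n)) \<longlonglongrightarrow> 0 * exp 0" by (intro tendsto_intros a_lim)
    then have "eventually (\<lambda>n. ?a n * exp (?a n) < 1 / 2) sequentially"
      by (intro order_tendstoD(2)[where y = 0]) auto
    moreover have "eventually (\<lambda>n. conn_dist S (conn (\<theta>' n \<omega>)) (conn \<theta>\<^sub>0) < \<eta>) sequentially"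
      using order_tendstoD(2)[OF conv \<eta>(1)] .
    ultimately show ?thesis
    proof eventually_elim
      case (elim n)
      show ?case
      proof
        assume \<omega>\<Omega>: "\<omega> \<in> \<Omega> n"
        have "1 / 2 < posterior S n (m n) (\<theta>' n \<omega>) (X n \<omega>) (ZW n \<omega>)"
          using post(1)[OF \<omega>\<Omega> \<theta>' less_imp_le[OF elim(2)]] elim(1) by linarith
        moreover have "X n \<omega> \<in> space (data_space S n (m n))" "ZW n \<omega> \<in> configs S n (m n)"
          using data[of n] \<omega> by (auto simp: block_data_def dest: measurable_space)
        ultimately have "ZW' n \<omega> = ZW n \<omega>" using unique_MAP[OF S \<theta>' _ _ _ ZW'] by blast
        then show "misclassified S n (m n) (ZW' n \<omega>) (ZW n \<omega>) = 0"
          by (cases "ZW n \<omega>") (simp add: misclassified_def split: variant.splits)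
      qed
    qed
  qed
  show "\<exists>(\<epsilon> :: nat \<Rightarrow> nat \<Rightarrow> real) (\<Omega>\<^sub>1 :: nat \<Rightarrow> 'o set).
       (\<forall>n k. \<epsilon> n k > 0) \<and> summable (\<lambda>n. \<epsilon> n (m n)) \<and>
       (\<forall>n. \<Omega>\<^sub>1 n \<in> sets M \<and> measure M (\<Omega>\<^sub>1 n) \<ge> 1 - \<epsilon> n (m n)) \<and>
       (\<forall>n. \<forall>\<omega>\<in>\<Omega>\<^sub>1 n. \<forall>\<theta>\<in>Theta S. conn_dist S (conn \<theta>) (conn \<theta>\<^sub>0) \<le> \<eta> \<longrightarrow>
          (let a = a_bound S (c - 2 * L\<^sub>0 * \<eta>) K n (m n);
               b = b_bound S C K n (m n);
               p = posterior S n (m n) \<theta> (X n \<omega>) (ZW n \<omega>)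
           in p \<ge> 1 - a * exp a \<and> (nrows S \<ge> 2 \<longrightarrow> p \<le> inverse (1 + b * exp b)))) \<and>
       (\<lambda>n. a_bound S (c - 2 * L\<^sub>0 * \<eta>) K n (m n)) \<longlonglongrightarrow> 0 \<and>
       (\<lambda>n. b_bound S C K n (m n)) \<longlonglongrightarrow> 0 \<and>
       (\<forall>(\<theta>' :: nat \<Rightarrow> 'o \<Rightarrow> 'p param) (ZW' :: nat \<Rightarrow> 'o \<Rightarrow> config). \<forall>\<omega>\<in>space M.
          (\<forall>n. \<theta>' n \<omega> \<in> Theta S) \<and>
          (\<lambda>n. conn_dist S (conn (\<theta>' n \<omega>)) (conn \<theta>\<^sub>0)) \<longlonglongrightarrow> 0 \<and>
          (\<forall>n. is_MAP S n (m n) (\<theta>' n \<omega>) (X n \<omega>) (ZW' n \<omega>)) \<longrightarrow>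
          (\<forall>\<^sub>F n in sequentially. \<omega> \<in> \<Omega>\<^sub>1 n \<longrightarrow>
             misclassified S n (m n) (ZW' n \<omega>) (ZW n \<omega>) = 0))"
    unfolding \<gamma>_def[symmetric] Let_def
  proof (intro exI[of _ \<epsilon>] exI[of _ \<Omega>] conjI allI ballI impI)
    show "measure M (\<Omega> n) \<ge> 1 - \<epsilon> n (m n)" for n by (simp add: \<epsilon>_def)
  qed (use \<epsilon>_pos \<epsilon>_summable \<Omega>_sets post a_lim b_lim MAP in blast)+
qed

end
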